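(* Let $f(z)=(b_1z,b_2z^2,b_3z^3,\dots)$ and $\tilde f(z)=(\tilde b_1z,\tilde b_2z^2,\tilde b_3z^3,\dots)$ be functions of $\overline{\mathbb{D}}$ into $\mathbb{B}_\infty$, with $\|(b_n)\|_2=r<1$, $\|(\tilde b_n)\|_2=r'<1$ and $b_1\tilde b_1\neq0$, such that the series $\sum_{n\ge1}|b_n|^2z^n$ and $\sum_{n\ge1}|\tilde b_n|^2z^n$ both have radius of convergence $1$. Let $V=f(\mathbb{D})$, $\tilde V=\tilde f(\mathbb{D})$, $\overline V=f(\overline{\mathbb{D}})$ and $\overline{\tilde V}=\tilde f(\overline{\mathbb{D}})$. Define $(a_n)_{n\ge0}$ and $(\tilde a_n)_{n\ge0}$ by $\sum_{n\ge0}a_nz^n=\big(1-\sum_{n\ge1}|b_n|^2z^n\big)^{-1}$ and $\sum_{n\ge0}\tilde a_nz^n=\big(1-\sum_{n\ge1}|\tilde b_n|^2z^n\big)^{-1}$ for $z\in\mathbb{D}$. (1) $\mathcal{M}_{\overline V}$ and $\mathcal{M}_{\overline{\tilde V}}$ are isomorphic via the natural map $h\mapsto h\circ f\circ\tilde f^{-1}$ if and only if the sequences $(a_n)$ and $(\tilde a_n)$ are comparable. (2) Suppose that \[ \sup_{n\ge1}\sum_{k=0}^n\frac{a_ka_{n-k}}{a_n}<\infty \] and that $\mathcal{M}_{\overline V}$ is automorphism invariant. Assume that $\phi:\mathcal{M}_{\overline V}\to\mathcal{M}_{\overline{\tilde V}}$ is an algebra isomorphism. Then the restriction $F$ of $\phi^*$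 to $\overline{\tilde V}$ (points of $\overline{\tilde V}$ and $\overline V$ being identified with the corresponding point evaluation characters) is a homeomorphism of $\overline{\tilde V}$ onto $\overline V$ which is holomorphic on $\tilde V$, and $\phi(h)=h\circ F$ for all $h\in\mathcal{M}_{\overline V}$. There is a M\"obius map $\theta$ of $\mathbb{D}$ such that $C_{\tilde f}\circ\phi=C_\theta\circ C_f$, where $C_f:\mathcal{M}_{\overline V}\to\mathrm{A}(\mathbb{D})$, $C_{\tilde f}:\mathcal{M}_{\overline{\tilde V}}\to\mathrm{A}(\mathbb{D})$ and $C_\theta:\mathrm{A}(\mathbb{D})\to\mathrm{A}(\mathbb{D})$ are the composition operators $h\mapsto h\circ f$, $h\mapsto h\circ\tilde f$, $h\mapsto h\circ\theta$. Moreover, $\mathcal{M}_{\overline V}$ and $\mathcal{M}_{\overline{\tilde V}}$ are isomorphic via the natural map of composition with $G=f\circ\tilde f^{-1}$.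
   Context: $\mathbb{B}_\infty$ is the open unit ball of $\ell^2$. The Drury-Arveson space $\mathcal{H}_\infty$ is the reproducing kernel Hilbert space on $\mathbb{B}_\infty$ with kernel $k(x,y)=\frac{1}{1-\langle x,y\rangle}$, $k_y(x)=k(x,y)$. For $X\subset\mathbb{B}_\infty$ a variety (an intersection of zero sets in $\mathbb{B}_\infty$ of multipliers of $\mathcal{H}_\infty$), $\mathcal{H}_X=\overline{\operatorname{span}}\{k_y:y\in X\}$, considered as a Hilbert space of functions on $X$, and $\mathcal{M}_X$ is its multiplier algebra (functions on $X$). The compact sets $\overline V$, $\overline{\tilde V}$ above are varieties in $\mathbb{B}_\infty$, and the functions in $\mathcal{M}_{\overline V}$, $\mathcal{M}_{\overline{\tilde V}}$ are continuous. The character space $M(\mathcal{M}_X)$ is the set of nonzero multiplicative linear functionals on $\mathcal{M}_X$; for $v\in X$, $\rho_v(h)=h(v)$. For an algebra isomorphism $\phi:\mathcal{M}_X\to\mathcal{M}_Y$, $\phi^*:M(\mathcal{M}_Y)\to M(\mathcal{M}_X)$ is $\phi^*(\rho)=\rho\circ\phi$. A map on a subset of $\ell^2$ is holomorphic if near each point of the subset it is the restriction of a holomorphic map on a ball about that point. $\mathrm{A}(\mathbb{D})$ is the disc algebra (continuous functions on $\overline{\mathbb{D}}$ analytic on $\mathbb{D}$). M\"obius maps of $\mathbb{D}$ are the conformal automorphisms of $\mathbb{D}$ (extended to $\overline{\mathbb{D}}$). $\mathcal{M}_{\overline V}$ is automorphism invariant if for every M\"obius map $\theta$, composition with $f\circ\theta\circ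 f^{-1}$ is an automorphism of $\mathcal{M}_{\overline V}$. "Isomorphic via the natural map" means that $h\mapsto h\circ f\circ\tilde f^{-1}$ is an isomorphism of $\mathcal{M}_{\overline V}$ onto $\mathcal{M}_{\overline{\tilde V}}$. Two positive sequences are comparable if their ratio is bounded above and bounded below by positive constants. *)

theory Defs
  imports "HOL-Complex_Analysis.Complex_Analysis"
begin

section \<open>The complex Hilbert space of square summable sequences\<close>

typedef ell2 = "{x :: nat \<Rightarrow> complex. summable (\<lambda>n. (cmod (x n))\<^sup>2)}"
  morphisms coord Abs_ell2
  by (rule exI[of _ "\<lambda>_. 0"]) simp

lemma ell2_eqI: "(\<And>n. coord x n = coord y n) \<Longrightarrow> x = y"
  by (metis coord_inject ext)

lemma summable_coord: "summable (\<lambda>n. (cmod (coord x n))\<^sup>2)"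
  using coord[of x] by simp

lemma cmod_add_sq_le: "(cmod (a + b))\<^sup>2 \<le> 2 * (cmod a)\<^sup>2 + 2 * (cmod b)\<^sup>2"
proof -
  have "(cmod (a + b))\<^sup>2 \<le> (cmod a + cmod b)\<^sup>2"
    by (intro power_mono norm_triangle_ineq) simp
  also have "\<dots> \<le> 2 * (cmod a)\<^sup>2 + 2 * (cmod b)\<^sup>2"
    using sum_squares_bound[of "cmod a" "cmod b"] by (simp add: power2_sum)
  finally show ?thesis .
qed

definition ell2_cinner :: "ell2 \<Rightarrow> ell2 \<Rightarrow> complex" where
  "ell2_cinner x y = (\<Sum>n. coord x n * cnj (coord y n))"

definition ell2_scale :: "complex \<Rightarrow> ell2 \<Rightarrow> ell2" where
  "ell2_scale c x = Abs_ell2 (\<lambda>n. c * coord x n)"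

lemma coord_scale [simp]: "coord (ell2_scale c x) n = c * coord x n"
  unfolding ell2_scale_def
  by (subst Abs_ell2_inverse)
     (use summable_mult[OF summable_coord, of "(cmod c)\<^sup>2" x]
      in \<open>simp_all add: norm_mult power_mult_distrib\<close>)

lemma summable_ell2_cinner: "summable (\<lambda>n. coord x n * cnj (coord y n))"
proof (rule summable_norm_cancel, rule summable_comparison_test')
  show "summable (\<lambda>n. (cmod (coord x n))\<^sup>2 + (cmod (coord y n))\<^sup>2)"
    by (intro summable_add summable_coord)
  fix n
  have "2 * (cmod (coord x n) * cmod (coord y n)) \<le> (cmod (coord x n))\<^sup>2 + (cmod (coord y n))\<^sup>2"
    using sum_squares_bound[of "cmod (coord x n)" "cmod (coord y n)"] by (simp add: mult.assoc)
  moreover have "0 \<le> cmod (coord x n) * cmod (coord y n)" by simp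
  ultimately show "norm (norm (coord x n * cnj (coord y n)))
      \<le> (cmod (coord x n))\<^sup>2 + (cmod (coord y n))\<^sup>2"
    unfolding norm_mult complex_mod_cnj real_norm_def abs_mult abs_norm_cancel by linarith
qed

instantiation ell2 :: real_vector
begin

definition "0 = Abs_ell2 (\<lambda>_. 0)"
definition "x + y = Abs_ell2 (\<lambda>n. coord x n + coord y n)"
definition "- x = ell2_scale (- 1) x"
definition "x - y = x + (- y :: ell2)"
definition "r *\<^sub>R x = ell2_scale (complex_of_real r) x"

lemma coord_zero [simp]: "coord 0 n = 0"
  unfolding zero_ell2_def by (subst Abs_ell2_inverse) simp_all

lemma coord_add [simp]: "coord (x + y) n = coord x n + coord y n"
  unfolding plus_ell2_def
proof (subst Abs_ell2_inverse)
  have "summable (\<lambda>n. (cmod (coord x n + coord y n))\<^sup>2)"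
    by (rule summable_comparison_test'[where g =
          "\<lambda>n. 2 * (cmod (coord x n))\<^sup>2 + 2 * (cmod (coord y n))\<^sup>2"])
       (auto intro!: summable_add summable_mult summable_coord simp: cmod_add_sq_le)
  then show "(\<lambda>n. coord x n + coord y n) \<in> {x. summable (\<lambda>n. (cmod (x n))\<^sup>2)}" by simp
qed simp

lemma coord_uminus [simp]: "coord (- x) n = - coord x n"
  by (simp add: uminus_ell2_def)

lemma coord_minus [simp]: "coord (x - y) n = coord x n - coord y n"
  by (simp add: minus_ell2_def)

lemma coord_scaleR [simp]: "coord (r *\<^sub>R x) n = complex_of_real r * coord x n"
  by (simp add: scaleR_ell2_def)

instance
  by standard (auto intro!: ell2_eqI simp: algebra_simps)

end

instantiation ell2 :: real_inner
begin

definition "inner (x :: ell2) y = Re (ell2_cinner x y)"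
definition "norm (x :: ell2) = sqrt (inner x x)"
definition "dist (x :: ell2) y = norm (x - y)"
definition "sgn x = x /\<^sub>R norm (x :: ell2)"
definition "uniformity = (INF e\<in>{0<..}. principal {(x :: ell2, y). dist x y < e})"
definition "open U \<longleftrightarrow> (\<forall>x\<in>U. \<forall>\<^sub>F (x' :: ell2, y) in uniformity. x' = x \<longrightarrow> y \<in> U)"

lemma summable_ell2_inner: "summable (\<lambda>n. Re (coord x n * cnj (coord y n)))"
  by (intro summable_Re summable_ell2_cinner)

lemma ell2_inner_eq: "inner x y = (\<Sum>n. Re (coord x n * cnj (coord y n)))"
  unfolding inner_ell2_def ell2_cinner_def by (rule Re_suminf[OF summable_ell2_cinner])

lemma ell2_inner_self: "inner x x = (\<Sum>n. (cmod (coord x n))\<^sup>2)"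
  unfolding ell2_inner_eq cmod_power2 by (simp add: power2_eq_square)

instance
proof
  fix x y z :: ell2 and r :: real
  show "inner x y = inner y x"
    unfolding ell2_inner_eq by (simp add: algebra_simps)
  show "inner (x + y) z = inner x z + inner y z"
    unfolding ell2_inner_eq
    by (subst suminf_add[OF summable_ell2_inner summable_ell2_inner]) (simp add: algebra_simps)
  show "inner (r *\<^sub>R x) y = r * inner x y"
    unfolding ell2_inner_eq
    by (subst suminf_mult[OF summable_ell2_inner, symmetric]) (simp add: algebra_simps)
  show "0 \<le> inner x x"
    unfolding ell2_inner_self by (intro suminf_nonneg summable_coord) simp
  show "inner x x = 0 \<longleftrightarrow> x = 0"
    unfolding ell2_inner_self
    by (subst suminf_eq_zero_iff[OF summable_coord]) (auto intro: ell2_eqI)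
qed (simp_all add: norm_ell2_def dist_ell2_def sgn_ell2_def uniformity_ell2_def open_ell2_def)

end

section \<open>Reproducing kernel Hilbert spaces\<close>

text \<open>A function on a set \<open>X\<close> is represented by a function on the whole type which is \<open>0\<close> off \<open>X\<close>;
  pointwise sums, products and scalar multiples respect this convention.\<close>

definition fun_on :: "'a set \<Rightarrow> ('a \<Rightarrow> complex) \<Rightarrow> 'a \<Rightarrow> complex" where
  "fun_on X h = (\<lambda>x. if x \<in> X then h x else 0)"

text \<open>\<open>H\<close> is the set of functions forming the space, \<open>ip\<close> its inner product (linear in the first
  argument); the values of \<open>ip\<close> outside \<open>H \<times> H\<close> are irrelevant.\<close>

locale hilbert_function_space =
  fixes X :: "'a set" and H :: "('a \<Rightarrow> complex) set"
    and ip :: "('a \<Rightarrow> complex) \<Rightarrow> ('a \<Rightarrow> complex) \<Rightarrow> complex"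
  assumes supported: "h \<in> H \<Longrightarrow> x \<notin> X \<Longrightarrow> h x = 0"
    and zero_mem: "(\<lambda>x. 0) \<in> H"
    and add_mem: "g \<in> H \<Longrightarrow> h \<in> H \<Longrightarrow> (\<lambda>x. g x + h x) \<in> H"
    and scale_mem: "h \<in> H \<Longrightarrow> (\<lambda>x. c * h x) \<in> H"
    and ip_add: "g \<in> H \<Longrightarrow> h \<in> H \<Longrightarrow> l \<in> H \<Longrightarrow> ip (\<lambda>x. g x + h x) l = ip g l + ip h l"
    and ip_scale: "g \<in> H \<Longrightarrow> h \<in> H \<Longrightarrow> ip (\<lambda>x. c * g x) h = c * ip g h"
    and ip_sym: "g \<in> H \<Longrightarrow> h \<in> H \<Longrightarrow> ip h g = cnj (ip g h)"
    and ip_pos: "h \<in> H \<Longrightarrow> h \<noteq> (\<lambda>x. 0) \<Longrightarrow> 0 < Re (ip h h)"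
    and complete: "(\<And>n::nat. u n \<in> H) \<Longrightarrow>
      (\<And>e. e > 0 \<Longrightarrow> \<exists>N. \<forall>m\<ge>N. \<forall>n\<ge>N.
          sqrt (Re (ip (\<lambda>x. u m x - u n x) (\<lambda>x. u m x - u n x))) < e) \<Longrightarrow>
      \<exists>h\<in>H. (\<lambda>n. sqrt (Re (ip (\<lambda>x. u n x - h x) (\<lambda>x. u n x - h x)))) \<longlonglongrightarrow> 0"

locale rkhs = hilbert_function_space X H ip
  for X :: "'a set" and k :: "'a \<Rightarrow> 'a \<Rightarrow> complex" and H :: "('a \<Rightarrow> complex) set"
    and ip :: "('a \<Rightarrow> complex) \<Rightarrow> ('a \<Rightarrow> complex) \<Rightarrow> complex" +
  assumes kernel_mem: "y \<in> X \<Longrightarrow> fun_on X (\<lambda>x. k x y) \<in> H"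
    and reproducing: "y \<in> X \<Longrightarrow> h \<in> H \<Longrightarrow> ip h (fun_on X (\<lambda>x. k x y)) = h y"

definition drury_arveson_kernel :: "ell2 \<Rightarrow> ell2 \<Rightarrow> complex" where
  "drury_arveson_kernel x y = 1 / (1 - ell2_cinner x y)"

text \<open>A reproducing kernel Hilbert space is determined by its kernel, so this predicate singles
  out the Drury-Arveson space \<open>H\<close> on the unit ball, with its inner product.\<close>

definition drury_arveson_space ::
  "(ell2 \<Rightarrow> complex) set \<Rightarrow> ((ell2 \<Rightarrow> complex) \<Rightarrow> (ell2 \<Rightarrow> complex) \<Rightarrow> complex) \<Rightarrow> bool" where
  "drury_arveson_space H ip \<longleftrightarrow> rkhs (ball 0 1) drury_arveson_kernel H ip"

definition kernel_span :: "ell2 set \<Rightarrow> (ell2 \<Rightarrow> complex) set" where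
  "kernel_span S = {fun_on (ball 0 1) (\<lambda>x. \<Sum>y\<in>T. c y * drury_arveson_kernel x y) | T c.
     finite T \<and> T \<subseteq> S}"

definition closed_kernel_span ::
  "(ell2 \<Rightarrow> complex) set \<Rightarrow> ((ell2 \<Rightarrow> complex) \<Rightarrow> (ell2 \<Rightarrow> complex) \<Rightarrow> complex)
     \<Rightarrow> ell2 set \<Rightarrow> (ell2 \<Rightarrow> complex) set" where
  "closed_kernel_span H ip S =
     {h \<in> H. \<forall>e>0. \<exists>g\<in>kernel_span S. sqrt (Re (ip (\<lambda>x. h x - g x) (\<lambda>x. h x - g x))) < e}"

text \<open>The space \<open>\<H>\<^sub>S\<close> and its multiplier algebra, both consisting of functions on \<open>S\<close>.\<close>

definition hilbert_on ::
  "(ell2 \<Rightarrow> complex) set \<Rightarrow> ((ell2 \<Rightarrow> complex) \<Rightarrow> (ell2 \<Rightarrow> complex) \<Rightarrow> complex)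
     \<Rightarrow> ell2 set \<Rightarrow> (ell2 \<Rightarrow> complex) set" where
  "hilbert_on H ip S = fun_on S ` closed_kernel_span H ip S"

definition multiplier_algebra ::
  "(ell2 \<Rightarrow> complex) set \<Rightarrow> ((ell2 \<Rightarrow> complex) \<Rightarrow> (ell2 \<Rightarrow> complex) \<Rightarrow> complex)
     \<Rightarrow> ell2 set \<Rightarrow> (ell2 \<Rightarrow> complex) set" where
  "multiplier_algebra H ip S =
     {m. (\<forall>x. x \<notin> S \<longrightarrow> m x = 0) \<and>
         (\<forall>g\<in>hilbert_on H ip S. (\<lambda>x. m x * g x) \<in> hilbert_on H ip S)}"

section \<open>Algebras of functions, isomorphisms and characters\<close>

definition alg_iso ::
  "('a \<Rightarrow> complex) set \<Rightarrow> ('b \<Rightarrow> complex) set \<Rightarrow> (('a \<Rightarrow> complex) \<Rightarrow> ('b \<Rightarrow> complex)) \<Rightarrow> bool" where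
  "alg_iso A B \<phi> \<longleftrightarrow> bij_betw \<phi> A B \<and>
     (\<forall>g\<in>A. \<forall>h\<in>A. \<phi> (\<lambda>x. g x + h x) = (\<lambda>y. \<phi> g y + \<phi> h y)) \<and>
     (\<forall>c. \<forall>h\<in>A. \<phi> (\<lambda>x. c * h x) = (\<lambda>y. c * \<phi> h y)) \<and>
     (\<forall>g\<in>A. \<forall>h\<in>A. \<phi> (\<lambda>x. g x * h x) = (\<lambda>y. \<phi> g y * \<phi> h y))"

text \<open>Characters live on the carrier \<open>A\<close> only; being \<open>extensional\<close>, they are equal as soon
  as they agree on \<open>A\<close>.\<close>

definition character_space :: "('a \<Rightarrow> complex) set \<Rightarrow> (('a \<Rightarrow> complex) \<Rightarrow> complex) set" where
  "character_space A = {\<rho> \<in> extensional A.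
     (\<forall>g\<in>A. \<forall>h\<in>A. \<rho> (\<lambda>x. g x + h x) = \<rho> g + \<rho> h) \<and>
     (\<forall>c. \<forall>h\<in>A. \<rho> (\<lambda>x. c * h x) = c * \<rho> h) \<and>
     (\<forall>g\<in>A. \<forall>h\<in>A. \<rho> (\<lambda>x. g x * h x) = \<rho> g * \<rho> h) \<and>
     (\<exists>h\<in>A. \<rho> h \<noteq> 0)}"

definition point_eval :: "('a \<Rightarrow> complex) set \<Rightarrow> 'a \<Rightarrow> ('a \<Rightarrow> complex) \<Rightarrow> complex" where
  "point_eval A v = restrict (\<lambda>h. h v) A"

definition pullback ::
  "('a \<Rightarrow> complex) set \<Rightarrow> (('a \<Rightarrow> complex) \<Rightarrow> ('b \<Rightarrow> complex))
     \<Rightarrow> (('b \<Rightarrow> complex) \<Rightarrow> complex) \<Rightarrow> ('a \<Rightarrow> complex) \<Rightarrow> complex" where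
  "pullback A \<phi> \<rho> = restrict (\<rho> \<circ> \<phi>) A"

text \<open>\<open>comp_op Y G h\<close> is \<open>h \<circ> G\<close> as a function on \<open>Y\<close>.\<close>

definition comp_op :: "'b set \<Rightarrow> ('b \<Rightarrow> 'a) \<Rightarrow> ('a \<Rightarrow> complex) \<Rightarrow> 'b \<Rightarrow> complex" where
  "comp_op Y G h = fun_on Y (h \<circ> G)"

definition disc_algebra :: "(complex \<Rightarrow> complex) set" where
  "disc_algebra = {g. (\<forall>z. z \<notin> cball 0 1 \<longrightarrow> g z = 0) \<and>
     continuous_on (cball 0 1) g \<and> g holomorphic_on ball 0 1}"

text \<open>A holomorphic bijection of the disc has a holomorphic inverse, so it is a conformal
  automorphism.\<close>

definition moebius_map :: "(complex \<Rightarrow> complex) \<Rightarrow> bool" where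
  "moebius_map \<theta> \<longleftrightarrow> continuous_on (cball 0 1) \<theta> \<and> \<theta> holomorphic_on ball 0 1 \<and>
     bij_betw \<theta> (ball 0 1) (ball 0 1)"

definition automorphism_invariant ::
  "(ell2 \<Rightarrow> complex) set \<Rightarrow> (complex \<Rightarrow> ell2) \<Rightarrow> bool" where
  "automorphism_invariant A f \<longleftrightarrow> (\<forall>\<theta>. moebius_map \<theta> \<longrightarrow>
     alg_iso A A (comp_op (f ` cball 0 1) (f \<circ> \<theta> \<circ> inv_into (cball 0 1) f)))"

definition comparable :: "(nat \<Rightarrow> real) \<Rightarrow> (nat \<Rightarrow> real) \<Rightarrow> bool" where
  "comparable s t \<longleftrightarrow> (\<exists>c>0. \<exists>C>0. \<forall>n. c \<le> s n / t n \<and> s n / t n \<le> C)"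

section \<open>Holomorphic maps\<close>

text \<open>Complex (Frechet) differentiability at every point of the open set \<open>U\<close>;
  \<open>has_derivative\<close> by itself only asks for a bounded real-linear derivative.\<close>

definition holomorphic_on_open :: "(ell2 \<Rightarrow> ell2) \<Rightarrow> ell2 set \<Rightarrow> bool" where
  "holomorphic_on_open G U \<longleftrightarrow>
     (\<forall>x\<in>U. \<exists>D. (G has_derivative D) (at x) \<and> (\<forall>c v. D (ell2_scale c v) = ell2_scale c (D v)))"

definition holomorphic_on_subset :: "(ell2 \<Rightarrow> ell2) \<Rightarrow> ell2 set \<Rightarrow> bool" where
  "holomorphic_on_subset F S \<longleftrightarrow>
     (\<forall>p\<in>S. \<exists>e>0. \<exists>G. holomorphic_on_open G (ball p e) \<and> (\<forall>x\<in>S \<inter> ball p e. F x = G x))"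

end

theory Submission
  imports Defs
begin

text \<open>
  Everything is transported to the closed disc. Along \<open>f\<close> the kernel of the Drury-Arveson space
  becomes \<open>1 / (1 - \<Sum>\<beta>\<^sub>n (z w\<^sup>*)^n) = \<Sum>a\<^sub>n (z w\<^sup>*)^n\<close> with \<open>\<beta>\<^sub>n = \<bar>b\<^sub>n\<bar>^2\<close>, where \<open>w\<^sup>*\<close> is the
  conjugate of \<open>w\<close>. Hence \<open>\<H>\<^sub>X\<close> is the space of the power series \<open>\<Sum>c\<^sub>n z^n\<close> on the closed disc
  with \<open>\<Sum>\<bar>c\<^sub>n\<bar>^2 / a\<^sub>n\<close> finite (\<open>hilbert_on_X\<close>): the feature vectors \<open>(\<surd>a\<^sub>n w\<^sup>*^n)\<^sub>n\<close> have the right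
  inner products, and averages over the roots of unity show that those with \<open>\<bar>w\<bar> = 1\<close> already span a
  dense subspace of \<open>\<ell>^2\<close>.

  The weights satisfy the renewal equation \<open>a\<^sub>n\<^sub>+\<^sub>1 = \<Sum>\<beta>\<^sub>i\<^sub>+\<^sub>1 a\<^sub>n\<^sub>-\<^sub>i\<close>. It gives four facts: \<open>a\<^sub>n > 0\<close>;
  \<open>\<Sum>a\<^sub>n < \<infinity>\<close>; \<open>a\<^sub>m a\<^sub>n \<le> a\<^sub>m\<^sub>+\<^sub>n\<close>; and, as \<open>\<beta>\<^sub>n \<le> a\<^sub>n\<close> and \<open>\<Sum>\<beta>\<^sub>n z^n\<close> has radius of convergence 1, for
  each \<open>t < 1\<close> a bound \<open>a\<^sub>n \<ge> \<delta> t^n\<close>. By the third fact \<open>z^n\<close> is a multiplier of norm at most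
  \<open>1 / \<surd>a\<^sub>n\<close>, so \<open>\<Sum>d\<^sub>n z^n\<close> is a multiplier as soon as \<open>\<Sum>\<bar>d\<^sub>n\<bar> / \<surd>a\<^sub>n\<close> is finite
  (\<open>weighted_multiplierI\<close>).

  The natural map is \<open>m \<mapsto> m\<close> when both algebras are read as algebras of functions on the closed disc,
  so it is an isomorphism exactly when the two sets of multipliers coincide. Comparable weights define
  the same space. Conversely, if \<open>a\<^sub>n / a'\<^sub>n\<close> is unbounded, a lacunary series with
  \<open>\<Sum>\<bar>d\<^sub>n\<bar> / \<surd>a\<^sub>n < \<infinity>\<close> but \<open>\<bar>d\<^sub>n\<bar>^2 / a'\<^sub>n \<ge> 1\<close> infinitely often is a multiplier for \<open>a\<close> and does not
  even belong to the space for \<open>a'\<close>. This replaces the usual closed graph argument.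

  For the second part, the bound on the convolution of \<open>a\<close> with itself makes the space a Banach algebra,
  equal to its multiplier algebra. By the Neumann series its characters are continuous; polynomials are
  dense; and \<open>1 / (\<lambda> - z)\<close> is a multiplier for \<open>\<bar>\<lambda>\<bar> > 1\<close> because \<open>a\<^sub>n\<close> decays slower than any geometric
  sequence. So every character is evaluation at a point of the closed disc (\<open>character_is_evaluation\<close>),
  and \<open>\<phi>\<close> is composition with \<open>\<theta> = \<phi>(z)\<close>. Put \<open>g = \<phi>\<^sup>-\<^sup>1(z)\<close>. Then \<open>g \<circ> \<theta> = id\<close>, and \<open>\<bar>g\<bar> \<le> 1\<close> because
  \<open>1 / (\<lambda> - z)\<close> is a multiplier for the second weight too. The open mapping theorem and the identity
  theorem then make \<open>\<theta>\<close> a Moebius map with inverse \<open>g\<close>. Automorphism invariance cancels \<open>\<theta>\<close>, which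
  leaves the natural map.
\<close>

section \<open>The Hilbert space of square summable sequences\<close>

lemma coord_Abs_ell2: "summable (\<lambda>n. (cmod (u n))\<^sup>2) \<Longrightarrow> coord (Abs_ell2 u) n = u n"
  by (subst Abs_ell2_inverse) auto

lemma norm_ell2_squared: "(norm x)\<^sup>2 = (\<Sum>n. (cmod (coord x n))\<^sup>2)"
  by (simp add: power2_norm_eq_inner ell2_inner_self)

lemma norm_coord_le: "cmod (coord x n) \<le> norm x"
proof -
  have "(cmod (coord x n))\<^sup>2 \<le> (norm x)\<^sup>2"
    unfolding norm_ell2_squared
    using sum_le_suminf[OF summable_coord, of "{n}" x] by simp
  then show ?thesis by (rule power2_le_imp_le) simp
qed

lemma norm_ell2_scale [simp]: "norm (ell2_scale c x) = cmod c * norm x"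
proof -
  have "(norm (ell2_scale c x))\<^sup>2 = (cmod c * norm x)\<^sup>2"
    unfolding norm_ell2_squared power_mult_distrib
    by (simp add: norm_mult power_mult_distrib suminf_mult summable_coord)
  then show ?thesis by (simp add: power2_eq_iff_nonneg)
qed

lemma coord_sum: "coord (sum h T) n = (\<Sum>y\<in>T. coord (h y) n)"
  by (induction T rule: infinite_finite_induct) auto

lemma ell2_cinner_add_left: "ell2_cinner (x + y) z = ell2_cinner x z + ell2_cinner y z"
  unfolding ell2_cinner_def
  by (subst suminf_add[OF summable_ell2_cinner summable_ell2_cinner]) (simp add: algebra_simps)

lemma ell2_cinner_scale_left: "ell2_cinner (ell2_scale c x) z = c * ell2_cinner x z"
  unfolding ell2_cinner_def
  by (subst suminf_mult[OF summable_ell2_cinner, symmetric]) (simp add: algebra_simps)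

lemma ell2_cinner_commute: "ell2_cinner y x = cnj (ell2_cinner x y)"
proof -
  have "(\<lambda>n. coord x n * cnj (coord y n)) sums ell2_cinner x y"
    unfolding ell2_cinner_def by (rule summable_sums[OF summable_ell2_cinner])
  from sums_cnj[THEN iffD2, OF this] show ?thesis
    unfolding ell2_cinner_def[of y x] by (simp add: sums_iff mult.commute)
qed

lemma ell2_cinner_zero_left [simp]: "ell2_cinner 0 z = 0"
  by (simp add: ell2_cinner_def)

lemma ell2_cinner_sum_left:
  "ell2_cinner (\<Sum>y\<in>T. ell2_scale (c y) (h y)) z = (\<Sum>y\<in>T. c y * ell2_cinner (h y) z)"
  by (induction T rule: infinite_finite_induct)
     (auto simp: ell2_cinner_add_left ell2_cinner_scale_left)

text \<open>Rotating \<open>x\<close> by a unimodular scalar makes the complex inner product real and nonnegative, which reduces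
  the claim to the real inner product.\<close>

lemma ell2_cinner_Cauchy_Schwarz: "cmod (ell2_cinner x y) \<le> norm x * norm y"
proof (cases "ell2_cinner x y = 0")
  case False
  define c where "c = cnj (ell2_cinner x y) / complex_of_real (cmod (ell2_cinner x y))"
  have "c * ell2_cinner x y = complex_of_real (cmod (ell2_cinner x y))"
    using False complex_norm_square[of "ell2_cinner x y"]
    by (simp add: c_def power2_eq_square field_simps)
  then have "cmod (ell2_cinner x y) = inner (ell2_scale c x) y"
    unfolding inner_ell2_def ell2_cinner_scale_left by simp
  also have "\<dots> \<le> norm (ell2_scale c x) * norm y"
    by (rule norm_cauchy_schwarz)
  also have "cmod c = 1"
    using False by (simp add: c_def norm_divide)
  then have "norm (ell2_scale c x) * norm y = norm x * norm y" by simp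
  finally show ?thesis .
qed simp

lemma bounded_linear_ell2_cinner_left: "bounded_linear (\<lambda>x. ell2_cinner x y)"
proof (rule bounded_linear_intro[where K = "norm y"])
  fix r x show "ell2_cinner (r *\<^sub>R x) y = r *\<^sub>R ell2_cinner x y"
    unfolding scaleR_ell2_def ell2_cinner_scale_left by (simp add: scaleR_conv_of_real)
qed (simp_all add: ell2_cinner_add_left ell2_cinner_Cauchy_Schwarz)

text \<open>A bound on all partial sums gives membership and the norm bound at once. This is the form in which
  coordinatewise limits can be controlled.\<close>

lemma norm_ell2_le_if_sums_le:
  assumes "\<And>N. (\<Sum>n<N. (cmod (u n))\<^sup>2) \<le> e\<^sup>2" and "0 \<le> e"
  shows "summable (\<lambda>n. (cmod (u n))\<^sup>2)" and "norm (Abs_ell2 u) \<le> e"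
proof -
  show s: "summable (\<lambda>n. (cmod (u n))\<^sup>2)"
    by (rule summableI_nonneg_bounded[of _ "e\<^sup>2"]) (use assms(1) in auto)
  have "(\<Sum>n. (cmod (u n))\<^sup>2) \<le> e\<^sup>2"
    by (rule suminf_le_const[OF s]) (rule assms(1))
  then have "(norm (Abs_ell2 u))\<^sup>2 \<le> e\<^sup>2"
    by (simp add: norm_ell2_squared coord_Abs_ell2[OF s])
  then show "norm (Abs_ell2 u) \<le> e" using assms(2) by (rule power2_le_imp_le)
qed

instance ell2 :: banach
proof
  fix x :: "nat \<Rightarrow> ell2"
  assume C: "Cauchy x"
  have "Cauchy (\<lambda>j. coord (x j) n)" for n
  proof (rule CauchyI)
    fix e :: real assume "0 < e"
    then obtain M where "\<forall>i\<ge>M. \<forall>j\<ge>M. norm (x i - x j) < e"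
      using CauchyD[OF C] by blast
    then show "\<exists>M. \<forall>i\<ge>M. \<forall>j\<ge>M. norm (coord (x i) n - coord (x j) n) < e"
      by (metis coord_minus norm_coord_le order_le_less_trans)
  qed
  then have "\<forall>n. \<exists>l. (\<lambda>j. coord (x j) n) \<longlonglongrightarrow> l"
    using Cauchy_convergent convergent_def by blast
  then obtain l where l: "\<And>n. (\<lambda>j. coord (x j) n) \<longlonglongrightarrow> l n" by metis
  have close: "\<exists>M. \<forall>j\<ge>M. \<forall>N. (\<Sum>n<N. (cmod (coord (x j) n - l n))\<^sup>2) \<le> e\<^sup>2"
    if "0 < e" for e
  proof -
    obtain M where M: "\<And>i j. i \<ge> M \<Longrightarrow> j \<ge> M \<Longrightarrow> norm (x i - x j) < e"
      using CauchyD[OF C \<open>0 < e\<close>] by blast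
    have "(\<Sum>n<N. (cmod (coord (x j) n - l n))\<^sup>2) \<le> e\<^sup>2" if "j \<ge> M" for j N
    proof (rule LIMSEQ_le_const2)
      show "(\<lambda>i. \<Sum>n<N. (cmod (coord (x j) n - coord (x i) n))\<^sup>2)
        \<longlonglongrightarrow> (\<Sum>n<N. (cmod (coord (x j) n - l n))\<^sup>2)"
        by (intro tendsto_intros l)
      have "(\<Sum>n<N. (cmod (coord (x j) n - coord (x i) n))\<^sup>2) \<le> e\<^sup>2" if "i \<ge> M" for i
      proof -
        have "(\<Sum>n<N. (cmod (coord (x j) n - coord (x i) n))\<^sup>2) \<le> (norm (x j - x i))\<^sup>2"
          unfolding norm_ell2_squared coord_minus[symmetric]
          by (rule sum_le_suminf[OF summable_coord]) auto
        also have "\<dots> \<le> e\<^sup>2"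
          using M[OF \<open>j \<ge> M\<close> that] by (intro power_mono) auto
        finally show ?thesis .
      qed
      then show "\<exists>K. \<forall>i\<ge>K. (\<Sum>n<N. (cmod (coord (x j) n - coord (x i) n))\<^sup>2) \<le> e\<^sup>2"
        by blast
    qed
    then show ?thesis by blast
  qed
  obtain M where M: "\<And>N. (\<Sum>n<N. (cmod (coord (x M) n - l n))\<^sup>2) \<le> 1\<^sup>2"
    using close[of 1] by auto
  define y where "y = x M - Abs_ell2 (\<lambda>n. coord (x M) n - l n)"
  have y: "coord y n = l n" for n
    unfolding y_def coord_minus
    by (subst coord_Abs_ell2[OF norm_ell2_le_if_sums_le(1)[OF M]]) auto
  have "x \<longlonglongrightarrow> y"
  proof (rule LIMSEQ_I)
    fix e :: real assume "0 < e"
    then obtain M where M: "\<And>j N. j \<ge> M \<Longrightarrow> (\<Sum>n<N. (cmod (coord (x j) n - l n))\<^sup>2) \<le> (e/2)\<^sup>2"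
      using close[of "e/2"] by auto
    have "norm (x j - y) < e" if "j \<ge> M" for j
    proof -
      have u: "summable (\<lambda>n. (cmod (coord (x j) n - l n))\<^sup>2)"
        "norm (Abs_ell2 (\<lambda>n. coord (x j) n - l n)) \<le> e/2"
        using norm_ell2_le_if_sums_le[of "\<lambda>n. coord (x j) n - l n" "e/2"] M[OF that] \<open>0 < e\<close> by auto
      have "x j - y = Abs_ell2 (\<lambda>n. coord (x j) n - l n)"
        by (rule ell2_eqI) (simp add: y coord_Abs_ell2[OF u(1)])
      then show ?thesis using u(2) \<open>0 < e\<close> by simp
    qed
    then show "\<exists>M. \<forall>j\<ge>M. norm (x j - y) < e" by blast
  qed
  then show "convergent x" by (auto simp: convergent_def)
qed

definition ell2_unit :: "nat \<Rightarrow> ell2" where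
  "ell2_unit n = Abs_ell2 (\<lambda>m. if m = n then 1 else 0)"

lemma coord_ell2_unit: "coord (ell2_unit n) m = (if m = n then 1 else 0)"
  unfolding ell2_unit_def
  by (rule coord_Abs_ell2) (rule summable_finite[of "{n}"], auto)

text \<open>The squared norm of the remainder is a tail of the convergent series \<open>\<Sum>\<bar>x\<^sub>n\<bar>^2\<close>.\<close>

lemma ell2_unit_expansion: "(\<lambda>n. ell2_scale (coord x n) (ell2_unit n)) sums x"
  unfolding sums_def
proof (rule LIM_zero_cancel, rule tendsto_norm_zero_cancel)
  let ?t = "\<lambda>N. \<Sum>i. (cmod (coord x (i + N)))\<^sup>2"
  have eq: "norm ((\<Sum>n<N. ell2_scale (coord x n) (ell2_unit n)) - x) = sqrt (?t N)" for N
  proof -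
    let ?y = "(\<Sum>n<N. ell2_scale (coord x n) (ell2_unit n)) - x"
    have c: "coord ?y m = (if m < N then 0 else - coord x m)" for m
      by (simp add: coord_sum coord_ell2_unit if_distrib sum.delta cong: if_cong)
    have "(norm ?y)\<^sup>2 = (\<Sum>m. (cmod (coord ?y (m + N)))\<^sup>2) + (\<Sum>m<N. (cmod (coord ?y m))\<^sup>2)"
      unfolding norm_ell2_squared by (rule suminf_split_initial_segment[OF summable_coord])
    also have "\<dots> = ?t N" by (simp only: c) simp
    finally show ?thesis by (metis norm_ge_zero real_sqrt_unique)
  qed
  have "?t \<longlonglongrightarrow> 0"
    by (rule suminf_exist_split2[OF summable_coord])
  then show "(\<lambda>N. norm ((\<Sum>n<N. ell2_scale (coord x n) (ell2_unit n)) - x)) \<longlonglongrightarrow> 0"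
    unfolding eq using tendsto_real_sqrt by fastforce
qed

lemma bounded_linear_ell2_eqI:
  assumes F: "bounded_linear F" and G: "bounded_linear G"
    and eq: "\<And>c n. F (ell2_scale c (ell2_unit n)) = G (ell2_scale c (ell2_unit n))"
  shows "F x = G x"
  using bounded_linear.sums[OF F ell2_unit_expansion[of x]]
    bounded_linear.sums[OF G ell2_unit_expansion[of x]] sums_unique2
  unfolding eq by blast

section \<open>Closed kernel spans and feature maps\<close>

context hilbert_function_space
begin

lemma diff_mem: "g \<in> H \<Longrightarrow> h \<in> H \<Longrightarrow> (\<lambda>x. g x - h x) \<in> H"
  using add_mem[of g "\<lambda>x. (-1) * h x"] scale_mem[of h "-1"] by simp

lemma ip_diff:
  assumes "g \<in> H" "h \<in> H" "l \<in> H"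
  shows "ip (\<lambda>x. g x - h x) l = ip g l - ip h l"
  using ip_add[OF assms(1) scale_mem[OF assms(2), of "-1"] assms(3)]
    ip_scale[OF assms(2,3), of "-1"] by simp

lemma ip_zero: "h \<in> H \<Longrightarrow> ip (\<lambda>x. 0) h = 0"
  using ip_scale[of h h 0] by simp

lemma ip_self_nonneg: "h \<in> H \<Longrightarrow> 0 \<le> Re (ip h h)"
  using ip_pos[of h] ip_zero[of h] by (cases "h = (\<lambda>x. 0)") auto

lemma ip_self_real: "h \<in> H \<Longrightarrow> ip h h = complex_of_real (Re (ip h h))"
  using ip_sym[of h h] by (metis Reals_cnj_iff of_real_Re)

text \<open>The usual argument: the component of \<open>g\<close> orthogonal to \<open>h\<close> has nonnegative squared norm.\<close>

lemma ip_Cauchy_Schwarz: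
  assumes "g \<in> H" "h \<in> H"
  shows "cmod (ip g h) \<le> sqrt (Re (ip g g)) * sqrt (Re (ip h h))"
proof (cases "h = (\<lambda>x. 0)")
  case True
  then have "ip g h = 0"
    using ip_sym[OF assms(2,1)] ip_zero[OF assms(1)] by simp
  then show ?thesis
    using assms by (simp add: ip_self_nonneg)
next
  case False
  then have pos: "0 < Re (ip h h)" using assms ip_pos by blast
  define R where "R = Re (ip h h)"
  \<comment> \<open>\<open>t h\<close> is the orthogonal projection of \<open>g\<close> onto the line of \<open>h\<close>.\<close>
  define t where "t = ip g h / complex_of_real R"
  have R: "ip h h = complex_of_real R" "0 < R"
    using ip_self_real[OF assms(2)] pos by (auto simp: R_def)
  define th where "th = (\<lambda>x. t * h x)"
  have th: "th \<in> H" unfolding th_def by (rule scale_mem[OF assms(2)])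
  define l where "l = (\<lambda>x. g x - th x)"
  have l: "l \<in> H" unfolding l_def by (rule diff_mem[OF assms(1) th])
  have th_ip: "ip th u = t * ip h u" if "u \<in> H" for u
    unfolding th_def by (rule ip_scale[OF assms(2) that])
  have hl: "ip h l = 0"
  proof -
    have "ip l h = ip g h - t * ip h h"
      unfolding l_def using ip_diff[OF assms(1) th assms(2)] th_ip[OF assms(2)] by simp
    also have "\<dots> = 0" using R by (simp add: t_def)
    finally show ?thesis using ip_sym[OF l assms(2)] by simp
  qed
  have "ip l l = ip g l"
    using ip_diff[OF assms(1) th l] th_ip[OF l] hl by (simp add: l_def)
  also have "\<dots> = cnj (ip l g)" using ip_sym[OF l assms(1)] .
  also have "ip l g = ip g g - t * ip h g"
    unfolding l_def using ip_diff[OF assms(1) th assms(1)] th_ip[OF assms(1)] by simp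
  also have "ip h g = cnj (ip g h)" using ip_sym[OF assms] .
  also have "t * cnj (ip g h) = complex_of_real ((cmod (ip g h))\<^sup>2 / R)"
    using complex_norm_square[of "ip g h"] by (simp add: t_def)
  finally have "Re (ip l l) = Re (ip g g) - (cmod (ip g h))\<^sup>2 / R"
    by simp
  then have "(cmod (ip g h))\<^sup>2 / R \<le> Re (ip g g)"
    using ip_self_nonneg[OF l] by linarith
  then have "(cmod (ip g h))\<^sup>2 \<le> Re (ip g g) * Re (ip h h)"
    using R(2) by (simp add: field_simps R_def)
  then show ?thesis
    by (simp add: real_le_rsqrt flip: real_sqrt_mult)
qed

lemma ip_diff_self:
  assumes "g \<in> H" "h \<in> H"
  shows "Re (ip (\<lambda>x. g x - h x) (\<lambda>x. g x - h x)) = Re (ip g g) - 2 * Re (ip g h) + Re (ip h h)"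
proof -
  define l where "l = (\<lambda>x. g x - h x)"
  have l: "l \<in> H" unfolding l_def by (rule diff_mem[OF assms])
  have "ip l l = ip g l - ip h l"
    using ip_diff[OF assms l] by (simp add: l_def)
  moreover have "ip g l = cnj (ip g g - ip h g)"
    using ip_sym[OF l assms(1)] ip_diff[OF assms assms(1)] by (simp add: l_def)
  moreover have "ip h l = cnj (ip g h - ip h h)"
    using ip_sym[OF l assms(2)] ip_diff[OF assms assms(2)] by (simp add: l_def)
  moreover have "Re (ip h g) = Re (ip g h)"
    using ip_sym[OF assms] by simp
  ultimately show ?thesis by (simp add: l_def)
qed

lemma ip_triangle:
  assumes "g \<in> H" "h \<in> H"
  shows "sqrt (Re (ip (\<lambda>x. g x - h x) (\<lambda>x. g x - h x))) \<le> sqrt (Re (ip g g)) + sqrt (Re (ip h h))"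
proof (rule real_le_lsqrt)
  have "- Re (ip g h) \<le> sqrt (Re (ip g g)) * sqrt (Re (ip h h))"
    using ip_Cauchy_Schwarz[OF assms] abs_Re_le_cmod[of "ip g h"] by linarith
  then show "Re (ip (\<lambda>x. g x - h x) (\<lambda>x. g x - h x)) \<le> (sqrt (Re (ip g g)) + sqrt (Re (ip h h)))\<^sup>2"
    unfolding ip_diff_self[OF assms] using ip_self_nonneg[OF assms(1)] ip_self_nonneg[OF assms(2)]
    by (simp add: power2_sum)
qed (auto simp: ip_self_nonneg assms)

end

context rkhs
begin

lemma kernel_sum_mem:
  assumes "finite T" "T \<subseteq> X"
  shows "fun_on X (\<lambda>x. \<Sum>y\<in>T. c y * k x y) \<in> H"
  using assms
proof (induction T)
  case empty
  then show ?case using zero_mem by (simp add: fun_on_def cong: if_cong)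
next
  case (insert y T)
  have "(\<lambda>x. c y * fun_on X (\<lambda>x. k x y) x + fun_on X (\<lambda>x. \<Sum>y\<in>T. c y * k x y) x) \<in> H"
    using insert by (intro add_mem scale_mem kernel_mem) auto
  also have "(\<lambda>x. c y * fun_on X (\<lambda>x. k x y) x + fun_on X (\<lambda>x. \<Sum>y\<in>T. c y * k x y) x)
     = fun_on X (\<lambda>x. \<Sum>y\<in>insert y T. c y * k x y)"
    using insert by (auto simp: fun_on_def fun_eq_iff)
  finally show ?case .
qed

lemma ip_kernel_sum:
  assumes "finite T" "T \<subseteq> X" "h \<in> H"
  shows "ip (fun_on X (\<lambda>x. \<Sum>y\<in>T. c y * k x y)) h = (\<Sum>y\<in>T. c y * cnj (h y))"
  using assms
proof (induction T)
  case empty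
  then show ?case using ip_zero[of h] by (simp add: fun_on_def cong: if_cong)
next
  case (insert y T)
  have y: "fun_on X (\<lambda>x. k x y) \<in> H" "ip (fun_on X (\<lambda>x. k x y)) h = cnj (h y)"
    using insert.prems kernel_mem[of y] reproducing[of y h] ip_sym[of h "fun_on X (\<lambda>x. k x y)"]
    by auto
  have eq: "fun_on X (\<lambda>x. \<Sum>y\<in>insert y T. c y * k x y) =
      (\<lambda>x. c y * fun_on X (\<lambda>x. k x y) x + fun_on X (\<lambda>x. \<Sum>y\<in>T. c y * k x y) x)"
    using insert by (auto simp: fun_on_def fun_eq_iff)
  have "ip (fun_on X (\<lambda>x. \<Sum>y\<in>insert y T. c y * k x y)) h = c y * cnj (h y) + (\<Sum>y\<in>T. c y * cnj (h y))"
    unfolding eq using insert y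
    by (subst ip_add[OF scale_mem[OF y(1)] kernel_sum_mem]) (auto simp: ip_scale)
  then show ?case using insert.hyps by simp
qed

text \<open>Point evaluations are bounded, so convergence in the Hilbert space implies pointwise convergence.\<close>

lemma eval_le:
  assumes "y \<in> X" "h \<in> H"
  shows "cmod (h y) \<le> sqrt (Re (ip h h)) * sqrt (Re (k y y))"
proof -
  have "ip (fun_on X (\<lambda>x. k x y)) (fun_on X (\<lambda>x. k x y)) = k y y"
    using reproducing[OF assms(1) kernel_mem[OF assms(1)]] assms by (simp add: fun_on_def)
  then show ?thesis
    using ip_Cauchy_Schwarz[OF assms(2) kernel_mem[OF assms(1)]] reproducing[OF assms] by simp
qed

end

text \<open>The complex span of the vectors \<open>E y\<close>. It is written with finite subsets of \<open>S\<close>, like the span of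
  the kernel functions, so that a combination of kernel functions and the corresponding combination of
  feature vectors have the same data \<open>T\<close>, \<open>c\<close>.\<close>

definition cspan :: "(ell2 \<Rightarrow> ell2) \<Rightarrow> ell2 set \<Rightarrow> ell2 set" where
  "cspan E S = {\<Sum>y\<in>T. ell2_scale (c y) (E y) | T c. finite T \<and> T \<subseteq> S}"

text \<open>If the vectors \<open>E y\<close> have the inner products prescribed by the kernel, then sending the kernel function
  at \<open>y\<close> to \<open>E y\<close> is isometric on spans, so by completeness on both sides it extends to the closures; the
  values on \<open>S\<close> are recovered as inner products with \<open>E v\<close>.\<close>

theorem hilbert_on_eq:
  assumes DA: "drury_arveson_space H ip" and S: "S \<subseteq> ball 0 1"
    and E: "\<And>x y. x \<in> S \<Longrightarrow> y \<in> S \<Longrightarrow> drury_arveson_kernel x y = ell2_cinner (E y) (E x)"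
  shows "hilbert_on H ip S = (\<lambda>x. fun_on S (\<lambda>v. ell2_cinner x (E v))) ` closure (cspan E S)"
proof -
  interpret R: rkhs "ball 0 1" drury_arveson_kernel H ip
    using DA by (simp add: drury_arveson_space_def)
  let ?N = "\<lambda>g h. sqrt (Re (ip (\<lambda>x. g x - h x) (\<lambda>x. g x - h x)))"
  \<comment> \<open>\<open>P\<close> is the graph of the isometry between the spans. A relation is enough, since each step only
    uses that corresponding elements have the same mutual inner products.\<close>
  define P where "P = {(fun_on (ball 0 1) (\<lambda>x. \<Sum>y\<in>T. c y * drury_arveson_kernel x y),
      \<Sum>y\<in>T. ell2_scale (c y) (E y)) | T c. finite T \<and> T \<subseteq> S}"
  have P_span: "g \<in> kernel_span S" "x \<in> cspan E S" if "(g, x) \<in> P" for g x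
    using that by (auto simp: P_def kernel_span_def cspan_def)
  have P_ex1: "\<exists>x. (g, x) \<in> P" if "g \<in> kernel_span S" for g
    using that by (auto simp: P_def kernel_span_def)
  have P_ex2: "\<exists>g. (g, x) \<in> P" if "x \<in> cspan E S" for x
    using that by (auto simp: P_def cspan_def)
  have P_mem: "g \<in> H" if "(g, x) \<in> P" for g x
    using that S unfolding P_def by (auto intro!: R.kernel_sum_mem)
  have P_eval: "g v = ell2_cinner x (E v)" if "(g, x) \<in> P" "v \<in> S" for g x v
  proof -
    obtain T c where T: "finite T" "T \<subseteq> S"
      and g: "g = fun_on (ball 0 1) (\<lambda>x. \<Sum>y\<in>T. c y * drury_arveson_kernel x y)"
      and x: "x = (\<Sum>y\<in>T. ell2_scale (c y) (E y))"
      using \<open>(g, x) \<in> P\<close> by (auto simp: P_def)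
    have "g v = (\<Sum>y\<in>T. c y * drury_arveson_kernel v y)"
      using that S by (auto simp: g fun_on_def)
    also have "\<dots> = (\<Sum>y\<in>T. c y * ell2_cinner (E y) (E v))"
      using T that by (intro sum.cong refl) (auto simp: E subset_iff)
    finally show ?thesis by (simp add: x ell2_cinner_sum_left)
  qed
  have P_ip: "ip g g' = ell2_cinner x x'" if "(g, x) \<in> P" "(g', x') \<in> P" for g x g' x'
  proof -
    obtain T c where T: "finite T" "T \<subseteq> S"
      and g: "g = fun_on (ball 0 1) (\<lambda>x. \<Sum>y\<in>T. c y * drury_arveson_kernel x y)"
      and x: "x = (\<Sum>y\<in>T. ell2_scale (c y) (E y))"
      using \<open>(g, x) \<in> P\<close> by (auto simp: P_def)
    have "ip g g' = (\<Sum>y\<in>T. c y * cnj (g' y))"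
      unfolding g using T S P_mem[OF that(2)] by (intro R.ip_kernel_sum) auto
    also have "\<dots> = (\<Sum>y\<in>T. c y * ell2_cinner (E y) x')"
      using T P_eval[OF that(2)] by (intro sum.cong refl) (auto simp: ell2_cinner_commute[of x'])
    finally show ?thesis by (simp add: x ell2_cinner_sum_left)
  qed
  have P_dist: "?N g g' = norm (x - x')" if p: "(g, x) \<in> P" "(g', x') \<in> P" for g x g' x'
  proof -
    have "Re (ip (\<lambda>y. g y - g' y) (\<lambda>y. g y - g' y)) = (norm (x - x'))\<^sup>2"
      unfolding R.ip_diff_self[OF P_mem[OF p(1)] P_mem[OF p(2)]]
      using P_ip[OF p(1) p(1)] P_ip[OF p(1) p(2)] P_ip[OF p(2) p(2)]
      by (simp add: power2_norm_eq_inner inner_ell2_def[symmetric] inner_diff inner_commute)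
    then show ?thesis by simp
  qed
  have eval_lim: "(\<lambda>j. g j v) \<longlonglongrightarrow> h v"
    if "h \<in> H" "\<And>j. g j \<in> H" "(\<lambda>j. ?N (g j) h) \<longlonglongrightarrow> 0" "v \<in> S" for h g v
  proof (rule LIM_zero_cancel, rule Lim_null_comparison)
    let ?C = "sqrt (Re (drury_arveson_kernel v v))"
    have "norm (g j v - h v) \<le> ?N (g j) h * ?C" for j
      using R.eval_le[OF _ R.diff_mem[OF that(2)[of j] that(1)], of v] that(4) S by auto
    then show "\<forall>\<^sub>F j in sequentially. norm (g j v - h v) \<le> ?N (g j) h * ?C" by simp
    show "(\<lambda>j. ?N (g j) h * ?C) \<longlonglongrightarrow> 0"
      using tendsto_mult_right[OF that(3), of ?C] by simp
  qed
  have N_sym: "?N g h = ?N h g" if "g \<in> H" "h \<in> H" for g h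
    unfolding R.ip_diff_self[OF that] R.ip_diff_self[OF that(2,1)] using R.ip_sym[OF that] by simp
  show ?thesis
  proof (intro set_eqI iffI)
    fix u assume "u \<in> hilbert_on H ip S"
    then obtain h where h: "h \<in> H" "u = fun_on S h"
      and "\<And>e. e > 0 \<Longrightarrow> \<exists>g\<in>kernel_span S. ?N h g < e"
      by (auto simp: hilbert_on_def closed_kernel_span_def)
    then have "\<exists>g\<in>kernel_span S. ?N h g < 1 / real (Suc j)" for j by simp
    then have "\<exists>g x. (g, x) \<in> P \<and> ?N h g < 1 / real (Suc j)" for j
      using P_ex1 by meson
    then obtain g x where gx: "\<And>j. (g j, x j) \<in> P" and near: "\<And>j. ?N h (g j) < 1 / real (Suc j)"
      by metis
    note gH = P_mem[OF gx]
    have tri: "?N (g i) (g j) \<le> ?N h (g j) + ?N h (g i)" for i j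
      using R.ip_triangle[OF R.diff_mem[OF h(1) gH[of j]] R.diff_mem[OF h(1) gH[of i]]] by simp
    have d: "norm (x i - x j) \<le> 1 / real (Suc j) + 1 / real (Suc i)" for i j
      using tri[of i j] near[of i] near[of j] unfolding P_dist[OF gx[of i] gx[of j]] by linarith
    have "Cauchy x"
    proof (rule CauchyI)
      fix e :: real assume "0 < e"
      then obtain M where M: "1 / real (Suc M) < e / 2"
        using nat_approx_posE[of "e/2"] by auto
      have "norm (x i - x j) < e" if "i \<ge> M" "j \<ge> M" for i j
      proof -
        have "1 / real (Suc i) \<le> 1 / real (Suc M)" "1 / real (Suc j) \<le> 1 / real (Suc M)"
          using that by (auto simp: field_simps)
        then show ?thesis using d[of i j] M by linarith
      qed
      then show "\<exists>M. \<forall>m\<ge>M. \<forall>n\<ge>M. norm (x m - x n) < e" by blast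
    qed
    then obtain l where l: "x \<longlonglongrightarrow> l"
      using Cauchy_convergent convergent_def by blast
    have lcl: "l \<in> closure (cspan E S)"
      using l P_span(2)[OF gx] closure_sequential by blast
    have "(\<lambda>j. ?N (g j) h) \<longlonglongrightarrow> 0"
    proof (rule Lim_null_comparison)
      show "\<forall>\<^sub>F j in sequentially. norm (?N (g j) h) \<le> 1 / real (Suc j)"
        using near N_sym[OF h(1) gH] R.ip_self_nonneg[OF R.diff_mem[OF gH h(1)]]
        by (intro always_eventually allI) (simp add: less_imp_le)
      show "(\<lambda>j. 1 / real (Suc j)) \<longlonglongrightarrow> 0"
        using LIMSEQ_inverse_real_of_nat by (simp add: inverse_eq_divide)
    qed
    then have "(\<lambda>j. g j v) \<longlonglongrightarrow> h v" if "v \<in> S" for v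
      using eval_lim[where g = g, OF h(1) gH] that by blast
    moreover have "(\<lambda>j. g j v) \<longlonglongrightarrow> ell2_cinner l (E v)" if "v \<in> S" for v
      unfolding P_eval[OF gx that]
      by (rule bounded_linear.tendsto[OF bounded_linear_ell2_cinner_left l])
    ultimately have "u = fun_on S (\<lambda>v. ell2_cinner l (E v))"
      unfolding h(2) fun_on_def using LIMSEQ_unique by fastforce
    then show "u \<in> (\<lambda>x. fun_on S (\<lambda>v. ell2_cinner x (E v))) ` closure (cspan E S)"
      using lcl by blast
  next
    fix u assume "u \<in> (\<lambda>x. fun_on S (\<lambda>v. ell2_cinner x (E v))) ` closure (cspan E S)"
    then obtain l where l: "l \<in> closure (cspan E S)" and u: "u = fun_on S (\<lambda>v. ell2_cinner l (E v))"
      by blast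
    then obtain x where x: "\<And>j. x j \<in> cspan E S" "x \<longlonglongrightarrow> l"
      unfolding closure_sequential by blast
    have "\<forall>j. \<exists>g. (g, x j) \<in> P"
      using P_ex2 x(1) by blast
    then obtain g where gx: "\<And>j. (g j, x j) \<in> P"
      by metis
    note gH = P_mem[OF gx]
    have "\<exists>h\<in>H. (\<lambda>n. ?N (g n) h) \<longlonglongrightarrow> 0"
    proof (rule R.complete[OF gH])
      fix e :: real assume "0 < e"
      then show "\<exists>N. \<forall>m\<ge>N. \<forall>n\<ge>N. ?N (g m) (g n) < e"
        unfolding P_dist[OF gx gx] using CauchyD[OF LIMSEQ_imp_Cauchy[OF x(2)]] by blast
    qed
    then obtain h where h: "h \<in> H" "(\<lambda>n. ?N (g n) h) \<longlonglongrightarrow> 0" by blast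
    have "h \<in> closed_kernel_span H ip S"
      unfolding closed_kernel_span_def
    proof (intro CollectI conjI allI impI)
      fix e :: real assume "0 < e"
      then have "\<forall>\<^sub>F n in sequentially. ?N (g n) h < e"
        using order_tendstoD(2)[OF h(2)] by blast
      then obtain n where "?N (g n) h < e" by (meson eventually_happens' sequentially_bot)
      then show "\<exists>g\<in>kernel_span S. ?N h g < e"
        using P_span(1)[OF gx] N_sym[OF h(1) gH] by metis
    qed (rule h(1))
    moreover have "u = fun_on S h"
    proof -
      have "h v = ell2_cinner l (E v)" if "v \<in> S" for v
      proof (rule LIMSEQ_unique[OF eval_lim[where g = g, OF h(1) gH h(2) that]])
        show "(\<lambda>j. g j v) \<longlonglongrightarrow> ell2_cinner l (E v)"
          unfolding P_eval[OF gx that]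
          by (rule bounded_linear.tendsto[OF bounded_linear_ell2_cinner_left x(2)])
      qed
      then show ?thesis by (auto simp: u fun_on_def)
    qed
    ultimately show "u \<in> hilbert_on H ip S"
      unfolding hilbert_on_def by blast
  qed
qed

section \<open>Power series that converge absolutely on the closed disc\<close>

text \<open>The values on the open disc determine the formal power series, because both radii of convergence are
  positive.\<close>

lemma powser_coeff_unique:
  fixes c d :: "nat \<Rightarrow> complex"
  assumes c: "\<And>z. cmod z < 1 \<Longrightarrow> (\<lambda>n. c n * z ^ n) sums g z"
    and d: "\<And>z. cmod z < 1 \<Longrightarrow> (\<lambda>n. d n * z ^ n) sums g z"
  shows "c = d"
proof -
  have pos: "0 < fps_conv_radius (Abs_fps u)"
    if "\<And>z. cmod z < 1 \<Longrightarrow> (\<lambda>n. u n * z ^ n) sums g z" for u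
  proof -
    have "summable (\<lambda>n. u n * (1/2) ^ n)" using that[of "1/2"] by (simp add: sums_iff)
    from conv_radius_geI[OF this] have "ereal (1/2) \<le> fps_conv_radius (Abs_fps u)"
      by (simp add: fps_conv_radius_def)
    then show ?thesis by (rule less_le_trans[rotated]) simp
  qed
  have "eval_fps (Abs_fps c) z = eval_fps (Abs_fps d) z" if "z \<in> ball 0 1" for z
    using c[of z] d[of z] that by (simp add: eval_fps_def sums_iff)
  then have "Abs_fps c = Abs_fps d"
    using eventually_nhds_in_open[of "ball 0 1" "0::complex"]
    by (intro eval_fps_eqD pos c d) (auto elim: eventually_mono)
  from arg_cong[OF this, of fps_nth] show ?thesis by (simp add: Abs_fps_inverse)
qed

lemma abs_summable_powser:
  assumes "summable (\<lambda>n. cmod (c n))" "cmod z \<le> 1"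
  shows "summable (\<lambda>n. cmod (c n * z ^ n))"
  by (rule summable_comparison_test'[OF assms(1)])
     (use power_le_one[of "cmod z"] assms(2) in \<open>auto simp: norm_mult norm_power intro!: mult_left_le\<close>)

lemma abs_powser_disc_algebra:
  assumes "summable (\<lambda>n. cmod (c n))"
  shows "fun_on (cball 0 1) (\<lambda>z. \<Sum>n. c n * z ^ n) \<in> disc_algebra"
proof -
  let ?g = "\<lambda>z. \<Sum>n. c n * z ^ n"
  have "uniform_limit (cball 0 1) (\<lambda>N z. \<Sum>n<N. c n * z ^ n) ?g sequentially"
  proof (rule Weierstrass_m_test[OF _ assms])
    show "norm (c n * z ^ n) \<le> cmod (c n)" if "z \<in> cball 0 1" for n z
      using that power_le_one[of "cmod z" n] by (auto simp: norm_mult norm_power intro!: mult_left_le)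
  qed
  then have "continuous_on (cball 0 1) ?g"
    by (rule uniform_limit_theorem[rotated]) (auto intro!: always_eventually continuous_intros)
  then have 1: "continuous_on (cball 0 1) (fun_on (cball 0 1) ?g)"
    by (rule continuous_on_eq) (auto simp: fun_on_def)
  have "?g holomorphic_on ball 0 1"
  proof (rule power_series_holomorphic)
    show "(\<lambda>n. c n * (w - 0) ^ n) sums ?g w" if "w \<in> ball 0 1" for w
      using that summable_norm_cancel[OF abs_summable_powser[OF assms, of w]]
      by (auto intro!: summable_sums)
  qed
  then have 2: "fun_on (cball 0 1) ?g holomorphic_on ball 0 1"
    by (rule holomorphic_transform) (auto simp: fun_on_def)
  show ?thesis using 1 2 by (auto simp: disc_algebra_def fun_on_def)
qed

section \<open>Renewal sequences\<close>

text \<open>The defining identity \<open>\<Sum>a\<^sub>n z^n = 1 / (1 - \<Sum>\<beta>\<^sub>n z^n)\<close> on the disc becomes \<open>A (1 - B) = 1\<close> for formal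
  power series; comparing coefficients in \<open>A = 1 + B A\<close> gives the renewal equation.\<close>

lemma renewal_recursion_of_reciprocal:
  fixes a \<beta> :: "nat \<Rightarrow> real"
  assumes \<beta>: "summable (\<lambda>n. \<beta> (Suc n))" "\<And>n. 0 \<le> \<beta> n" "(\<Sum>n. \<beta> (Suc n)) < 1"
    and a: "\<And>z :: complex. z \<in> ball 0 1 \<Longrightarrow> (\<lambda>n. of_real (a n) * z ^ n) sums
      inverse (1 - (\<Sum>n. of_real (\<beta> (Suc n)) * z ^ Suc n))"
  shows "a 0 = 1" and "a (Suc n) = (\<Sum>i\<le>n. \<beta> (Suc i) * a (n - i))"
proof -
  define A where "A = Abs_fps (\<lambda>n. complex_of_real (a n))"
  define B where "B = Abs_fps (\<lambda>n. if n = 0 then 0 else complex_of_real (\<beta> n))"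
  have summ_B: "summable (\<lambda>n. cmod (complex_of_real (\<beta> (Suc n)) * z ^ Suc n))"
    and norm_B: "cmod (\<Sum>n. complex_of_real (\<beta> (Suc n)) * z ^ Suc n) < 1" if "cmod z < 1" for z
  proof -
    have le: "cmod (complex_of_real (\<beta> (Suc n)) * z ^ Suc n) \<le> \<beta> (Suc n)" for n
      using \<beta>(2)[of "Suc n"] that power_le_one[of "cmod z" "Suc n"]
      by (auto simp: norm_mult norm_power intro!: mult_left_le simp del: power_Suc)
    show "summable (\<lambda>n. cmod (complex_of_real (\<beta> (Suc n)) * z ^ Suc n))"
      by (rule summable_comparison_test'[OF \<beta>(1)]) (use le in auto)
    from suminf_le[OF le this \<beta>(1)] summable_norm[OF this] \<beta>(3)
    show "cmod (\<Sum>n. complex_of_real (\<beta> (Suc n)) * z ^ Suc n) < 1" by simp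
  qed
  have B_sums: "(\<lambda>n. fps_nth B n * z ^ n) sums (\<Sum>n. complex_of_real (\<beta> (Suc n)) * z ^ Suc n)"
    if "cmod z < 1" for z
  proof -
    have "(\<lambda>n. fps_nth B (Suc n) * z ^ Suc n) sums (\<Sum>n. complex_of_real (\<beta> (Suc n)) * z ^ Suc n)"
      unfolding B_def using summable_norm_cancel[OF summ_B[OF that]] by (auto intro!: summable_sums)
    then show ?thesis
      by (subst (asm) sums_Suc_iff) (simp add: B_def)
  qed
  have half: "summable (\<lambda>n. fps_nth A n * (1/2) ^ n)" "summable (\<lambda>n. fps_nth B n * (1/2) ^ n)"
    using a[of "1/2"] B_sums[of "1/2"] by (auto simp: A_def sums_iff)
  have rad: "fps_conv_radius A \<ge> ereal (1/2)" "fps_conv_radius B \<ge> ereal (1/2)"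
    unfolding fps_conv_radius_def
    using conv_radius_geI[OF half(1)] conv_radius_geI[OF half(2)] by (auto simp: norm_divide)
  have "A * (1 - B) = 1"
  proof (rule eval_fps_eqD)
    have rB: "fps_conv_radius (1 - B) \<ge> ereal (1/2)"
      by (rule order_trans[OF _ fps_conv_radius_diff[of 1 B]]) (use rad(2) in simp)
    have "fps_conv_radius (A * (1 - B)) \<ge> ereal (1/2)"
      by (rule order_trans[OF min.boundedI[OF rad(1) rB] fps_conv_radius_mult])
    then show "0 < fps_conv_radius (A * (1 - B))"
      by (rule less_le_trans[rotated]) simp
    have "eval_fps (A * (1 - B)) z = eval_fps 1 z" if "z \<in> ball 0 (1/2)" for z
    proof -
      have z: "cmod z < 1/2" "cmod z < 1" using that by auto
      have "eval_fps (A * (1 - B)) z = eval_fps A z * eval_fps (1 - B) z"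
        by (rule eval_fps_mult) (use z rad rB in \<open>auto intro: less_le_trans[of _ "ereal (1/2)"]\<close>)
      also have "eval_fps (1 - B) z = 1 - eval_fps B z"
        by (subst eval_fps_diff) (use z rad in \<open>auto intro: less_le_trans[of _ "ereal (1/2)"]\<close>)
      also have "eval_fps B z = (\<Sum>n. complex_of_real (\<beta> (Suc n)) * z ^ Suc n)"
        unfolding eval_fps_def using B_sums[OF z(2)] by (simp add: sums_iff)
      also have "eval_fps A z = inverse (1 - (\<Sum>n. complex_of_real (\<beta> (Suc n)) * z ^ Suc n))"
        unfolding eval_fps_def using a[of z] z by (simp add: A_def sums_iff)
      finally have "eval_fps (A * (1 - B)) z = inverse (1 - (\<Sum>n. complex_of_real (\<beta> (Suc n)) * z ^ Suc n))
          * (1 - (\<Sum>n. complex_of_real (\<beta> (Suc n)) * z ^ Suc n))" .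
      moreover have "1 - (\<Sum>n. complex_of_real (\<beta> (Suc n)) * z ^ Suc n) \<noteq> 0"
        using norm_B[OF z(2)] by force
      ultimately show ?thesis by (simp add: eval_fps_1 del: power_Suc)
    qed
    then show "\<forall>\<^sub>F z in nhds 0. eval_fps (A * (1 - B)) z = eval_fps 1 z"
      using eventually_nhds_in_open[of "ball 0 (1/2)" "0::complex"]
      by (auto elim: eventually_mono)
  qed simp
  then have AB: "A = 1 + B * A" by (simp add: algebra_simps)
  have "fps_nth A 0 = 1" by (subst AB) (simp add: B_def)
  then show "a 0 = 1" by (simp add: A_def)
  have "fps_nth A (Suc n) = (\<Sum>i\<le>n. fps_nth B (Suc i) * fps_nth A (n - i))"
    by (subst AB) (simp add: fps_mult_nth sum.atMost_Suc_shift B_def atLeast0AtMost del: sum.atMost_Suc)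
  then have "complex_of_real (a (Suc n)) = complex_of_real (\<Sum>i\<le>n. \<beta> (Suc i) * a (n - i))"
    by (simp add: A_def B_def)
  then show "a (Suc n) = (\<Sum>i\<le>n. \<beta> (Suc i) * a (n - i))"
    by (simp only: of_real_eq_iff)
qed

text \<open>In probabilistic terms, \<open>\<beta>\<close> is the distribution of a defective waiting time and \<open>a\<^sub>n\<close> the probability of
  a renewal at time \<open>n\<close>.\<close>

locale renewal_sequence =
  fixes a \<beta> :: "nat \<Rightarrow> real"
  assumes \<beta>_nonneg: "0 \<le> \<beta> n" and \<beta>_1: "0 < \<beta> 1"
    and \<beta>_summable: "summable (\<lambda>n. \<beta> (Suc n))" and \<beta>_defect: "(\<Sum>n. \<beta> (Suc n)) < 1"
    and a_0: "a 0 = 1" and a_Suc: "a (Suc n) = (\<Sum>i\<le>n. \<beta> (Suc i) * a (n - i))"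
begin

lemma a_pos: "0 < a n"
proof (induction n rule: less_induct)
  case (less n)
  show ?case
  proof (cases n)
    case (Suc m)
    have "0 < \<beta> (Suc 0) * a (m - 0)" using \<beta>_1 less Suc by simp
    also have "\<dots> \<le> (\<Sum>i\<le>m. \<beta> (Suc i) * a (m - i))"
      by (rule member_le_sum) (use \<beta>_nonneg less Suc in \<open>auto simp: less_imp_le intro!: mult_nonneg_nonneg\<close>)
    finally show ?thesis by (simp add: Suc a_Suc)
  qed (simp add: a_0)
qed

lemma a_nonneg: "0 \<le> a n"
  using a_pos less_imp_le by blast

text \<open>This is the last term of the renewal equation, with \<open>a\<^sub>0 = 1\<close>.\<close>

lemma \<beta>_le_a: "\<beta> (Suc n) \<le> a (Suc n)"
proof -
  have "\<beta> (Suc n) * a (n - n) \<le> (\<Sum>i\<le>n. \<beta> (Suc i) * a (n - i))"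
    by (rule member_le_sum) (use \<beta>_nonneg a_nonneg in auto)
  then show ?thesis by (simp add: a_0 a_Suc)
qed

text \<open>A renewal at \<open>m\<close> followed by one at \<open>m + n\<close> is one way to have a renewal at \<open>m + n\<close>.
  Formally: apply the induction hypothesis to the terms of the renewal equation for \<open>m\<close>, which
  then are the first terms of the renewal equation for \<open>m + n\<close>.\<close>

lemma a_supermult: "a m * a n \<le> a (m + n)"
proof (induction m rule: less_induct)
  case (less m)
  show ?case
  proof (cases m)
    case (Suc p)
    have "a m * a n = (\<Sum>i\<le>p. \<beta> (Suc i) * (a (p - i) * a n))"
      by (simp add: Suc a_Suc sum_distrib_right mult.assoc)
    also have "\<dots> \<le> (\<Sum>i\<le>p. \<beta> (Suc i) * a (p + n - i))"
    proof (rule sum_mono)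
      fix i assume "i \<in> {..p}"
      then have "a (p - i) * a n \<le> a (p + n - i)"
        using less[of "p - i"] Suc by simp
      then show "\<beta> (Suc i) * (a (p - i) * a n) \<le> \<beta> (Suc i) * a (p + n - i)"
        by (rule mult_left_mono[OF _ \<beta>_nonneg])
    qed
    also have "\<dots> \<le> (\<Sum>i\<le>p + n. \<beta> (Suc i) * a (p + n - i))"
      by (rule sum_mono2) (use \<beta>_nonneg a_nonneg in auto)
    finally show ?thesis by (simp add: Suc a_Suc)
  qed (simp add: a_0)
qed

text \<open>With \<open>q = \<Sum>\<beta>\<^sub>n < 1\<close>, the renewal equation gives \<open>S\<^sub>N\<^sub>+\<^sub>1 \<le> 1 + q S\<^sub>N\<close> for the partial sums \<open>S\<^sub>N\<close> of \<open>a\<close>, so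
  all of them stay below the fixed point \<open>1 / (1 - q)\<close>.\<close>

lemma a_summable: "summable a"
proof (rule summableI_nonneg_bounded)
  let ?q = "\<Sum>n. \<beta> (Suc n)"
  have q: "0 \<le> ?q" by (intro suminf_nonneg \<beta>_summable \<beta>_nonneg)
  show "sum a {..<N} \<le> 1 / (1 - ?q)" for N
  proof (induction N)
    case 0
    then show ?case using \<beta>_defect by simp
  next
    case (Suc N)
    have "(\<Sum>n<N. a (Suc n)) = (\<Sum>(i,j)\<in>{(i,j). i + j < N}. \<beta> (Suc i) * a j)"
      unfolding a_Suc by (rule sum.triangle_reindex[symmetric])
    also have "\<dots> \<le> (\<Sum>(i,j)\<in>{..<N} \<times> {..<N}. \<beta> (Suc i) * a j)"
      by (rule sum_mono2) (use \<beta>_nonneg a_nonneg in auto)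
    also have "\<dots> = (\<Sum>i<N. \<beta> (Suc i)) * (\<Sum>j<N. a j)"
      by (simp add: sum_product sum.cartesian_product)
    also have "\<dots> \<le> ?q * (1 / (1 - ?q))"
      using Suc.IH q
      by (intro mult_mono sum_le_suminf \<beta>_summable sum_nonneg) (auto simp: \<beta>_nonneg a_nonneg)
    finally have "sum a {..<Suc N} \<le> 1 + ?q * (1 / (1 - ?q))"
      by (simp only: sum.lessThan_Suc_shift a_0)
    also have "\<dots> = 1 / (1 - ?q)" using \<beta>_defect by (simp add: field_simps)
    finally show ?case .
  qed
qed (rule a_nonneg)

lemma a_power_summable:
  assumes "cmod u \<le> 1"
  shows "summable (\<lambda>n. norm (complex_of_real (a n) * u ^ n))"
  by (rule summable_comparison_test'[OF a_summable])
     (use a_nonneg power_le_one[of "cmod u"] assms in \<open>auto simp: norm_mult norm_power intro!: mult_left_le\<close>)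

text \<open>The reciprocal identity persists on the unit circle, because both series converge absolutely there and
  the renewal equation is a Cauchy product.\<close>

lemma kernel_series:
  assumes u: "cmod u \<le> 1"
  shows "(\<Sum>n. complex_of_real (a n) * u ^ n) = 1 / (1 - (\<Sum>n. complex_of_real (\<beta> (Suc n)) * u ^ Suc n))"
proof -
  let ?A = "\<lambda>n. complex_of_real (a n) * u ^ n"
  let ?B = "\<lambda>n. complex_of_real (\<beta> (Suc n)) * u ^ Suc n"
  have B: "summable (\<lambda>n. norm (?B n))"
    by (rule summable_comparison_test'[OF \<beta>_summable])
       (use \<beta>_nonneg power_le_one[of "cmod u"] u in
         \<open>auto simp: norm_mult norm_power intro!: mult_left_le simp del: power_Suc\<close>)
  have A: "summable ?A" using a_power_summable[OF u] by (rule summable_norm_cancel)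
  have "(\<Sum>n. ?B n) * (\<Sum>n. ?A n) = (\<Sum>k. \<Sum>i\<le>k. ?B i * ?A (k - i))"
    by (rule Cauchy_product[OF B a_power_summable[OF u]])
  also have "\<dots> = (\<Sum>k. ?A (Suc k))"
  proof (intro suminf_cong)
    fix k
    have "?B i * ?A (k - i) = of_real (\<beta> (Suc i) * a (k - i)) * u ^ Suc k" if "i \<le> k" for i
      using that by (simp add: power_add[symmetric] algebra_simps)
    then have "(\<Sum>i\<le>k. ?B i * ?A (k - i)) = (\<Sum>i\<le>k. of_real (\<beta> (Suc i) * a (k - i)) * u ^ Suc k)"
      by (intro sum.cong) auto
    also have "\<dots> = ?A (Suc k)" by (simp add: a_Suc sum_distrib_right)
    finally show "(\<Sum>i\<le>k. ?B i * ?A (k - i)) = ?A (Suc k)" .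
  qed
  also have "\<dots> = (\<Sum>n. ?A n) - 1"
    using suminf_split_head[OF A] by (simp add: a_0)
  finally have "(\<Sum>n. ?A n) * (1 - (\<Sum>n. ?B n)) = 1" by (simp add: algebra_simps)
  then show ?thesis
    by (metis mult_zero_right nonzero_eq_divide_eq zero_neq_one)
qed

text \<open>One index \<open>N\<close> with \<open>a\<^sub>N \<ge> t^N\<close> suffices: supermultiplicativity gives the bound at all multiples of \<open>N\<close>,
  and the finitely many values \<open>a\<^sub>s\<close> with \<open>s < N\<close> account for the remainder.\<close>

lemma a_lower_bound:
  assumes t: "0 < t" "t < 1" and large: "t ^ N \<le> \<beta> N" "N \<ge> 1"
  obtains \<delta> where "0 < \<delta>" "\<And>n. \<delta> * t ^ n \<le> a n"
proof
  let ?\<delta> = "Min (a ` {..<N})"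
  have ne: "a ` {..<N} \<noteq> {}" using large(2) by (auto simp: lessThan_empty_iff)
  show \<delta>: "0 < ?\<delta>" using a_pos ne by (subst Min_gr_iff) auto
  have aN: "t ^ N \<le> a N" using large \<beta>_le_a[of "N - 1"] by simp
  have pow: "(t ^ N) ^ q \<le> a (q * N)" for q
  proof (induction q)
    case (Suc q)
    have "t ^ N * (t ^ N) ^ q \<le> a N * a (q * N)"
      using Suc aN t a_nonneg by (intro mult_mono) auto
    also have "\<dots> \<le> a (Suc q * N)" using a_supermult[of N "q * N"] by simp
    finally show ?case by simp
  qed (simp add: a_0)
  show "?\<delta> * t ^ n \<le> a n" for n
  proof -
    let ?q = "n div N" and ?s = "n mod N"
    have "?s < N" using large(2) by simp
    then have "?\<delta> \<le> a ?s" by (intro Min_le) auto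
    moreover have "t ^ n \<le> (t ^ N) ^ ?q"
      using t by (auto simp: power_mult[symmetric] intro!: power_decreasing)
    ultimately have "?\<delta> * t ^ n \<le> a ?s * a (?q * N)"
      using pow[of ?q] t a_nonneg by (intro mult_mono) auto
    also have "\<dots> \<le> a (?s + ?q * N)" by (rule a_supermult)
    finally show ?thesis by simp
  qed
qed

end

text \<open>Otherwise \<open>\<beta>\<^sub>n < t^n\<close> for all \<open>n \<ge> 1\<close>, and the series would converge at some \<open>s\<close> with \<open>1 < s < 1 / t\<close>.\<close>

lemma not_dominated_if_conv_radius_1:
  fixes \<beta> :: "nat \<Rightarrow> real"
  assumes "conv_radius (\<lambda>n. if n = 0 then 0 else \<beta> n) = 1" "\<And>n. 0 \<le> \<beta> n" "0 < t" "t < 1"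
  obtains N where "N \<ge> 1" "t ^ N \<le> \<beta> N"
proof -
  have "\<exists>N\<ge>1. t ^ N \<le> \<beta> N"
  proof (rule ccontr)
    assume "\<not> ?thesis"
    then have small: "\<And>n. n \<ge> 1 \<Longrightarrow> \<beta> n \<le> t ^ n" by force
    obtain s where s: "1 < s" "s * t < 1"
    proof
      \<comment> \<open>the midpoint of the interval from \<open>1\<close> to \<open>1 / t\<close>\<close>
      show "1 < (1 + 1/t) / 2" using assms(3,4) by (simp add: field_simps)
      show "(1 + 1/t) / 2 * t < 1" using assms(3,4) by (simp add: field_simps)
    qed
    have "summable (\<lambda>n. (if n = 0 then 0 else \<beta> n) * s ^ n)"
    proof (rule summable_comparison_test')
      show "summable (\<lambda>n. (s * t) ^ n)" using s assms(3) by (intro summable_geometric) auto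
      show "norm ((if n = 0 then 0 else \<beta> n) * s ^ n) \<le> (s * t) ^ n" for n
        using small[of n] assms(2)[of n] s(1) assms(3) by (auto simp: power_mult_distrib mult.commute intro!: mult_left_mono)
    qed
    from conv_radius_geI[OF this] have "ereal s \<le> 1" using s by (simp add: assms(1))
    then show False using s by (simp add: one_ereal_def)
  qed
  then show ?thesis using that by blast
qed

section \<open>Weighted spaces of power series and their multipliers\<close>

text \<open>The normalisation by \<open>\<surd>a\<^sub>n\<close> makes \<open>1, z, z^2, \<dots>\<close>, each multiplied by its \<open>\<surd>a\<^sub>n\<close>, the orthonormal
  basis, so that the norm of the weighted space is the norm of \<open>ell2\<close>.\<close>

definition weighted_series :: "(nat \<Rightarrow> real) \<Rightarrow> ell2 \<Rightarrow> complex \<Rightarrow> complex" where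
  "weighted_series a x z = (\<Sum>n. complex_of_real (sqrt (a n)) * coord x n * z ^ n)"

definition weighted_space :: "(nat \<Rightarrow> real) \<Rightarrow> (complex \<Rightarrow> complex) set" where
  "weighted_space a = range (\<lambda>x. fun_on (cball 0 1) (weighted_series a x))"

definition weighted_multipliers :: "(nat \<Rightarrow> real) \<Rightarrow> (complex \<Rightarrow> complex) set" where
  "weighted_multipliers a = {m. (\<forall>z. z \<notin> cball 0 1 \<longrightarrow> m z = 0) \<and>
     (\<forall>g\<in>weighted_space a. (\<lambda>z. m z * g z) \<in> weighted_space a)}"

definition feature :: "(nat \<Rightarrow> real) \<Rightarrow> complex \<Rightarrow> ell2" where
  "feature a z = Abs_ell2 (\<lambda>n. complex_of_real (sqrt (a n)) * cnj z ^ n)"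

definition weighted_coeffs :: "(nat \<Rightarrow> real) \<Rightarrow> (nat \<Rightarrow> complex) \<Rightarrow> ell2" where
  "weighted_coeffs a c = Abs_ell2 (\<lambda>n. c n / complex_of_real (sqrt (a n)))"

locale disc_weight =
  fixes a :: "nat \<Rightarrow> real"
  assumes a_0: "a 0 = 1" and a_pos: "0 < a n" and a_summable: "summable a"
    and a_supermult: "a m * a n \<le> a (m + n)"
    and a_subexp: "0 < t \<Longrightarrow> t < 1 \<Longrightarrow> \<exists>\<delta>>0. \<forall>n. \<delta> * t ^ n \<le> a n"
begin

lemma a_nonneg: "0 \<le> a n"
  using a_pos less_imp_le by blast

lemma coord_feature:
  assumes "cmod z \<le> 1"
  shows "coord (feature a z) n = complex_of_real (sqrt (a n)) * cnj z ^ n"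
  unfolding feature_def
proof (rule coord_Abs_ell2, rule summable_comparison_test'[OF a_summable])
  show "norm ((cmod (complex_of_real (sqrt (a n)) * cnj z ^ n))\<^sup>2) \<le> a n" for n
    using a_nonneg[of n] power_le_one[of "cmod z" "n * 2"] assms
    by (auto simp: norm_mult norm_power power_mult_distrib power_mult[symmetric] intro!: mult_left_le)
qed

lemma weighted_series_eq_cinner:
  "cmod z \<le> 1 \<Longrightarrow> weighted_series a x z = ell2_cinner x (feature a z)"
  unfolding weighted_series_def ell2_cinner_def
  by (intro suminf_cong) (simp add: coord_feature mult_ac)

lemma bounded_linear_weighted_series:
  "cmod z \<le> 1 \<Longrightarrow> bounded_linear (\<lambda>x. weighted_series a x z)"
  using bounded_linear_ell2_cinner_left by (simp add: weighted_series_eq_cinner)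

lemma weighted_series_scale:
  "cmod z \<le> 1 \<Longrightarrow> weighted_series a (ell2_scale c x) z = c * weighted_series a x z"
  by (simp add: weighted_series_eq_cinner ell2_cinner_scale_left)

lemma weighted_series_abs_summable: "summable (\<lambda>n. cmod (complex_of_real (sqrt (a n)) * coord x n))"
proof (rule summable_comparison_test')
  show "summable (\<lambda>n. a n + (cmod (coord x n))\<^sup>2)"
    by (intro summable_add a_summable summable_coord)
  show "norm (cmod (complex_of_real (sqrt (a n)) * coord x n)) \<le> a n + (cmod (coord x n))\<^sup>2" for n
  proof -
    have "0 \<le> sqrt (a n) * cmod (coord x n)" using a_nonneg[of n] by simp
    moreover have "2 * (sqrt (a n) * cmod (coord x n)) \<le> a n + (cmod (coord x n))\<^sup>2"
      using sum_squares_bound[of "sqrt (a n)" "cmod (coord x n)"] a_nonneg[of n] by simp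
    ultimately have "sqrt (a n) * cmod (coord x n) \<le> a n + (cmod (coord x n))\<^sup>2" by linarith
    then show ?thesis using a_nonneg[of n] by (simp add: norm_mult)
  qed
qed

lemma weighted_series_sums:
  "cmod z \<le> 1 \<Longrightarrow> (\<lambda>n. complex_of_real (sqrt (a n)) * coord x n * z ^ n) sums weighted_series a x z"
  unfolding weighted_series_def
  by (intro summable_sums summable_norm_cancel[OF abs_summable_powser] weighted_series_abs_summable)

lemma coord_weighted_coeffs:
  assumes "summable (\<lambda>n. (cmod (c n))\<^sup>2 / a n)"
  shows "coord (weighted_coeffs a c) n = c n / complex_of_real (sqrt (a n))"
  unfolding weighted_coeffs_def
proof (rule coord_Abs_ell2)
  show "summable (\<lambda>n. (cmod (c n / complex_of_real (sqrt (a n))))\<^sup>2)"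
    using assms by (simp add: norm_divide power_divide a_nonneg)
qed

lemma weighted_series_weighted_coeffs:
  assumes "summable (\<lambda>n. (cmod (c n))\<^sup>2 / a n)"
  shows "weighted_series a (weighted_coeffs a c) z = (\<Sum>n. c n * z ^ n)"
  unfolding weighted_series_def coord_weighted_coeffs[OF assms] using a_pos
  by (intro suminf_cong) (simp add: less_imp_neq[symmetric])

lemma norm_weighted_coeffs:
  assumes "summable (\<lambda>n. (cmod (c n))\<^sup>2 / a n)"
  shows "(norm (weighted_coeffs a c))\<^sup>2 = (\<Sum>n. (cmod (c n))\<^sup>2 / a n)"
  unfolding norm_ell2_squared coord_weighted_coeffs[OF assms]
  by (simp add: norm_divide power_divide a_nonneg)

lemma weighted_spaceI:
  assumes "summable (\<lambda>n. (cmod (c n))\<^sup>2 / a n)"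
    and "\<And>z. cmod z \<le> 1 \<Longrightarrow> h z = (\<Sum>n. c n * z ^ n)" "\<And>z. z \<notin> cball 0 1 \<Longrightarrow> h z = 0"
  shows "h \<in> weighted_space a"
proof -
  have "h = fun_on (cball 0 1) (weighted_series a (weighted_coeffs a c))"
    using assms by (auto simp: fun_on_def weighted_series_weighted_coeffs fun_eq_iff)
  then show ?thesis by (simp add: weighted_space_def)
qed

text \<open>The coefficients of a member of the space are determined by its values; thus any power series
  representing it has square summable normalised coefficients.\<close>

lemma weighted_space_coeffs:
  assumes "fun_on (cball 0 1) g \<in> weighted_space a"
    and "\<And>z. cmod z < 1 \<Longrightarrow> (\<lambda>n. c n * z ^ n) sums g z"
  shows "summable (\<lambda>n. (cmod (c n))\<^sup>2 / a n)"
proof -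
  obtain x where x: "fun_on (cball 0 1) g = fun_on (cball 0 1) (weighted_series a x)"
    using assms(1) by (auto simp: weighted_space_def)
  have "weighted_series a x z = g z" if "cmod z < 1" for z
    using fun_cong[OF x, of z] that by (simp add: fun_on_def)
  then have "(\<lambda>n. complex_of_real (sqrt (a n)) * coord x n * z ^ n) sums g z" if "cmod z < 1" for z
    using weighted_series_sums[of z x] that by simp
  then have c: "c = (\<lambda>n. complex_of_real (sqrt (a n)) * coord x n)"
    using assms(2) by (intro powser_coeff_unique[where g = g]) auto
  have "(cmod (c n))\<^sup>2 / a n = (cmod (coord x n))\<^sup>2" for n
    using a_pos[of n] by (simp add: c norm_mult power_mult_distrib)
  then show ?thesis using summable_coord by simp
qed

lemma weighted_space_subset_disc_algebra: "weighted_space a \<subseteq> disc_algebra"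
  using abs_powser_disc_algebra[OF weighted_series_abs_summable]
  by (auto simp: weighted_space_def weighted_series_def[abs_def])

lemma monomial_mem: "fun_on (cball 0 1) (\<lambda>z. z ^ k) \<in> weighted_space a"
proof (rule weighted_spaceI[where c = "\<lambda>n. if n = k then 1 else 0"])
  show "summable (\<lambda>n. (cmod (if n = k then 1 else 0))\<^sup>2 / a n)"
    by (rule summable_finite[of "{k}"]) auto
  show "fun_on (cball 0 1) (\<lambda>z. z ^ k) z = (\<Sum>n. (if n = k then 1 else 0) * z ^ n)"
    if "cmod z \<le> 1" for z
    using that suminf_finite[of "{k}" "\<lambda>n. (if n = k then 1 else 0) * z ^ n"] by (simp add: fun_on_def)
qed (simp add: fun_on_def)

lemma one_mem: "fun_on (cball 0 1) (\<lambda>z. 1) \<in> weighted_space a"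
  using monomial_mem[of 0] by simp

lemma weighted_space_support: "g \<in> weighted_space a \<Longrightarrow> z \<notin> cball 0 1 \<Longrightarrow> g z = 0"
  by (auto simp: weighted_space_def fun_on_def)

lemma multipliers_subset_space: "weighted_multipliers a \<subseteq> weighted_space a"
proof
  fix m assume m: "m \<in> weighted_multipliers a"
  then have "(\<lambda>z. m z * fun_on (cball 0 1) (\<lambda>z. 1) z) \<in> weighted_space a"
    using one_mem by (auto simp: weighted_multipliers_def)
  also have "(\<lambda>z. m z * fun_on (cball 0 1) (\<lambda>z. 1) z) = m"
    using m by (auto simp: weighted_multipliers_def fun_on_def)
  finally show "m \<in> weighted_space a" .
qed

lemma abs_summable_if_weighted:
  assumes "summable (\<lambda>n. cmod (d n) / sqrt (a n))"
  shows "summable (\<lambda>n. cmod (d n))"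
proof (rule summable_comparison_test')
  show "summable (\<lambda>n. sqrt (suminf a) * (cmod (d n) / sqrt (a n)))"
    by (rule summable_mult[OF assms])
  show "norm (cmod (d n)) \<le> sqrt (suminf a) * (cmod (d n) / sqrt (a n))" for n
  proof -
    have "a n \<le> suminf a"
      using sum_le_suminf[OF a_summable, of "{n}"] a_nonneg by simp
    then have "sqrt (a n) * (cmod (d n) / sqrt (a n)) \<le> sqrt (suminf a) * (cmod (d n) / sqrt (a n))"
      using a_nonneg by (intro mult_right_mono) auto
    then show ?thesis using a_pos[of n] by simp
  qed
qed

text \<open>By supermultiplicativity \<open>z^k\<close> multiplies the space with norm at most \<open>1 / \<surd>a\<^sub>k\<close>, so the series converges
  absolutely in operator norm. In coordinates this is Young's inequality: the normalised coefficients of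
  the product are bounded by the convolution of the summable sequence \<open>p\<close> with the square summable
  sequence \<open>q\<close>.\<close>

theorem weighted_multiplierI:
  assumes d: "summable (\<lambda>n. cmod (d n) / sqrt (a n))"
  shows "fun_on (cball 0 1) (\<lambda>z. \<Sum>n. d n * z ^ n) \<in> weighted_multipliers a"
  unfolding weighted_multipliers_def
proof (intro CollectI conjI ballI)
  fix g assume "g \<in> weighted_space a"
  then obtain x where g: "g = fun_on (cball 0 1) (weighted_series a x)"
    by (auto simp: weighted_space_def)
  define p where "p = (\<lambda>k. cmod (d k) / sqrt (a k))"
  define q where "q = (\<lambda>k. cmod (coord x k))"
  define s where "s = (\<lambda>k. complex_of_real (sqrt (a k)) * coord x k)"
  define e where "e = (\<lambda>m. \<Sum>k\<le>m. d k * s (m - k))"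
  have p: "summable p" "\<And>k. 0 \<le> p k" using d a_nonneg by (auto simp: p_def)
  have q: "summable (\<lambda>k. (q k)\<^sup>2)" by (simp add: q_def summable_coord)
  have bound: "(cmod (e m))\<^sup>2 / a m \<le> suminf p * (\<Sum>k\<le>m. p k * (q (m - k))\<^sup>2)" for m
  proof -
    have "cmod (d k * s (m - k)) \<le> sqrt (a m) * (p k * q (m - k))" if "k \<le> m" for k
    proof -
      have "cmod (d k * s (m - k)) = (p k * q (m - k)) * sqrt (a k * a (m - k))"
        using a_pos[of k] a_nonneg[of "m - k"]
        by (simp add: p_def q_def s_def norm_mult real_sqrt_mult)
      also have "\<dots> \<le> (p k * q (m - k)) * sqrt (a m)"
        using a_supermult[of k "m - k"] that p(2)[of k]
        by (intro mult_left_mono real_sqrt_le_mono) (auto simp: q_def)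
      finally show ?thesis by (simp add: mult_ac)
    qed
    then have "cmod (e m) \<le> (\<Sum>k\<le>m. sqrt (a m) * (p k * q (m - k)))"
      unfolding e_def by (intro order_trans[OF norm_sum] sum_mono) auto
    then have "(cmod (e m))\<^sup>2 \<le> (sqrt (a m) * (\<Sum>k\<le>m. p k * q (m - k)))\<^sup>2"
      by (intro power_mono) (auto simp: sum_distrib_left)
    then have "(cmod (e m))\<^sup>2 / a m \<le> (\<Sum>k\<le>m. p k * q (m - k))\<^sup>2"
      using a_pos[of m] by (simp add: power_mult_distrib field_simps)
    \<comment> \<open>Splitting \<open>p\<close> into two square roots makes the Cauchy-Schwarz inequality lose only \<open>\<Sum>p\<close>.\<close>
    also have "\<dots> = (\<Sum>k\<le>m. sqrt (p k) * (sqrt (p k) * q (m - k)))\<^sup>2"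
      using p(2) by (simp add: mult.assoc[symmetric])
    also have "\<dots> \<le> (\<Sum>k\<le>m. (sqrt (p k))\<^sup>2) * (\<Sum>k\<le>m. (sqrt (p k) * q (m - k))\<^sup>2)"
      by (rule Cauchy_Schwarz_ineq_sum)
    also have "\<dots> = (\<Sum>k\<le>m. p k) * (\<Sum>k\<le>m. p k * (q (m - k))\<^sup>2)"
      using p(2) by (simp add: power_mult_distrib)
    also have "\<dots> \<le> suminf p * (\<Sum>k\<le>m. p k * (q (m - k))\<^sup>2)"
      using p by (intro mult_right_mono sum_le_suminf sum_nonneg) auto
    finally show ?thesis .
  qed
  have "summable (\<lambda>m. (cmod (e m))\<^sup>2 / a m)"
  proof (rule summable_comparison_test')
    show "summable (\<lambda>m. suminf p * (\<Sum>k\<le>m. p k * (q (m - k))\<^sup>2))"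
      using p q by (intro summable_mult summable_Cauchy_product) auto
    show "norm ((cmod (e m))\<^sup>2 / a m) \<le> suminf p * (\<Sum>k\<le>m. p k * (q (m - k))\<^sup>2)" for m
      using bound[of m] a_nonneg[of m] by simp
  qed
  then show "(\<lambda>z. fun_on (cball 0 1) (\<lambda>z. \<Sum>n. d n * z ^ n) z * g z) \<in> weighted_space a"
  proof (rule weighted_spaceI)
    fix z :: complex assume z: "cmod z \<le> 1"
    have "(\<Sum>n. d n * z ^ n) * (\<Sum>n. s n * z ^ n) = (\<Sum>m. \<Sum>k\<le>m. (d k * z ^ k) * (s (m - k) * z ^ (m - k)))"
      using abs_summable_if_weighted[OF d] weighted_series_abs_summable z
      by (intro Cauchy_product abs_summable_powser) (auto simp: s_def)
    also have "\<dots> = (\<Sum>m. e m * z ^ m)"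
      unfolding e_def sum_distrib_right
      by (intro suminf_cong sum.cong refl) (auto simp: power_add[symmetric] algebra_simps)
    finally show "fun_on (cball 0 1) (\<lambda>z. \<Sum>n. d n * z ^ n) z * g z = (\<Sum>n. e n * z ^ n)"
      using z by (simp add: g fun_on_def weighted_series_def s_def)
  qed (simp add: fun_on_def)
qed (simp add: fun_on_def)

lemma weighted_space_add:
  "g \<in> weighted_space a \<Longrightarrow> h \<in> weighted_space a \<Longrightarrow> (\<lambda>z. g z + h z) \<in> weighted_space a"
  unfolding weighted_space_def
  by (auto simp: fun_on_def fun_eq_iff linear_simps[OF bounded_linear_weighted_series]
      intro!: image_eqI[where x = "x + y" for x y])

lemma weighted_space_scale:
  "g \<in> weighted_space a \<Longrightarrow> (\<lambda>z. c * g z) \<in> weighted_space a"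
  unfolding weighted_space_def
  by (auto simp: fun_on_def fun_eq_iff weighted_series_scale
      intro!: image_eqI[where x = "ell2_scale c x" for x])

lemma multipliers_add:
  assumes "g \<in> weighted_multipliers a" "h \<in> weighted_multipliers a"
  shows "(\<lambda>z. g z + h z) \<in> weighted_multipliers a"
  using assms weighted_space_add[of "\<lambda>z. g z * u z" "\<lambda>z. h z * u z" for u]
  by (auto simp: weighted_multipliers_def ring_distribs)

lemma multipliers_scale:
  assumes "h \<in> weighted_multipliers a"
  shows "(\<lambda>z. c * h z) \<in> weighted_multipliers a"
  using assms weighted_space_scale[of "\<lambda>z. h z * u z" c for u]
  by (auto simp: weighted_multipliers_def mult.assoc)

lemma multipliers_mult:
  assumes "g \<in> weighted_multipliers a" "h \<in> weighted_multipliers a"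
  shows "(\<lambda>z. g z * h z) \<in> weighted_multipliers a"
  using assms by (auto simp: weighted_multipliers_def mult.assoc)

lemma monomial_multiplier: "fun_on (cball 0 1) (\<lambda>z. z ^ k) \<in> weighted_multipliers a"
proof -
  have "(\<Sum>n. (if n = k then 1 else 0) * z ^ n) = z ^ k" for z :: complex
    using suminf_finite[of "{k}" "\<lambda>n. (if n = k then 1 else 0) * z ^ n"] by simp
  moreover have "summable (\<lambda>n. cmod (if n = k then 1 else 0) / sqrt (a n))"
    by (rule summable_finite[of "{k}"]) auto
  ultimately show ?thesis
    using weighted_multiplierI[of "\<lambda>n. if n = k then 1 else 0"] by simp
qed

lemma coordinate_multiplier: "fun_on (cball 0 1) (\<lambda>z. z) \<in> weighted_multipliers a"
  using monomial_multiplier[of 1] by simp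

lemma one_multiplier: "fun_on (cball 0 1) (\<lambda>z. 1) \<in> weighted_multipliers a"
  using monomial_multiplier[of 0] by simp

text \<open>The spectrum of the coordinate function lies in the closed unit disc. The coefficients \<open>\<lambda>^(-n-1)\<close> of
  the resolvent stay summable after division by \<open>\<surd>a\<^sub>n\<close>, because \<open>a\<^sub>n \<ge> \<delta> t^n\<close> already with
  \<open>t = 1 / \<bar>\<lambda>\<bar>\<close>, which leaves the convergent geometric series with ratio \<open>\<surd>t\<close>.\<close>

lemma coordinate_resolvent:
  assumes l: "1 < cmod l"
  shows "fun_on (cball 0 1) (\<lambda>z. 1 / (l - z)) \<in> weighted_multipliers a"
proof -
  let ?r = "1 / cmod l"
  have l_pos: "0 < cmod l" using l by linarith
  then have r: "0 < ?r" "?r < 1" using l by simp_all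
  define t where "t = ?r"
  obtain \<delta> where \<delta>: "0 < \<delta>" "\<And>n. \<delta> * t ^ n \<le> a n"
    using a_subexp[of t] r by (auto simp: t_def)
  have st: "t < sqrt t" "0 < sqrt t" "sqrt t < 1"
    using r by (auto simp: t_def[symmetric] intro!: real_less_rsqrt power_strict_decreasing[of 1 2 t, simplified])
  define d where "d = (\<lambda>n. (1 / l) ^ Suc n)"
  have "summable (\<lambda>n. cmod (d n) / sqrt (a n))"
  proof (rule summable_comparison_test')
    show "summable (\<lambda>n. (t / sqrt \<delta>) * (sqrt t) ^ n)"
      using st by (intro summable_mult summable_geometric) auto
    show "norm (cmod (d n) / sqrt (a n)) \<le> (t / sqrt \<delta>) * (sqrt t) ^ n" for n
    proof -
      have "sqrt \<delta> * sqrt t ^ n \<le> sqrt (a n)"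
        using real_sqrt_le_mono[OF \<delta>(2)[of n]] by (simp add: real_sqrt_mult real_sqrt_power)
      moreover have "cmod (d n) = t * (sqrt t ^ n * sqrt t ^ n)"
        using r by (simp add: d_def t_def norm_mult norm_divide norm_power power_divide real_sqrt_mult[symmetric] flip: power_mult_distrib)
      moreover have "0 < sqrt \<delta>" "0 < sqrt (a n)" "0 < sqrt t ^ n" using \<delta>(1) a_pos[of n] st by auto
      moreover have "0 < t" using r by (simp add: t_def)
      ultimately show ?thesis
        by (simp add: field_simps)
    qed
  qed
  from weighted_multiplierI[OF this]
  have "fun_on (cball 0 1) (\<lambda>z. \<Sum>n. d n * z ^ n) \<in> weighted_multipliers a" .
  also have "fun_on (cball 0 1) (\<lambda>z. \<Sum>n. d n * z ^ n) = fun_on (cball 0 1) (\<lambda>z. 1 / (l - z))"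
  proof -
    have "(\<Sum>n. d n * z ^ n) = 1 / (l - z)" if "cmod z \<le> 1" for z
    proof -
      have l0: "l \<noteq> 0" "l - z \<noteq> 0" using l that by auto
      have "cmod (z / l) < 1" using l l_pos that by (simp add: norm_divide)
      from sums_mult[OF geometric_sums[OF this], of "1 / l"]
      have "(\<lambda>n. d n * z ^ n) sums (1 / l * (1 / (1 - z / l)))"
        by (simp add: d_def power_divide field_simps)
      also have "1 / l * (1 / (1 - z / l)) = 1 / (l - z)" using l0 by (simp add: field_simps)
      finally show ?thesis by (simp add: sums_iff)
    qed
    then show ?thesis by (auto simp: fun_on_def)
  qed
  finally show ?thesis .
qed

end

section \<open>Comparison of the multiplier algebras of two weights\<close>

lemma unbounded_subsequence_4_power:
  fixes t :: "nat \<Rightarrow> real"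
  assumes "\<And>C. \<exists>n. C < t n"
  obtains s where "strict_mono s" "\<And>k. 4 ^ k \<le> t (s k)"
proof -
  have ex: "\<exists>n>N. C \<le> t n" for N C
  proof -
    obtain n where "max C (Max (t ` {..N})) < t n" using assms by blast
    then have n: "C < t n" "Max (t ` {..N}) < t n" by linarith+
    have "\<not> n \<le> N"
    proof
      assume "n \<le> N"
      then have "t n \<le> Max (t ` {..N})" by (intro Max_ge) auto
      then show False using n(2) by linarith
    qed
    then show ?thesis using n(1) by (intro exI[of _ n]) linarith
  qed
  have "\<exists>s. \<forall>k. 4 ^ k \<le> t (s k) \<and> s k < s (Suc k)"
  proof (rule dependent_nat_choice)
    show "\<exists>n. 4 ^ 0 \<le> t n" using ex by blast
    show "\<exists>y. 4 ^ Suc k \<le> t y \<and> x < y" for x k using ex by blast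
  qed
  then show ?thesis using that by (auto simp: strict_mono_Suc_iff)
qed

text \<open>Gliding hump: along indices \<open>n\<^sub>k\<close> with \<open>a / a' \<ge> 4^k\<close> take the coefficients \<open>2^(-k) \<surd>a\<close>. They satisfy the
  criterion for multipliers with respect to \<open>a\<close>, but after division by \<open>\<surd>a'\<close> they do not tend to
  zero.\<close>

theorem bounded_ratio_if_multipliers_subset:
  assumes "disc_weight a" "disc_weight a'"
    and sub: "weighted_multipliers a \<subseteq> weighted_multipliers a'"
  shows "\<exists>C. \<forall>n. a n / a' n \<le> C"
proof (rule ccontr)
  interpret A: disc_weight a by fact
  interpret A': disc_weight a' by fact
  assume "\<not> ?thesis"
  then have "\<And>C. \<exists>n. C < a n / a' n" by (force simp: not_le)
  then obtain s where s: "strict_mono s" "\<And>k. 4 ^ k \<le> a (s k) / a' (s k)"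
    using unbounded_subsequence_4_power[of "\<lambda>n. a n / a' n"] by metis
  define u :: "nat \<Rightarrow> real" where "u = (\<lambda>n. if n \<in> range s then (1/2) ^ (inv s n) else 0)"
  have us: "u (s k) = (1/2) ^ k" for k
    using strict_mono_imp_inj_on[OF s(1)] by (simp add: u_def inv_f_f)
  have "summable (\<lambda>k. u (s k))" unfolding us by (rule summable_geometric) simp
  then have u: "summable u"
    using summable_mono_reindex[OF s(1), of u] by (simp add: u_def)
  have u0: "0 \<le> u n" for n by (simp add: u_def)
  define d where "d = (\<lambda>n. complex_of_real (u n * sqrt (a n)))"
  have d: "summable (\<lambda>n. cmod (d n) / sqrt (a n))"
    using u u0 A.a_pos A.a_nonneg by (simp add: d_def norm_mult less_imp_neq[symmetric])
  have "fun_on (cball 0 1) (\<lambda>z. \<Sum>n. d n * z ^ n) \<in> weighted_multipliers a"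
    by (rule A.weighted_multiplierI[OF d])
  then have mem: "fun_on (cball 0 1) (\<lambda>z. \<Sum>n. d n * z ^ n) \<in> weighted_space a'"
    using sub A'.multipliers_subset_space by blast
  have "(\<lambda>n. d n * z ^ n) sums (\<Sum>n. d n * z ^ n)" if "cmod z < 1" for z
    by (intro summable_sums summable_norm_cancel[OF abs_summable_powser] A.abs_summable_if_weighted d)
       (use that in auto)
  from A'.weighted_space_coeffs[OF mem this]
  have "summable (\<lambda>n. (cmod (d n))\<^sup>2 / a' n)" .
  then have "(\<lambda>n. (cmod (d n))\<^sup>2 / a' n) \<longlonglongrightarrow> 0" by (rule summable_LIMSEQ_zero)
  then have "(\<lambda>k. (cmod (d (s k)))\<^sup>2 / a' (s k)) \<longlonglongrightarrow> 0"
    using LIMSEQ_subseq_LIMSEQ[OF _ s(1)] by (force simp: o_def)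
  moreover have "1 \<le> (cmod (d (s k)))\<^sup>2 / a' (s k)" for k
  proof -
    have "cmod (d (s k)) = (1/2) ^ k * sqrt (a (s k))"
      unfolding d_def norm_of_real us using A.a_nonneg[of "s k"] by simp
    moreover have "((1/2) ^ k)\<^sup>2 = (1/4 :: real) ^ k"
      unfolding power2_eq_square power_mult_distrib[symmetric] by simp
    ultimately have "(cmod (d (s k)))\<^sup>2 / a' (s k) = (1/4) ^ k * (a (s k) / a' (s k))"
      using A.a_nonneg[of "s k"] by (simp add: power_mult_distrib)
    also have "\<dots> \<ge> (1/4) ^ k * 4 ^ k"
      by (intro mult_left_mono s(2)) simp
    finally show ?thesis by (simp add: power_mult_distrib[symmetric])
  qed
  ultimately have "1 \<le> (0::real)"
    by (intro LIMSEQ_le_const) auto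
  then show False by simp
qed

lemma weighted_space_subset_if_bounded_ratio:
  assumes "disc_weight a" "disc_weight a'" and C: "\<And>n. a n / a' n \<le> C"
  shows "weighted_space a \<subseteq> weighted_space a'"
proof
  interpret A: disc_weight a by fact
  interpret A': disc_weight a' by fact
  fix g assume "g \<in> weighted_space a"
  then obtain x where g: "g = fun_on (cball 0 1) (weighted_series a x)"
    by (auto simp: weighted_space_def)
  show "g \<in> weighted_space a'"
  proof (rule A'.weighted_spaceI)
    show "summable (\<lambda>n. (cmod (complex_of_real (sqrt (a n)) * coord x n))\<^sup>2 / a' n)"
    proof (rule summable_comparison_test')
      show "summable (\<lambda>n. C * (cmod (coord x n))\<^sup>2)" by (intro summable_mult summable_coord)
      show "norm ((cmod (complex_of_real (sqrt (a n)) * coord x n))\<^sup>2 / a' n) \<le> C * (cmod (coord x n))\<^sup>2" for n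
        using mult_right_mono[OF C[of n], of "(cmod (coord x n))\<^sup>2"] A.a_nonneg[of n] A'.a_nonneg[of n]
        by (simp add: norm_mult power_mult_distrib)
    qed
  qed (auto simp: g fun_on_def weighted_series_def)
qed

text \<open>Comparable weights give the same space of functions, and the multipliers depend only on the space, not
  on its norm.\<close>

theorem multipliers_eq_iff_comparable:
  assumes "disc_weight a" "disc_weight a'"
  shows "weighted_multipliers a = weighted_multipliers a' \<longleftrightarrow> comparable a a'"
proof
  interpret A: disc_weight a by fact
  interpret A': disc_weight a' by fact
  {
    assume eq: "weighted_multipliers a = weighted_multipliers a'"
    obtain C where C: "\<And>n. a n / a' n \<le> C"
      using bounded_ratio_if_multipliers_subset[OF assms] eq by blast
    obtain D where D: "\<And>n. a' n / a n \<le> D"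
      using bounded_ratio_if_multipliers_subset[OF assms(2,1)] eq by blast
    have CD: "0 < C" "0 < D"
      using C[of 0] D[of 0] by (auto simp: A.a_0 A'.a_0)
    have "1 / D \<le> a n / a' n" for n
      using D[of n] CD A.a_pos[of n] A'.a_pos[of n] by (simp add: field_simps)
    then show "comparable a a'"
      unfolding comparable_def using C CD by (intro exI[of _ "1/D"] exI[of _ C] conjI) auto
  next
    assume "comparable a a'"
    then obtain c C where c: "0 < c" "\<And>n. c \<le> a n / a' n" "\<And>n. a n / a' n \<le> C"
      unfolding comparable_def by blast
    have "a' n / a n \<le> 1 / c" for n
      using c(1) c(2)[of n] A.a_pos[of n] A'.a_pos[of n] by (simp add: field_simps)
    then have "weighted_space a = weighted_space a'"
      using weighted_space_subset_if_bounded_ratio[OF assms c(3)]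
        weighted_space_subset_if_bounded_ratio[OF assms(2,1)] by blast
    then show "weighted_multipliers a = weighted_multipliers a'"
      by (simp add: weighted_multipliers_def)
  }
qed

section \<open>Characters of the multiplier algebra\<close>

text \<open>A unital multiplicative functional. The function \<open>\<rho>\<close> is defined on all functions but constrained only on the
  multipliers, so that \<open>m \<mapsto> \<phi>(m \<circ> f\<^sup>-\<^sup>1)(f' w)\<close> is an instance for every isomorphism \<open>\<phi>\<close>.\<close>

locale disc_character = disc_weight +
  fixes \<rho> :: "(complex \<Rightarrow> complex) \<Rightarrow> complex"
  assumes \<rho>_add: "g \<in> weighted_multipliers a \<Longrightarrow> h \<in> weighted_multipliers a \<Longrightarrow>
      \<rho> (\<lambda>z. g z + h z) = \<rho> g + \<rho> h"
    and \<rho>_scale: "h \<in> weighted_multipliers a \<Longrightarrow> \<rho> (\<lambda>z. c * h z) = c * \<rho> h"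
    and \<rho>_mult: "g \<in> weighted_multipliers a \<Longrightarrow> h \<in> weighted_multipliers a \<Longrightarrow>
      \<rho> (\<lambda>z. g z * h z) = \<rho> g * \<rho> h"
    and \<rho>_one: "\<rho> (fun_on (cball 0 1) (\<lambda>z. 1)) = 1"

context disc_character
begin

lemma not_invertible:
  assumes h: "h \<in> weighted_multipliers a" and s: "s \<in> weighted_multipliers a"
    and inv: "\<And>z. cmod z \<le> 1 \<Longrightarrow> (c - h z) * s z = 1"
  shows "\<rho> h \<noteq> c"
proof
  assume c: "\<rho> h = c"
  let ?one = "fun_on (cball 0 1) (\<lambda>z. 1)"
  define g where "g = (\<lambda>z. c * ?one z + (- 1) * h z)"
  have "\<rho> g = \<rho> (\<lambda>z. c * ?one z) + \<rho> (\<lambda>z. (- 1) * h z)"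
    unfolding g_def by (rule \<rho>_add[OF multipliers_scale[OF one_multiplier] multipliers_scale[OF h]])
  also have "\<dots> = c * 1 + (- 1) * c"
    by (simp only: \<rho>_scale[OF one_multiplier] \<rho>_scale[OF h] \<rho>_one c)
  finally have "\<rho> g = 0" by simp
  moreover have g: "g \<in> weighted_multipliers a"
    unfolding g_def by (intro multipliers_add multipliers_scale one_multiplier h)
  have "(\<lambda>z. g z * s z) = ?one"
    using inv s by (auto simp: g_def fun_on_def weighted_multipliers_def)
  then have "\<rho> g * \<rho> s = 1" using \<rho>_mult[OF g s] by (simp add: \<rho>_one)
  ultimately show False by simp
qed

text \<open>The value of a character at \<open>z\<close> lies in the spectrum of \<open>z\<close>.\<close>

lemma character_coordinate_le_1: "cmod (\<rho> (fun_on (cball 0 1) (\<lambda>z. z))) \<le> 1"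
proof (rule ccontr)
  let ?l = "\<rho> (fun_on (cball 0 1) (\<lambda>z. z))"
  assume "\<not> ?thesis"
  then have l: "1 < cmod ?l" by simp
  have "(?l - fun_on (cball 0 1) (\<lambda>z. z) z) * fun_on (cball 0 1) (\<lambda>z. 1 / (?l - z)) z = 1"
    if "cmod z \<le> 1" for z
    using that l by (auto simp: fun_on_def)
  from not_invertible[OF coordinate_multiplier coordinate_resolvent[OF l] this] show False by blast
qed

end

text \<open>The condition makes the weighted space closed under products. It is stated without division,
  and also for \<open>n = 0\<close>, where it says \<open>1 \<le> C\<close>.\<close>

locale disc_algebra_weight = disc_weight +
  fixes C :: real
  assumes convolution_bound: "(\<Sum>k\<le>n. a k * a (n - k)) \<le> C * a n"
begin

lemma C_ge_1: "1 \<le> C"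
  using convolution_bound[of 0] by (simp add: a_0)

text \<open>Cauchy-Schwarz on each coefficient of the product with the weights \<open>a\<^sub>k a\<^sub>m\<^sub>-\<^sub>k\<close> separates the convolution
  of \<open>a\<close>, which is at most \<open>C a\<^sub>m\<close>, from the convolution of the squared normalised coefficients, which sums
  to the product of the squared norms.\<close>

lemma product_bound:
  obtains w where "\<And>z. cmod z \<le> 1 \<Longrightarrow> weighted_series a w z = weighted_series a x z * weighted_series a y z"
    and "norm w \<le> sqrt C * norm x * norm y"
proof
  define s t where "s = (\<lambda>n. complex_of_real (sqrt (a n)) * coord x n)"
    and "t = (\<lambda>n. complex_of_real (sqrt (a n)) * coord y n)"
  define e where "e = (\<lambda>m. \<Sum>k\<le>m. s k * t (m - k))"
  define v where "v = (\<lambda>m. \<Sum>k\<le>m. (cmod (coord x k))\<^sup>2 * (cmod (coord y (m - k)))\<^sup>2)"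
  have bound: "(cmod (e m))\<^sup>2 / a m \<le> C * v m" for m
  proof -
    let ?b = "\<lambda>k. sqrt (a k * a (m - k))" and ?c = "\<lambda>k. cmod (coord x k) * cmod (coord y (m - k))"
    have "cmod (e m) \<le> (\<Sum>k\<le>m. ?b k * ?c k)"
      unfolding e_def s_def t_def
      by (rule order_trans[OF norm_sum]) (auto simp: norm_mult real_sqrt_mult a_nonneg mult_ac intro!: sum_mono)
    then have "(cmod (e m))\<^sup>2 \<le> (\<Sum>k\<le>m. ?b k * ?c k)\<^sup>2"
      by (intro power_mono) auto
    also have "\<dots> \<le> (\<Sum>k\<le>m. (?b k)\<^sup>2) * (\<Sum>k\<le>m. (?c k)\<^sup>2)"
      by (rule Cauchy_Schwarz_ineq_sum)
    also have "\<dots> = (\<Sum>k\<le>m. a k * a (m - k)) * v m"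
      by (simp add: a_nonneg v_def power_mult_distrib)
    also have "\<dots> \<le> C * a m * v m"
      by (intro mult_right_mono convolution_bound) (auto simp: v_def intro!: sum_nonneg)
    finally show ?thesis using a_pos[of m] by (simp add: field_simps)
  qed
  have sv: "summable v"
    unfolding v_def by (intro summable_Cauchy_product) (auto simp: summable_coord)
  have se: "summable (\<lambda>m. (cmod (e m))\<^sup>2 / a m)"
    by (rule summable_comparison_test'[OF summable_mult[OF sv, of C]])
       (use bound a_nonneg in auto)
  show "weighted_series a (weighted_coeffs a e) z = weighted_series a x z * weighted_series a y z"
    if z: "cmod z \<le> 1" for z
  proof -
    have "(\<Sum>n. s n * z ^ n) * (\<Sum>n. t n * z ^ n) = (\<Sum>m. \<Sum>k\<le>m. (s k * z ^ k) * (t (m - k) * z ^ (m - k)))"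
      using weighted_series_abs_summable z
      by (intro Cauchy_product abs_summable_powser) (auto simp: s_def t_def)
    also have "\<dots> = (\<Sum>m. e m * z ^ m)"
      unfolding e_def sum_distrib_right
      by (intro suminf_cong sum.cong refl) (auto simp: power_add[symmetric] algebra_simps)
    finally show ?thesis
      unfolding weighted_series_weighted_coeffs[OF se] by (simp add: weighted_series_def s_def t_def)
  qed
  have "(norm (weighted_coeffs a e))\<^sup>2 \<le> (\<Sum>m. C * v m)"
    unfolding norm_weighted_coeffs[OF se] by (intro suminf_le bound se summable_mult sv)
  also have "\<dots> = C * ((norm x)\<^sup>2 * (norm y)\<^sup>2)"
    unfolding norm_ell2_squared suminf_mult[OF sv]
    by (subst Cauchy_product) (auto simp: summable_coord v_def)
  also have "\<dots> = (sqrt C * norm x * norm y)\<^sup>2"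
    using C_ge_1 by (simp add: power_mult_distrib)
  finally show "norm (weighted_coeffs a e) \<le> sqrt C * norm x * norm y"
    using C_ge_1 by (rule_tac power2_le_imp_le) auto
qed

lemma multipliers_eq_space: "weighted_multipliers a = weighted_space a"
proof
  show "weighted_space a \<subseteq> weighted_multipliers a"
  proof
    fix g assume g: "g \<in> weighted_space a"
    have "(\<lambda>z. g z * h z) \<in> weighted_space a" if h: "h \<in> weighted_space a" for h
    proof -
      obtain x y where xy: "g = fun_on (cball 0 1) (weighted_series a x)"
          "h = fun_on (cball 0 1) (weighted_series a y)"
        using g h by (auto simp: weighted_space_def)
      obtain w where "\<And>z. cmod z \<le> 1 \<Longrightarrow> weighted_series a w z = weighted_series a x z * weighted_series a y z"
        using product_bound[of x y] by blast
      then have "(\<lambda>z. g z * h z) = fun_on (cball 0 1) (weighted_series a w)"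
        by (auto simp: xy fun_on_def)
      then show ?thesis by (simp add: weighted_space_def)
    qed
    then show "g \<in> weighted_multipliers a"
      using weighted_space_support[OF g] by (simp add: weighted_multipliers_def)
  qed
qed (rule multipliers_subset_space)

text \<open>Multiplication by the function of \<open>x\<close> lifts to a map \<open>M\<close> on coefficient vectors with
  \<open>\<parallel>M y\<parallel> \<le> \<surd>C \<parallel>x\<parallel> \<parallel>y\<parallel>\<close> and \<open>\<surd>C \<parallel>x\<parallel> < 1\<close>, so the powers converge absolutely in the complete space \<open>ell2\<close>. Their sum
  represents the geometric series at each point.\<close>

lemma Neumann_inverse:
  assumes small: "sqrt C * norm x < 1"
  obtains s where "\<And>z. cmod z \<le> 1 \<Longrightarrow> (1 - weighted_series a x z) * weighted_series a s z = 1"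
proof -
  have "\<forall>y. \<exists>w. (\<forall>z. cmod z \<le> 1 \<longrightarrow> weighted_series a w z = weighted_series a x z * weighted_series a y z)
      \<and> norm w \<le> sqrt C * norm x * norm y"
  proof
    fix y
    show "\<exists>w. (\<forall>z. cmod z \<le> 1 \<longrightarrow> weighted_series a w z = weighted_series a x z * weighted_series a y z)
      \<and> norm w \<le> sqrt C * norm x * norm y"
      by (rule product_bound[of x y]) blast
  qed
  then obtain M where M: "\<And>y z. cmod z \<le> 1 \<Longrightarrow> weighted_series a (M y) z = weighted_series a x z * weighted_series a y z"
    and M_norm: "\<And>y. norm (M y) \<le> sqrt C * norm x * norm y"
    by metis
  obtain u where u: "fun_on (cball 0 1) (\<lambda>z. 1) = fun_on (cball 0 1) (weighted_series a u)"
    using one_mem by (auto simp: weighted_space_def)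
  have u1: "weighted_series a u z = 1" if "cmod z \<le> 1" for z
    using fun_cong[OF u, of z] that by (simp add: fun_on_def)
  have pow: "weighted_series a ((M ^^ n) u) z = weighted_series a x z ^ n" if "cmod z \<le> 1" for n z
    by (induction n) (use that in \<open>auto simp: M u1\<close>)
  have bound: "norm ((M ^^ n) u) \<le> norm u * (sqrt C * norm x) ^ n" for n
  proof (induction n)
    case (Suc n)
    have "norm ((M ^^ Suc n) u) \<le> sqrt C * norm x * norm ((M ^^ n) u)" using M_norm by simp
    also have "\<dots> \<le> sqrt C * norm x * (norm u * (sqrt C * norm x) ^ n)"
      using Suc C_ge_1 by (intro mult_left_mono) auto
    finally show ?case by (simp add: mult_ac)
  qed simp
  have "summable (\<lambda>n. (M ^^ n) u)"
  proof (rule summable_comparison_test')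
    show "summable (\<lambda>n. norm u * (sqrt C * norm x) ^ n)"
      using small C_ge_1 by (intro summable_mult summable_geometric) (auto simp: abs_mult)
  qed (rule bound)
  then have sums: "(\<lambda>n. (M ^^ n) u) sums (\<Sum>n. (M ^^ n) u)" by (rule summable_sums)
  have "(1 - weighted_series a x z) * weighted_series a (\<Sum>n. (M ^^ n) u) z = 1"
    if z: "cmod z \<le> 1" for z
  proof -
    have s: "(\<lambda>n. weighted_series a x z ^ n) sums weighted_series a (\<Sum>n. (M ^^ n) u) z"
      using bounded_linear.sums[OF bounded_linear_weighted_series[OF z] sums] by (simp add: pow z)
    then have lt: "cmod (weighted_series a x z) < 1"
      using summable_geometric_iff by (metis sums_summable)
    then have "weighted_series a (\<Sum>n. (M ^^ n) u) z = 1 / (1 - weighted_series a x z)"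
      using geometric_sums[OF lt] sums_unique2[OF s] by blast
    then show ?thesis using lt by auto
  qed
  then show ?thesis using that by blast
qed

end

locale disc_algebra_character = disc_character + disc_algebra_weight
begin

lemma fun_on_weighted_series_mem: "fun_on (cball 0 1) (weighted_series a x) \<in> weighted_multipliers a"
  unfolding multipliers_eq_space by (simp add: weighted_space_def)

text \<open>The character as a functional of the coefficient vector.\<close>

definition coeff_character :: "ell2 \<Rightarrow> complex" where
  "coeff_character x = \<rho> (fun_on (cball 0 1) (weighted_series a x))"

lemma coeff_character_add: "coeff_character (x + y) = coeff_character x + coeff_character y"
proof -
  have "fun_on (cball 0 1) (weighted_series a (x + y)) =
      (\<lambda>z. fun_on (cball 0 1) (weighted_series a x) z + fun_on (cball 0 1) (weighted_series a y) z)"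
    by (auto simp: fun_on_def fun_eq_iff linear_simps[OF bounded_linear_weighted_series])
  then show ?thesis
    unfolding coeff_character_def by (simp only: \<rho>_add[OF fun_on_weighted_series_mem fun_on_weighted_series_mem])
qed

lemma coeff_character_scale: "coeff_character (ell2_scale c x) = c * coeff_character x"
proof -
  have "fun_on (cball 0 1) (weighted_series a (ell2_scale c x)) =
      (\<lambda>z. c * fun_on (cball 0 1) (weighted_series a x) z)"
    by (auto simp: fun_on_def fun_eq_iff weighted_series_scale)
  then show ?thesis
    unfolding coeff_character_def by (simp only: \<rho>_scale[OF fun_on_weighted_series_mem])
qed

text \<open>Automatic continuity: if the bound failed, some \<open>h\<close> with \<open>\<rho> h = 1\<close> would have so small a norm that \<open>1 - h\<close>
  is invertible, which contradicts \<open>\<rho> (1 - h) = 0\<close>.\<close>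

lemma coeff_character_bound: "cmod (coeff_character x) \<le> sqrt C * norm x"
proof (rule ccontr)
  assume "\<not> ?thesis"
  then have lt: "sqrt C * norm x < cmod (coeff_character x)" by simp
  then have nz: "0 < cmod (coeff_character x)"
    using C_ge_1 by (metis mult_nonneg_nonneg norm_ge_zero order_le_less_trans real_sqrt_ge_zero zero_le_one order_trans)
  define y where "y = ell2_scale (1 / coeff_character x) x"
  have "coeff_character y = 1" unfolding y_def coeff_character_scale using nz by simp
  moreover have "sqrt C * norm y < 1"
    using lt nz by (simp add: y_def norm_divide field_simps)
  then obtain s where s: "\<And>z. cmod z \<le> 1 \<Longrightarrow> (1 - weighted_series a y z) * weighted_series a s z = 1"
    using Neumann_inverse[of y] by blast
  have "coeff_character y \<noteq> 1"
    unfolding coeff_character_def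
    by (rule not_invertible[OF fun_on_weighted_series_mem fun_on_weighted_series_mem[of s]])
       (use s in \<open>simp add: fun_on_def\<close>)
  ultimately show False by simp
qed

lemma \<rho>_power: "\<rho> (fun_on (cball 0 1) (\<lambda>z. z ^ n)) = \<rho> (fun_on (cball 0 1) (\<lambda>z. z)) ^ n"
proof (induction n)
  case (Suc n)
  have "fun_on (cball 0 1) (\<lambda>z. z ^ Suc n) =
      (\<lambda>z::complex. fun_on (cball 0 1) (\<lambda>z. z) z * fun_on (cball 0 1) (\<lambda>z. z ^ n) z)"
    by (auto simp: fun_on_def)
  then show ?case
    by (simp only: \<rho>_mult[OF coordinate_multiplier monomial_multiplier] Suc power_Suc)
qed (simp add: \<rho>_one)

text \<open>The character and the evaluation at \<open>\<rho> z\<close> are both continuous in the coefficient vector and agree on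
  monomials.\<close>

theorem character_is_evaluation:
  assumes "h \<in> weighted_multipliers a"
  shows "\<rho> h = h (\<rho> (fun_on (cball 0 1) (\<lambda>z. z)))"
proof -
  let ?l = "\<rho> (fun_on (cball 0 1) (\<lambda>z. z))"
  obtain x where h: "h = fun_on (cball 0 1) (weighted_series a x)"
    using assms multipliers_subset_space by (auto simp: weighted_space_def)
  have "bounded_linear coeff_character"
  proof (rule bounded_linear_intro)
    show "coeff_character (r *\<^sub>R x) = r *\<^sub>R coeff_character x" for r x
      by (simp add: scaleR_ell2_def coeff_character_scale scaleR_conv_of_real)
    show "norm (coeff_character x) \<le> norm x * sqrt C" for x
      using coeff_character_bound[of x] by (simp add: mult.commute)
  qed (rule coeff_character_add)
  moreover have "bounded_linear (\<lambda>x. weighted_series a x ?l)"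
    by (rule bounded_linear_weighted_series[OF character_coordinate_le_1])
  moreover have "coeff_character (ell2_scale c (ell2_unit n)) = weighted_series a (ell2_scale c (ell2_unit n)) ?l" for c n
  proof -
    have unit: "weighted_series a (ell2_unit n) z = complex_of_real (sqrt (a n)) * z ^ n" for z
    proof -
      have "weighted_series a (ell2_unit n) z = (\<Sum>m\<in>{n}. complex_of_real (sqrt (a m)) * coord (ell2_unit n) m * z ^ m)"
        unfolding weighted_series_def by (rule suminf_finite) (auto simp: coord_ell2_unit)
      then show ?thesis by (simp add: coord_ell2_unit)
    qed
    have "fun_on (cball 0 1) (weighted_series a (ell2_unit n)) =
        (\<lambda>z. complex_of_real (sqrt (a n)) * fun_on (cball 0 1) (\<lambda>z. z ^ n) z)"
      by (auto simp: fun_on_def unit)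
    then have "coeff_character (ell2_unit n) = complex_of_real (sqrt (a n)) * ?l ^ n"
      unfolding coeff_character_def by (simp only: \<rho>_scale[OF monomial_multiplier] \<rho>_power)
    then show ?thesis
      by (simp add: coeff_character_scale weighted_series_scale[OF character_coordinate_le_1] unit)
  qed
  ultimately have "coeff_character x = weighted_series a x ?l"
    by (rule bounded_linear_ell2_eqI)
  then show ?thesis
    using character_coordinate_le_1 by (simp add: h coeff_character_def fun_on_def)
qed

end

section \<open>Density of the kernel functions of the unit circle\<close>

lemma cspan_base: "v \<in> S \<Longrightarrow> E v \<in> cspan E S"
  unfolding cspan_def
  by (auto intro!: exI[of _ "{v}"] exI[of _ "\<lambda>_. 1"] ell2_eqI)

lemma cspan_scale:
  assumes "x \<in> cspan E S"
  shows "ell2_scale d x \<in> cspan E S"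
proof -
  obtain T c where "finite T" "T \<subseteq> S" and x: "x = (\<Sum>y\<in>T. ell2_scale (c y) (E y))"
    using assms by (auto simp: cspan_def)
  moreover have "ell2_scale d x = (\<Sum>y\<in>T. ell2_scale (d * c y) (E y))"
    by (rule ell2_eqI) (simp add: x coord_sum sum_distrib_left mult.assoc)
  ultimately show ?thesis unfolding cspan_def by (intro CollectI exI[of _ T] exI[of _ "\<lambda>y. d * c y"]) auto
qed

lemma cspan_add:
  assumes "x \<in> cspan E S" "y \<in> cspan E S"
  shows "x + y \<in> cspan E S"
proof -
  obtain T c where T: "finite T" "T \<subseteq> S" and x: "x = (\<Sum>y\<in>T. ell2_scale (c y) (E y))"
    using assms(1) by (auto simp: cspan_def)
  obtain U d where U: "finite U" "U \<subseteq> S" and y: "y = (\<Sum>y\<in>U. ell2_scale (d y) (E y))"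
    using assms(2) by (auto simp: cspan_def)
  let ?c = "\<lambda>v. if v \<in> T then c v else 0" and ?d = "\<lambda>v. if v \<in> U then d v else 0"
  have "x = (\<Sum>y\<in>T \<union> U. ell2_scale (?c y) (E y))"
    unfolding x using T U by (intro sum.mono_neutral_cong_left) (auto intro!: ell2_eqI)
  moreover have "y = (\<Sum>y\<in>T \<union> U. ell2_scale (?d y) (E y))"
    unfolding y using T U by (intro sum.mono_neutral_cong_left) (auto intro!: ell2_eqI)
  ultimately have "x + y = (\<Sum>y\<in>T \<union> U. ell2_scale (?c y + ?d y) (E y))"
    by (simp only: sum.distrib[symmetric]) (rule sum.cong[OF refl], rule ell2_eqI, simp add: algebra_simps)
  then show ?thesis
    unfolding cspan_def using T U
    by (intro CollectI exI[of _ "T \<union> U"] exI[of _ "\<lambda>y. ?c y + ?d y"]) auto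
qed

lemma cspan_subspace: "subspace (cspan E S)"
  unfolding subspace_def
proof (intro conjI allI ballI)
  show "0 \<in> cspan E S" unfolding cspan_def by (intro CollectI exI[of _ "{}"]) auto
qed (auto simp: scaleR_ell2_def cspan_add cspan_scale)

lemma closure_of_subspace:
  fixes V :: "'a :: real_normed_vector set"
  assumes V: "subspace V"
  shows "subspace (closure V)"
  unfolding subspace_def
proof (intro conjI ballI allI)
  show "0 \<in> closure V" using subspace_0[OF V] closure_subset by blast
next
  fix x y assume "x \<in> closure V" "y \<in> closure V"
  then obtain p q where "\<And>n. p n \<in> V" "p \<longlonglongrightarrow> x" "\<And>n. q n \<in> V" "q \<longlonglongrightarrow> y"
    unfolding closure_sequential by blast
  then show "x + y \<in> closure V"
    unfolding closure_sequential
    by (intro exI[of _ "\<lambda>n. p n + q n"]) (auto intro: subspace_add[OF V] tendsto_add)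
next
  fix c x assume "x \<in> closure V"
  then obtain p where "\<And>n. p n \<in> V" "p \<longlonglongrightarrow> x"
    unfolding closure_sequential by blast
  then show "c *\<^sub>R x \<in> closure V"
    unfolding closure_sequential
    by (intro exI[of _ "\<lambda>n. c *\<^sub>R p n"]) (auto intro: subspace_scale[OF V] tendsto_intros)
qed

text \<open>Summing the powers of \<open>w^n (w\<^sup>*)^m\<close>, an \<open>N\<close>-th root of unity that is \<open>1\<close> only for \<open>n \<equiv> m\<close> modulo \<open>N\<close>.
  The bound by \<open>1\<close> holds for all \<open>m\<close> and controls the aliased coefficients with \<open>m \<ge> N\<close>.\<close>

lemma roots_of_unity_orthogonal:
  fixes N n m :: nat
  assumes "0 < N"
  defines "w \<equiv> exp (2 * complex_of_real pi * \<i> / of_nat N)"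
  shows "cmod w = 1"
    and "cmod ((\<Sum>j<N. (w ^ j) ^ n * cnj (w ^ j) ^ m) / of_nat N) \<le> 1"
    and "n < N \<Longrightarrow> m < N \<Longrightarrow> (\<Sum>j<N. (w ^ j) ^ n * cnj (w ^ j) ^ m) / of_nat N = (if m = n then 1 else 0)"
proof -
  have pow: "w ^ k = exp (2 * complex_of_real pi * \<i> * of_nat k / of_nat N)" for k
    unfolding w_def exp_of_nat_mult[symmetric] by (simp add: mult_ac)
  show w: "cmod w = 1"
    by (simp add: w_def norm_exp_eq_Re)
  have wc: "w * cnj w = 1" using complex_norm_square[of w] w by simp
  let ?u = "w ^ n * cnj w ^ m"
  have eq: "(w ^ j) ^ n * cnj (w ^ j) ^ m = ?u ^ j" for j
    by (simp add: power_mult_distrib power_mult[symmetric] mult.commute)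
  show "cmod ((\<Sum>j<N. (w ^ j) ^ n * cnj (w ^ j) ^ m) / of_nat N) \<le> 1"
  proof -
    have "cmod (\<Sum>j<N. ?u ^ j) \<le> (\<Sum>j<N. 1)"
      by (rule order_trans[OF norm_sum]) (auto intro!: sum_mono simp: norm_power norm_mult w)
    then show ?thesis unfolding eq norm_divide using assms(1) by simp
  qed
  show "(\<Sum>j<N. (w ^ j) ^ n * cnj (w ^ j) ^ m) / of_nat N = (if m = n then 1 else 0)"
    if nm: "n < N" "m < N"
  proof (cases "m = n")
    case True
    then have u: "?u = 1" using wc by (simp add: power_mult_distrib[symmetric])
    show ?thesis unfolding eq u using True assms(1) by simp
  next
    case False
    have u1: "?u \<noteq> 1"
    proof
      assume u: "?u = 1"
      have "w ^ n * (w * cnj w) ^ m = w ^ m * ?u" by (simp add: power_mult_distrib mult_ac)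
      then have "w ^ m = w ^ n" unfolding u wc by simp
      then have "m mod N = n mod N"
        unfolding pow using complex_root_unity_eq[of N m n] assms(1) by simp
      then show False using nm False by simp
    qed
    have "w ^ N = 1" unfolding pow using assms(1) by simp
    then have uN: "?u ^ N = 1"
      by (simp add: power_mult_distrib power_mult[symmetric] mult.commute[of _ N] flip: complex_cnj_power)
        (simp add: power_mult)
    show ?thesis unfolding eq geometric_sum[OF u1] uN using False by simp
  qed
qed

context disc_weight
begin

text \<open>Averaging the feature vectors at the \<open>N\<close>-th roots of unity against \<open>w^n\<close> isolates the \<open>n\<close>-th
  coordinate among the first \<open>N\<close>. The error sits in the coordinates \<open>m \<ge> N\<close> and is bounded by a tail of
  \<open>\<Sum>a\<^sub>m\<close>, so the unit vectors are limits.\<close>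

theorem feature_span_dense:
  assumes E: "\<And>z. cmod z = 1 \<Longrightarrow> \<exists>v\<in>S. E v = feature a z"
  shows "closure (cspan E S) = UNIV"
proof -
  have sub: "subspace (closure (cspan E S))"
    by (rule closure_of_subspace[OF cspan_subspace])
  have unit: "ell2_scale c (ell2_unit n) \<in> closure (cspan E S)" for c n
  proof -
    define w where "w = (\<lambda>N. exp (2 * complex_of_real pi * \<i> / of_nat N))"
    define D where "D = (\<lambda>N m. (\<Sum>j<N. (w N ^ j) ^ n * cnj (w N ^ j) ^ m) / of_nat N)"
    define y where "y = (\<lambda>N. \<Sum>j<N. ell2_scale
        (c * (w N ^ j) ^ n / (of_nat N * complex_of_real (sqrt (a n)))) (feature a (w N ^ j)))"
    have w1: "cmod (w N ^ j) = 1" if "0 < N" for N j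
      unfolding w_def norm_power roots_of_unity_orthogonal(1)[OF that] by simp
    have ymem: "y N \<in> cspan E S" if N: "0 < N" for N
      unfolding y_def
    proof (rule subspace_sum[OF cspan_subspace], rule cspan_scale)
      fix j show "feature a (w N ^ j) \<in> cspan E S"
        using E[OF w1[OF N, of j]] cspan_base[of _ S E] by metis
    qed
    have ycoord: "coord (y N) m = c * complex_of_real (sqrt (a m) / sqrt (a n)) * D N m" if N: "0 < N" for N m
    proof -
      have "coord (y N) m = (\<Sum>j<N. c * complex_of_real (sqrt (a m) / sqrt (a n)) / of_nat N
           * ((w N ^ j) ^ n * cnj (w N ^ j) ^ m))"
        unfolding y_def coord_sum
        by (intro sum.cong refl) (simp add: coord_feature w1[OF N] field_simps)
      also have "\<dots> = c * complex_of_real (sqrt (a m) / sqrt (a n)) / of_nat N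
          * (\<Sum>j<N. (w N ^ j) ^ n * cnj (w N ^ j) ^ m)"
        by (rule sum_distrib_left[symmetric])
      finally show ?thesis by (simp add: D_def)
    qed
    let ?K = "(cmod c)\<^sup>2 / a n"
    have near: "(norm (y N - ell2_scale c (ell2_unit n)))\<^sup>2 \<le> ?K * (\<Sum>m. a (m + N))" if N: "n < N" for N
    proof -
      have N0: "0 < N" using N by simp
      let ?d = "y N - ell2_scale c (ell2_unit n)"
      have small: "coord ?d m = 0" if "m < N" for m
      proof -
        have "D N m = (if m = n then 1 else 0)"
          unfolding D_def w_def by (rule roots_of_unity_orthogonal(3)[OF N0 N that])
        then show ?thesis using a_pos[of n] by (simp add: ycoord[OF N0] coord_ell2_unit)
      qed
      have large: "(cmod (coord ?d m))\<^sup>2 \<le> ?K * a m" if "N \<le> m" for m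
      proof -
        have "coord ?d m = c * complex_of_real (sqrt (a m) / sqrt (a n)) * D N m"
          using that N by (simp add: ycoord[OF N0] coord_ell2_unit)
        then have "cmod (coord ?d m) = (cmod c * (sqrt (a m) / sqrt (a n))) * cmod (D N m)"
          by (simp add: norm_mult norm_divide a_nonneg)
        also have "\<dots> \<le> (cmod c * (sqrt (a m) / sqrt (a n))) * 1"
          unfolding D_def w_def using roots_of_unity_orthogonal(2)[OF N0, of n m]
          by (intro mult_left_mono) (auto simp: a_nonneg)
        finally have "(cmod (coord ?d m))\<^sup>2 \<le> (cmod c * (sqrt (a m) / sqrt (a n)))\<^sup>2"
          by (intro power_mono) auto
        then show ?thesis by (simp add: power_mult_distrib power_divide a_nonneg)
      qed
      have "(norm ?d)\<^sup>2 = (\<Sum>m. (cmod (coord ?d (m + N)))\<^sup>2) + (\<Sum>m<N. (cmod (coord ?d m))\<^sup>2)"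
        unfolding norm_ell2_squared by (rule suminf_split_initial_segment[OF summable_coord])
      also have "(\<Sum>m<N. (cmod (coord ?d m))\<^sup>2) = 0" using small by simp
      also have "(\<Sum>m. (cmod (coord ?d (m + N)))\<^sup>2) \<le> (\<Sum>m. ?K * a (m + N))"
        by (rule suminf_le[OF large summable_ignore_initial_segment[OF summable_coord]
              summable_mult[OF summable_ignore_initial_segment[OF a_summable]]]) simp
      also have "\<dots> = ?K * (\<Sum>m. a (m + N))"
        by (rule suminf_mult[OF summable_ignore_initial_segment[OF a_summable]])
      finally show ?thesis by simp
    qed
    have "(\<lambda>N. (norm (y N - ell2_scale c (ell2_unit n)))\<^sup>2) \<longlonglongrightarrow> 0"
    proof (rule Lim_null_comparison)
      show "\<forall>\<^sub>F N in sequentially. norm ((norm (y N - ell2_scale c (ell2_unit n)))\<^sup>2) \<le> ?K * (\<Sum>m. a (m + N))"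
        using eventually_gt_at_top[of n] by eventually_elim (use near in simp)
      show "(\<lambda>N. ?K * (\<Sum>m. a (m + N))) \<longlonglongrightarrow> 0"
        using tendsto_mult_right_zero[OF suminf_exist_split2[OF a_summable]] by blast
    qed
    then have "(\<lambda>N. norm (y N - ell2_scale c (ell2_unit n))) \<longlonglongrightarrow> 0"
      by (rule power_tendsto_0_iff[THEN iffD1, rotated]) simp
    then have "(\<lambda>N. y N - ell2_scale c (ell2_unit n)) \<longlonglongrightarrow> 0"
      by (rule tendsto_norm_zero_cancel)
    then have "y \<longlonglongrightarrow> ell2_scale c (ell2_unit n)"
      by (rule LIM_zero_cancel)
    then have "(\<lambda>N. y (Suc N)) \<longlonglongrightarrow> ell2_scale c (ell2_unit n)" by (rule LIMSEQ_Suc)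
    then show ?thesis
      unfolding closure_sequential by (intro exI[of _ "\<lambda>N. y (Suc N)"]) (simp add: ymem)
  qed
  have "x \<in> closure (cspan E S)" for x
  proof (rule closed_sequentially[OF closed_closure])
    show "(\<lambda>N. \<Sum>n<N. ell2_scale (coord x n) (ell2_unit n)) \<longlonglongrightarrow> x"
      using ell2_unit_expansion[of x] by (simp add: sums_def)
    show "(\<Sum>n<N. ell2_scale (coord x n) (ell2_unit n)) \<in> closure (cspan E S)" for N
      by (rule subspace_sum[OF sub unit])
  qed
  then show ?thesis by blast
qed

end

section \<open>Self-maps of the closed disc\<close>

text \<open>Both maps are nonconstant on the open disc, hence open, and so map it into itself. The composition
  \<open>\<theta> \<circ> g\<close> is the identity on the nonempty open set \<open>\<theta>(\<D>)\<close>, hence on the disc and, by continuity, on its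
  closure.\<close>

lemma disc_self_map_with_left_inverse:
  assumes \<theta>: "continuous_on (cball 0 1) \<theta>" "\<theta> holomorphic_on ball 0 1" "\<theta> ` cball 0 1 \<subseteq> cball 0 1"
    and g: "continuous_on (cball 0 1) g" "g holomorphic_on ball 0 1" "g ` cball 0 1 \<subseteq> cball 0 1"
    and inv: "\<And>w::complex. w \<in> cball 0 1 \<Longrightarrow> g (\<theta> w) = w"
  shows "\<theta> ` ball 0 1 \<subseteq> ball 0 1" "moebius_map \<theta>" "\<And>v. v \<in> cball 0 1 \<Longrightarrow> \<theta> (g v) = v"
proof -
  have nonconst: "\<not> u constant_on ball 0 1"
    if "inj_on u (ball 0 1)" for u :: "complex \<Rightarrow> complex"
  proof
    assume "u constant_on ball 0 1"
    then have "u 0 = u (1/2)" by (auto simp: constant_on_def)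
    then show False using inj_onD[OF that, of 0 "1/2"] by (simp add: norm_divide)
  qed
  have into: "u ` ball 0 1 \<subseteq> ball 0 1"
    if "u holomorphic_on ball 0 1" "u ` cball 0 1 \<subseteq> cball 0 1" "\<not> u constant_on ball 0 1"
    for u :: "complex \<Rightarrow> complex"
  proof -
    have "open (u ` ball 0 1)"
      by (rule open_mapping_thm[OF that(1) open_ball _ open_ball _ that(3)]) auto
    moreover have "u ` ball 0 1 \<subseteq> cball 0 1"
      using that(2) ball_subset_cball by blast
    ultimately have "u ` ball 0 1 \<subseteq> interior (cball 0 1)" by (rule interior_maximal[rotated])
    then show ?thesis by simp
  qed
  have inj: "inj_on \<theta> (ball 0 1)"
    using inv by (metis ball_subset_cball inj_on_inverseI subsetD)
  show th: "\<theta> ` ball 0 1 \<subseteq> ball 0 1"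
    by (rule into[OF \<theta>(2,3) nonconst[OF inj]])
  have "\<not> g constant_on ball 0 1"
  proof
    assume "g constant_on ball 0 1"
    moreover have "\<theta> 0 \<in> ball 0 1" "\<theta> (1/2) \<in> ball 0 1"
      using th by (auto simp: norm_divide image_subset_iff)
    ultimately have "g (\<theta> 0) = g (\<theta> (1/2))" by (metis constant_on_def)
    then show False by (simp add: inv norm_divide)
  qed
  then have gi: "g ` ball 0 1 \<subseteq> ball 0 1" by (rule into[OF g(2,3)])
  have op: "open (\<theta> ` ball 0 1)"
    by (rule open_mapping_thm[OF \<theta>(2) open_ball _ open_ball _ nonconst[OF inj]]) auto
  have ball_eq: "(\<theta> \<circ> g) v = v" if "v \<in> ball 0 1" for v
  proof (rule analytic_continuation_open[where s = "\<theta> ` ball 0 1" and s' = "ball 0 1"])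
    show "\<theta> \<circ> g holomorphic_on ball 0 1"
      by (rule holomorphic_on_compose_gen[OF g(2) \<theta>(2) gi])
    show "(\<theta> \<circ> g) z = z" if "z \<in> \<theta> ` ball 0 1" for z
      using that inv by auto
  qed (use op th that in auto)
  have "continuous_on (cball 0 1) (\<theta> \<circ> g)"
    by (rule continuous_on_compose[OF g(1) continuous_on_subset[OF \<theta>(1) g(3)]])
  then have c: "continuous_on (closure (ball 0 1)) (\<lambda>v. \<theta> (g v) - v)"
    by (auto intro!: continuous_intros simp: o_def)
  show right: "\<theta> (g v) = v" if "v \<in> cball 0 1" for v
    using continuous_constant_on_closure[OF c, of 0 v] ball_eq that by auto
  have "bij_betw \<theta> (ball 0 1) (ball 0 1)"
    by (rule bij_betwI[where g = g]) (use th gi inv right in auto)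
  then show "moebius_map \<theta>" using \<theta> by (simp add: moebius_map_def)
qed

section \<open>The embedded disc\<close>

lemma (in renewal_sequence) disc_weightI:
  assumes "\<And>t. 0 < t \<Longrightarrow> t < 1 \<Longrightarrow> \<exists>N\<ge>1. t ^ N \<le> \<beta> N"
  shows "disc_weight a"
proof
  show "\<exists>\<delta>>0. \<forall>n. \<delta> * t ^ n \<le> a n" if t: "0 < t" "t < 1" for t
  proof -
    obtain N where "N \<ge> 1" "t ^ N \<le> \<beta> N" using assms[OF t] by blast
    then show ?thesis using a_lower_bound[OF t, of N] by blast
  qed
qed (rule a_0 a_pos a_summable a_supermult)+

text \<open>The data of one of the two curves. The last assumption replaces the condition on the radius of
  convergence; it is what the lower bound for \<open>a\<close> uses.\<close>

locale disc_embedding =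
  fixes H :: "(ell2 \<Rightarrow> complex) set" and ip :: "(ell2 \<Rightarrow> complex) \<Rightarrow> (ell2 \<Rightarrow> complex) \<Rightarrow> complex"
    and b :: "nat \<Rightarrow> complex" and f :: "complex \<Rightarrow> ell2" and a :: "nat \<Rightarrow> real"
  assumes DA: "drury_arveson_space H ip"
    and f_ball: "f \<in> cball 0 1 \<rightarrow> ball 0 1"
    and f_coord: "z \<in> cball 0 1 \<Longrightarrow> coord (f z) n = b (Suc n) * z ^ Suc n"
    and b_1: "b 1 \<noteq> 0"
    and renewal: "renewal_sequence a (\<lambda>n. (cmod (b n))\<^sup>2)"
    and not_dominated: "0 < t \<Longrightarrow> t < 1 \<Longrightarrow> \<exists>N\<ge>1. t ^ N \<le> (cmod (b N))\<^sup>2"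
begin

sublocale R: renewal_sequence a "\<lambda>n. (cmod (b n))\<^sup>2" by (rule renewal)
sublocale disc_weight a by (rule R.disc_weightI[OF not_dominated])

definition X :: "ell2 set" where "X = f ` cball 0 1"
text \<open>The first coordinate recovers the parameter, so \<open>\<zeta>\<close> is a continuous, even linear, inverse of \<open>f\<close> on \<open>X\<close>.\<close>

definition \<zeta> :: "ell2 \<Rightarrow> complex" where "\<zeta> v = coord v 0 / b 1"
definition to_disc :: "(ell2 \<Rightarrow> complex) \<Rightarrow> complex \<Rightarrow> complex" where
  "to_disc = comp_op (cball 0 1) f"
definition from_disc :: "(complex \<Rightarrow> complex) \<Rightarrow> ell2 \<Rightarrow> complex" where
  "from_disc = comp_op X \<zeta>"
definition MX :: "(ell2 \<Rightarrow> complex) set" where "MX = multiplier_algebra H ip X"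

lemma \<zeta>_f [simp]: "cmod z \<le> 1 \<Longrightarrow> \<zeta> (f z) = z"
  using b_1 by (simp add: \<zeta>_def f_coord)

lemma f_mem [simp]: "cmod z \<le> 1 \<Longrightarrow> f z \<in> X"
  by (simp add: X_def)

lemma XE:
  assumes "v \<in> X" obtains z where "cmod z \<le> 1" "v = f z"
  using assms by (auto simp: X_def)

lemma inv_into_f [simp]: "cmod z \<le> 1 \<Longrightarrow> inv_into (cball 0 1) f (f z) = z"
  by (rule inv_into_f_f) (auto intro!: inj_on_inverseI[where g = \<zeta>])

lemma to_disc_eq: "to_disc h z = (if cmod z \<le> 1 then h (f z) else 0)"
  by (simp add: to_disc_def comp_op_def fun_on_def)

lemma from_disc_f: "cmod z \<le> 1 \<Longrightarrow> from_disc m (f z) = m z"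
  by (simp add: from_disc_def comp_op_def fun_on_def)

lemma from_disc_off: "v \<notin> X \<Longrightarrow> from_disc m v = 0"
  by (simp add: from_disc_def comp_op_def fun_on_def)

lemma to_from_disc: "(\<And>z. z \<notin> cball 0 1 \<Longrightarrow> m z = 0) \<Longrightarrow> to_disc (from_disc m) = m"
  by (auto simp: to_disc_eq from_disc_f fun_eq_iff)

lemma eq_if_to_disc_eq:
  assumes "to_disc g = to_disc h" "\<And>v. v \<notin> X \<Longrightarrow> g v = 0" "\<And>v. v \<notin> X \<Longrightarrow> h v = 0"
  shows "g = h"
proof
  fix v show "g v = h v"
  proof (cases "v \<in> X")
    case True
    then obtain z where "cmod z \<le> 1" "v = f z" by (rule XE)
    then show ?thesis using fun_cong[OF assms(1), of z] by (simp add: to_disc_eq)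
  qed (simp add: assms)
qed

definition step_series :: "complex \<Rightarrow> complex" where
  "step_series u = (\<Sum>n. complex_of_real ((cmod (b (Suc n)))\<^sup>2) * u ^ Suc n)"

lemma cinner_f:
  assumes "cmod z \<le> 1" "cmod w \<le> 1"
  shows "ell2_cinner (f z) (f w) = step_series (z * cnj w)"
  unfolding ell2_cinner_def step_series_def
proof (intro suminf_cong)
  fix n
  have "b (Suc n) * cnj (b (Suc n)) = complex_of_real ((cmod (b (Suc n)))\<^sup>2)"
    by (rule complex_norm_square[symmetric])
  moreover have "coord (f z) n * cnj (coord (f w) n) = (b (Suc n) * cnj (b (Suc n))) * (z * cnj w) ^ Suc n"
    using assms by (simp add: f_coord power_mult_distrib mult_ac)
  ultimately show "coord (f z) n * cnj (coord (f w) n) =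
      complex_of_real ((cmod (b (Suc n)))\<^sup>2) * (z * cnj w) ^ Suc n" by simp
qed

text \<open>The kernel on the curve is the generating function of \<open>a\<close> at \<open>z w\<^sup>*\<close>, and \<open>feature a\<close> factorises it.\<close>

lemma kernel_f:
  assumes "cmod z \<le> 1" "cmod w \<le> 1"
  shows "drury_arveson_kernel (f z) (f w) = ell2_cinner (feature a w) (feature a z)"
proof -
  have "cmod (z * cnj w) \<le> 1" using assms by (simp add: norm_mult mult_le_one)
  then have "drury_arveson_kernel (f z) (f w) = (\<Sum>n. complex_of_real (a n) * (z * cnj w) ^ n)"
    unfolding drury_arveson_kernel_def cinner_f[OF assms] step_series_def by (rule R.kernel_series[symmetric])
  also have "\<dots> = ell2_cinner (feature a w) (feature a z)"
    unfolding ell2_cinner_def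
  proof (intro suminf_cong)
    fix n
    have "complex_of_real (sqrt (a n)) * complex_of_real (sqrt (a n)) = complex_of_real (a n)"
      using a_nonneg[of n] by (simp flip: of_real_mult)
    moreover have "coord (feature a w) n * cnj (coord (feature a z) n) =
        (complex_of_real (sqrt (a n)) * complex_of_real (sqrt (a n))) * (z * cnj w) ^ n"
      using assms by (simp add: coord_feature power_mult_distrib mult_ac)
    ultimately show "complex_of_real (a n) * (z * cnj w) ^ n = coord (feature a w) n * cnj (coord (feature a z) n)"
      by simp
  qed
  finally show ?thesis .
qed

theorem hilbert_on_X: "hilbert_on H ip X = from_disc ` weighted_space a"
proof -
  have "hilbert_on H ip X = (\<lambda>x. fun_on X (\<lambda>v. ell2_cinner x (feature a (\<zeta> v)))) `
      closure (cspan (\<lambda>v. feature a (\<zeta> v)) X)"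
  proof (rule hilbert_on_eq[OF DA])
    show "X \<subseteq> ball 0 1" using f_ball by (auto simp: X_def)
    show "drury_arveson_kernel x y = ell2_cinner (feature a (\<zeta> y)) (feature a (\<zeta> x))"
      if "x \<in> X" "y \<in> X" for x y
      using that by (auto elim!: XE simp: kernel_f)
  qed
  also have "closure (cspan (\<lambda>v. feature a (\<zeta> v)) X) = UNIV"
  proof (rule feature_span_dense)
    show "\<exists>v\<in>X. feature a (\<zeta> v) = feature a z" if "cmod z = 1" for z
      using that by (intro bexI[of _ "f z"]) auto
  qed
  also have "(\<lambda>x. fun_on X (\<lambda>v. ell2_cinner x (feature a (\<zeta> v)))) =
      (\<lambda>x. from_disc (fun_on (cball 0 1) (weighted_series a x)))"
  proof (intro ext)
    fix x v
    show "fun_on X (\<lambda>v. ell2_cinner x (feature a (\<zeta> v))) v =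
        from_disc (fun_on (cball 0 1) (weighted_series a x)) v"
    proof (cases "v \<in> X")
      case True
      then obtain z where "cmod z \<le> 1" "v = f z" by (rule XE)
      then show ?thesis by (simp add: from_disc_f fun_on_def weighted_series_eq_cinner)
    qed (simp add: from_disc_off fun_on_def)
  qed
  finally show ?thesis by (simp add: weighted_space_def image_image)
qed

lemma mem_hilbert_on_X:
  "h \<in> hilbert_on H ip X \<longleftrightarrow> (\<forall>v. v \<notin> X \<longrightarrow> h v = 0) \<and> to_disc h \<in> weighted_space a"
proof
  assume "h \<in> hilbert_on H ip X"
  then obtain g where "g \<in> weighted_space a" "h = from_disc g" by (auto simp: hilbert_on_X)
  then show "(\<forall>v. v \<notin> X \<longrightarrow> h v = 0) \<and> to_disc h \<in> weighted_space a"
    using to_from_disc[of g] weighted_space_support by (simp add: from_disc_off)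
next
  assume h: "(\<forall>v. v \<notin> X \<longrightarrow> h v = 0) \<and> to_disc h \<in> weighted_space a"
  have "to_disc (from_disc (to_disc h)) = to_disc h"
    by (rule to_from_disc) (simp add: to_disc_eq)
  then have "h = from_disc (to_disc h)"
    using h by (intro eq_if_to_disc_eq) (auto simp: from_disc_off)
  then show "h \<in> hilbert_on H ip X" using h hilbert_on_X by blast
qed

text \<open>Multipliers on \<open>X\<close> and on the closed disc correspond to each other, because the Hilbert spaces do.\<close>

theorem mem_MX: "h \<in> MX \<longleftrightarrow> (\<forall>v. v \<notin> X \<longrightarrow> h v = 0) \<and> to_disc h \<in> weighted_multipliers a"
proof -
  have td: "to_disc (\<lambda>v. h v * g v) = (\<lambda>z. to_disc h z * to_disc g z)" for g
    by (auto simp: to_disc_eq)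
  have "(\<forall>g\<in>hilbert_on H ip X. (\<lambda>v. h v * g v) \<in> hilbert_on H ip X) \<longleftrightarrow>
      (\<forall>g\<in>weighted_space a. (\<lambda>z. to_disc h z * g z) \<in> weighted_space a)"
    if h: "\<forall>v. v \<notin> X \<longrightarrow> h v = 0"
  proof safe
    fix g assume *: "\<forall>g\<in>hilbert_on H ip X. (\<lambda>v. h v * g v) \<in> hilbert_on H ip X" and g: "g \<in> weighted_space a"
    have "to_disc (from_disc g) = g" using to_from_disc[of g] weighted_space_support[OF g] by blast
    then show "(\<lambda>z. to_disc h z * g z) \<in> weighted_space a"
      using *[rule_format, of "from_disc g"] g by (simp add: hilbert_on_X[THEN eqset_imp_iff, of "from_disc g"] mem_hilbert_on_X td from_disc_off)
  next
    fix g assume *: "\<forall>g\<in>weighted_space a. (\<lambda>z. to_disc h z * g z) \<in> weighted_space a"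
      and g: "g \<in> hilbert_on H ip X"
    then show "(\<lambda>v. h v * g v) \<in> hilbert_on H ip X"
      by (auto simp: mem_hilbert_on_X td)
  qed
  then show ?thesis
    by (auto simp: MX_def multiplier_algebra_def weighted_multipliers_def to_disc_eq)
qed

lemma from_disc_mem_MX:
  assumes "m \<in> weighted_multipliers a"
  shows "from_disc m \<in> MX" "to_disc (from_disc m) = m"
proof -
  show "to_disc (from_disc m) = m"
    using assms by (intro to_from_disc) (auto simp: weighted_multipliers_def)
  then show "from_disc m \<in> MX" using assms by (simp add: mem_MX from_disc_off)
qed

lemma MX_off: "h \<in> MX \<Longrightarrow> v \<notin> X \<Longrightarrow> h v = 0"
  by (simp add: mem_MX)

lemma MX_add:
  assumes "g \<in> MX" "h \<in> MX" shows "(\<lambda>v. g v + h v) \<in> MX"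
proof -
  have "to_disc (\<lambda>v. g v + h v) = (\<lambda>z. to_disc g z + to_disc h z)" by (auto simp: to_disc_eq)
  then show ?thesis using assms by (auto simp: mem_MX intro: multipliers_add)
qed

lemma MX_scale:
  assumes "h \<in> MX" shows "(\<lambda>v. c * h v) \<in> MX"
proof -
  have "to_disc (\<lambda>v. c * h v) = (\<lambda>z. c * to_disc h z)" by (auto simp: to_disc_eq)
  then show ?thesis using assms by (auto simp: mem_MX intro: multipliers_scale)
qed

lemma MX_mult:
  assumes "g \<in> MX" "h \<in> MX" shows "(\<lambda>v. g v * h v) \<in> MX"
proof -
  have "to_disc (\<lambda>v. g v * h v) = (\<lambda>z. to_disc g z * to_disc h z)" by (auto simp: to_disc_eq)
  then show ?thesis using assms by (auto simp: mem_MX intro: multipliers_mult)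
qed

lemma to_disc_MX_disc_algebra: "to_disc \<in> MX \<rightarrow> disc_algebra"
  using mem_MX multipliers_subset_space weighted_space_subset_disc_algebra by blast

lemma inj_point_eval: "inj_on (point_eval MX) X"
proof (rule inj_onI)
  fix v w assume vw: "v \<in> X" "w \<in> X" and eq: "point_eval MX v = point_eval MX w"
  obtain z u where z: "cmod z \<le> 1" "v = f z" and u: "cmod u \<le> 1" "w = f u"
    using vw by (meson XE)
  have "from_disc (fun_on (cball 0 1) (\<lambda>z. z)) \<in> MX"
    by (rule from_disc_mem_MX[OF coordinate_multiplier])
  with fun_cong[OF eq, of "from_disc (fun_on (cball 0 1) (\<lambda>z. z))"]
  have "z = u" using z u by (simp add: point_eval_def from_disc_f fun_on_def)
  then show "v = w" using z u by simp
qed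

lemma point_eval_character: "point_eval MX ` X \<subseteq> character_space MX"
proof
  fix \<rho> assume "\<rho> \<in> point_eval MX ` X"
  then obtain z where z: "cmod z \<le> 1" and \<rho>: "\<rho> = point_eval MX (f z)" by (auto elim: XE)
  have one: "from_disc (fun_on (cball 0 1) (\<lambda>z. 1)) \<in> MX"
    by (rule from_disc_mem_MX[OF one_multiplier])
  have "\<exists>h\<in>MX. \<rho> h \<noteq> 0"
    by (rule bexI[OF _ one]) (use z one in \<open>simp add: \<rho> point_eval_def from_disc_f fun_on_def\<close>)
  then show "\<rho> \<in> character_space MX"
    by (simp add: character_space_def \<rho> point_eval_def MX_add MX_scale MX_mult)
qed

lemma continuous_\<zeta>: "continuous_on S \<zeta>"
proof -
  have "bounded_linear (\<lambda>v. coord v 0)"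
    by (rule bounded_linear_intro[where K = 1]) (auto simp: norm_coord_le scaleR_conv_of_real)
  then show ?thesis unfolding \<zeta>_def
    using b_1 by (intro continuous_intros linear_continuous_on) auto
qed

text \<open>The distances on the curve are expressed by the continuous function \<open>step_series\<close> on the closed disc:
  \<open>\<parallel>f w - f z\<parallel>^2\<close> is a combination of its values at \<open>w w\<^sup>*\<close>, \<open>w z\<^sup>*\<close> and \<open>z z\<^sup>*\<close>, and vanishes for
  \<open>w = z\<close>.\<close>

lemma continuous_f: "continuous_on (cball 0 1) f"
proof -
  define c where "c = (\<lambda>n. if n = 0 then 0 else complex_of_real ((cmod (b n))\<^sup>2))"
  have c: "summable (\<lambda>n. cmod (c n))"
    by (subst summable_Suc_iff[symmetric]) (use R.\<beta>_summable in \<open>simp add: c_def norm_power\<close>)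
  have "step_series u = (\<Sum>n. c n * u ^ n)" if "cmod u \<le> 1" for u
    using suminf_split_head[OF summable_norm_cancel[OF abs_summable_powser[OF c that]]]
    by (simp add: step_series_def c_def)
  then have "fun_on (cball 0 1) step_series \<in> disc_algebra"
    using abs_powser_disc_algebra[OF c] by (simp add: fun_on_def cong: if_cong)
  then have "continuous_on (cball 0 1) (fun_on (cball 0 1) step_series)" by (simp add: disc_algebra_def)
  then have step_series: "continuous_on (cball 0 1) step_series"
    by (rule continuous_on_eq) (simp add: fun_on_def)
  have dist: "norm (f w - f z) = sqrt (Re (step_series (w * cnj w)) - 2 * Re (step_series (w * cnj z)) + Re (step_series (z * cnj z)))"
    if "cmod z \<le> 1" "cmod w \<le> 1" for z w
  proof -
    have "inner (f w - f z) (f w - f z) = inner (f w) (f w) - 2 * inner (f w) (f z) + inner (f z) (f z)"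
      by (simp add: inner_diff inner_commute)
    then show ?thesis using that by (simp add: norm_eq_sqrt_inner inner_ell2_def cinner_f)
  qed
  show ?thesis
    unfolding continuous_on_def
  proof
    fix z :: complex assume z: "z \<in> cball 0 1"
    let ?r = "\<lambda>w. Re (step_series (w * cnj w)) - 2 * Re (step_series (w * cnj z)) + Re (step_series (z * cnj z))"
    have "continuous_on (cball 0 1) (\<lambda>w. sqrt (?r w))"
      using z
      by (intro continuous_intros continuous_on_compose2[OF step_series]) (auto simp: norm_mult mult_le_one)
    then have "((\<lambda>w. sqrt (?r w)) \<longlongrightarrow> sqrt (?r z)) (at z within cball 0 1)"
      using z unfolding continuous_on_def by blast
    moreover have "?r z = 0" by simp
    ultimately have "((\<lambda>w. sqrt (?r w)) \<longlongrightarrow> 0) (at z within cball 0 1)"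
      by (simp only: real_sqrt_zero)
    then have "((\<lambda>w. norm (f w - f z)) \<longlongrightarrow> 0) (at z within cball 0 1)"
      by (rule Lim_transform_eventually)
         (use z dist in \<open>auto simp: eventually_at_filter\<close>)
    then have "((\<lambda>w. f w - f z) \<longlongrightarrow> 0) (at z within cball 0 1)"
      by (rule tendsto_norm_zero_cancel)
    then show "(f \<longlongrightarrow> f z) (at z within cball 0 1)"
      by (rule LIM_zero_cancel)
  qed
qed

text \<open>Termwise differentiation. On the smaller disc of radius \<open>\<rho>\<close> the second-order remainder of
  \<open>z^(n+1)\<close> is at most \<open>n (n + 1) \<rho>^(n-1) \<bar>y - z\<bar>^2\<close>, and the numerical factor is bounded in \<open>n\<close>; hence the
  remainder of \<open>f\<close> has norm \<open>O(\<bar>y - z\<bar>^2)\<close>.\<close>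

lemma f_derivative:
  assumes z: "cmod z < 1"
  obtains d where "(f has_derivative (\<lambda>h. ell2_scale h d)) (at z)"
proof -
  obtain \<rho> where \<rho>: "cmod z < \<rho>" "\<rho> < 1" using dense[OF z] by blast
  have \<rho>0: "0 < \<rho>" using \<rho>(1) norm_ge_zero[of z] by linarith
  have geo: "summable (\<lambda>n. 1 * x ^ n)" if "norm x < 1" for x :: real
    using summable_geometric[OF that] by simp
  have s1: "summable (\<lambda>n. diffs (\<lambda>_. 1) n * x ^ n)" if "norm x < 1" for x :: real
    using termdiff_converges[OF that geo] .
  have s2: "summable (\<lambda>n. diffs (diffs (\<lambda>_. 1)) n * \<rho> ^ n)"
    by (rule termdiff_converges[OF _ s1]) (use \<rho> \<rho>0 in auto)
  \<comment> \<open>The constants \<open>K1\<close> and \<open>K2\<close> come from the first two derivatives of the geometric series.\<close>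
  obtain K1 where K1: "\<And>n. real (Suc n) * \<rho> ^ n \<le> K1"
  proof
    fix n show "real (Suc n) * \<rho> ^ n \<le> (\<Sum>n. diffs (\<lambda>_. 1) n * \<rho> ^ n)"
      using sum_le_suminf[OF s1, of \<rho> "{n}"] \<rho> \<rho>0 by (simp add: diffs_def)
  qed
  obtain K2 where K2: "\<And>n. real (Suc n) * (real (Suc (Suc n)) * \<rho> ^ n) \<le> K2"
  proof
    fix n show "real (Suc n) * (real (Suc (Suc n)) * \<rho> ^ n) \<le> (\<Sum>n. diffs (diffs (\<lambda>_. 1)) n * \<rho> ^ n)"
      using sum_le_suminf[OF s2, of "{n}"] \<rho>0 by (simp add: diffs_def mult.assoc)
  qed
  have K_pos: "0 \<le> K1" "0 \<le> K2" using K1[of 0] K2[of 0] by auto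
  let ?q = "\<Sum>n. (cmod (b (Suc n)))\<^sup>2"
  have q: "0 \<le> ?q" by (intro suminf_nonneg R.\<beta>_summable) auto
  have part: "(\<Sum>n<N. (cmod (b (Suc n)))\<^sup>2) \<le> ?q" for N
    by (intro sum_le_suminf R.\<beta>_summable) auto
  have bound: "summable (\<lambda>n. (cmod (u n))\<^sup>2)" "norm (Abs_ell2 u) \<le> K * sqrt ?q"
    if K: "0 \<le> K" and u: "\<And>n. cmod (u n) \<le> K * cmod (b (Suc n))" for u K
  proof -
    have "(\<Sum>n<N. (cmod (u n))\<^sup>2) \<le> (K * sqrt ?q)\<^sup>2" for N
    proof -
      have "(\<Sum>n<N. (cmod (u n))\<^sup>2) \<le> (\<Sum>n<N. (K * cmod (b (Suc n)))\<^sup>2)"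
        by (intro sum_mono power_mono u) auto
      also have "\<dots> = K\<^sup>2 * (\<Sum>n<N. (cmod (b (Suc n)))\<^sup>2)"
        by (simp add: power_mult_distrib sum_distrib_left)
      also have "\<dots> \<le> K\<^sup>2 * ?q" by (intro mult_left_mono part) auto
      finally show ?thesis using q by (simp add: power_mult_distrib)
    qed
    moreover have "0 \<le> K * sqrt ?q" using K q by simp
    ultimately show "summable (\<lambda>n. (cmod (u n))\<^sup>2)" "norm (Abs_ell2 u) \<le> K * sqrt ?q"
      by (rule norm_ell2_le_if_sums_le)+
  qed
  define d where "d = Abs_ell2 (\<lambda>n. b (Suc n) * (of_nat (Suc n) * z ^ n))"
  have d: "coord d n = b (Suc n) * (of_nat (Suc n) * z ^ n)" for n
    unfolding d_def
  proof (rule coord_Abs_ell2, rule bound(1)[OF K_pos(1)])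
    fix n
    have "real (Suc n) * cmod z ^ n \<le> real (Suc n) * \<rho> ^ n"
      using \<rho> by (intro mult_left_mono power_mono) auto
    then have "real (Suc n) * cmod z ^ n \<le> K1" using K1[of n] by linarith
    then have "cmod (b (Suc n)) * (real (Suc n) * cmod z ^ n) \<le> cmod (b (Suc n)) * K1"
      by (rule mult_left_mono) simp
    then show "cmod (b (Suc n) * (of_nat (Suc n) * z ^ n)) \<le> K1 * cmod (b (Suc n))"
      unfolding norm_mult norm_power norm_of_nat by (simp only: mult.commute)
  qed
  have near: "norm ((f y - f z) - ell2_scale (y - z) d) / norm (y - z) \<le> K2 * sqrt ?q * norm (y - z)"
    if y: "cmod y \<le> \<rho>" "y \<noteq> z" for y
  proof -
    let ?u = "\<lambda>n. b (Suc n) * (((z + (y - z)) ^ Suc n - z ^ Suc n) - (y - z) * (of_nat (Suc n) * z ^ n))"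
    have u: "cmod (?u n) \<le> (K2 * (norm (y - z))\<^sup>2) * cmod (b (Suc n))" for n
    proof -
      have "norm (((z + (y - z)) ^ Suc n - z ^ Suc n) / (y - z) - of_nat (Suc n) * z ^ (Suc n - Suc 0))
          \<le> real (Suc n) * real (Suc n - Suc 0) * \<rho> ^ (Suc n - 2) * norm (y - z)"
        using y \<rho> by (intro lemma_termdiff3) auto
      also have "real (Suc n) * real (Suc n - Suc 0) * \<rho> ^ (Suc n - 2) \<le> K2"
        using K2[of "n - 1"] K_pos by (cases n) (auto simp: mult_ac)
      then have "real (Suc n) * real (Suc n - Suc 0) * \<rho> ^ (Suc n - 2) * norm (y - z) \<le> K2 * norm (y - z)"
        by (rule mult_right_mono) simp
      finally have 1: "norm (((z + (y - z)) ^ Suc n - z ^ Suc n) / (y - z) - of_nat (Suc n) * z ^ n) \<le> K2 * norm (y - z)"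
        by simp
      have "A - (y - z) * D = (y - z) * (A / (y - z) - D)" for A D
        using y(2) by (simp add: right_diff_distrib)
      then have "((z + (y - z)) ^ Suc n - z ^ Suc n) - (y - z) * (of_nat (Suc n) * z ^ n)
          = (y - z) * (((z + (y - z)) ^ Suc n - z ^ Suc n) / (y - z) - of_nat (Suc n) * z ^ n)" .
      then have "cmod (((z + (y - z)) ^ Suc n - z ^ Suc n) - (y - z) * (of_nat (Suc n) * z ^ n))
          \<le> norm (y - z) * (K2 * norm (y - z))"
        by (simp only: norm_mult) (rule mult_left_mono[OF 1], simp)
      then have "cmod (b (Suc n)) * cmod (((z + (y - z)) ^ Suc n - z ^ Suc n) - (y - z) * (of_nat (Suc n) * z ^ n))
          \<le> cmod (b (Suc n)) * (norm (y - z) * (K2 * norm (y - z)))"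
        by (rule mult_left_mono) simp
      then show ?thesis
        unfolding norm_mult[of "b (Suc n)"] by (simp only: power2_eq_square mult_ac)
    qed
    have "0 \<le> K2 * (norm (y - z))\<^sup>2" using K_pos by simp
    note bd = bound[OF this u]
    have "(f y - f z) - ell2_scale (y - z) d = Abs_ell2 ?u"
    proof (rule ell2_eqI)
      fix n
      show "coord ((f y - f z) - ell2_scale (y - z) d) n = coord (Abs_ell2 ?u) n"
        unfolding coord_Abs_ell2[OF bd(1)] using y \<rho> z
        by (simp add: f_coord d right_diff_distrib mult_ac del: power_Suc)
    qed
    then have "norm ((f y - f z) - ell2_scale (y - z) d) \<le> K2 * (norm (y - z))\<^sup>2 * sqrt ?q"
      using bd(2) by simp
    then have "norm ((f y - f z) - ell2_scale (y - z) d) / norm (y - z) \<le> (K2 * (norm (y - z))\<^sup>2 * sqrt ?q) / norm (y - z)"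
      by (rule divide_right_mono) simp
    also have "\<dots> = K2 * sqrt ?q * norm (y - z)"
      using y(2) by (simp add: power2_eq_square)
    finally show ?thesis .
  qed
  have "(f has_derivative (\<lambda>h. ell2_scale h d)) (at z)"
  proof (rule has_derivativeI_sandwich[where e = "\<rho> - cmod z" and H = "\<lambda>y. K2 * sqrt ?q * norm (y - z)"])
    show "bounded_linear (\<lambda>h. ell2_scale h d)"
      by (rule bounded_linear_intro[where K = "norm d"])
         (auto intro!: ell2_eqI simp: algebra_simps scaleR_conv_of_real)
    show "((\<lambda>y. K2 * sqrt ?q * norm (y - z)) \<longlongrightarrow> 0) (at z)"
      by (rule tendsto_eq_intros refl | simp)+
    show "norm ((f y - f z) - ell2_scale (y - z) d) / norm (y - z) \<le> K2 * sqrt ?q * norm (y - z)"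
      if "y \<noteq> z" "dist y z < \<rho> - cmod z" for y
    proof (rule near[OF _ that(1)])
      have "cmod y \<le> cmod z + dist y z"
        using norm_triangle_ineq2[of y z] by (simp add: dist_norm)
      then show "cmod y \<le> \<rho>" using that(2) by linarith
    qed
  qed (use \<rho> in auto)
  then show ?thesis using that by blast
qed

end

section \<open>Isomorphisms between the algebras of two embedded discs\<close>

lemma alg_iso_inv_into:
  assumes iso: "alg_iso M N \<phi>"
    and add: "\<And>g h. g \<in> M \<Longrightarrow> h \<in> M \<Longrightarrow> (\<lambda>x. g x + h x) \<in> M"
    and scale: "\<And>c h. h \<in> M \<Longrightarrow> (\<lambda>x. c * h x) \<in> M"
    and mult: "\<And>g h. g \<in> M \<Longrightarrow> h \<in> M \<Longrightarrow> (\<lambda>x. g x * h x) \<in> M"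
  shows "alg_iso N M (inv_into M \<phi>)"
proof -
  let ?\<psi> = "inv_into M \<phi>"
  have bij: "bij_betw \<phi> M N" using iso by (simp add: alg_iso_def)
  have mem: "?\<psi> h \<in> M" and inv: "\<phi> (?\<psi> h) = h" if "h \<in> N" for h
    using that bij by (auto simp: bij_betw_def inv_into_into f_inv_into_f)
  have eq: "?\<psi> k = h" if "h \<in> M" "\<phi> h = k" for h k
    using that bij by (auto simp: bij_betw_def inv_into_f_f)
  show ?thesis
    unfolding alg_iso_def
  proof (intro conjI ballI allI)
    show "bij_betw ?\<psi> N M" by (rule bij_betw_inv_into[OF bij])
  next
    fix g h assume "g \<in> N" "h \<in> N"
    then show "?\<psi> (\<lambda>x. g x + h x) = (\<lambda>y. ?\<psi> g y + ?\<psi> h y)"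
      using iso by (intro eq add mem) (simp_all add: alg_iso_def mem inv)
    from \<open>g \<in> N\<close> \<open>h \<in> N\<close> show "?\<psi> (\<lambda>x. g x * h x) = (\<lambda>y. ?\<psi> g y * ?\<psi> h y)"
      using iso by (intro eq mult mem) (simp_all add: alg_iso_def mem inv)
  next
    fix c h assume "h \<in> N"
    then show "?\<psi> (\<lambda>x. c * h x) = (\<lambda>y. c * ?\<psi> h y)"
      using iso by (intro eq scale mem) (simp_all add: alg_iso_def mem inv)
  qed
qed

locale two_disc_embeddings =
  A: disc_embedding H ip b f a + B: disc_embedding H ip b' f' a'
  for H ip b f a b' f' a'
begin

lemma natural_map_f':
  "cmod w \<le> 1 \<Longrightarrow> comp_op B.X (f \<circ> inv_into (cball 0 1) f') h (f' w) = h (f w)"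
  by (simp add: comp_op_def fun_on_def)

text \<open>Read on the closed disc, the natural map is \<open>m \<mapsto> m\<close>: both \<open>h\<close> and its image have the same composition
  with \<open>f\<close> and \<open>f'\<close> respectively.\<close>

theorem natural_map_iso_iff:
  "alg_iso A.MX B.MX (comp_op B.X (f \<circ> inv_into (cball 0 1) f')) \<longleftrightarrow>
    weighted_multipliers a = weighted_multipliers a'" (is "alg_iso _ _ ?N \<longleftrightarrow> _")
proof
  have td: "B.to_disc (?N h) = A.to_disc h" for h
    by (auto simp: A.to_disc_eq B.to_disc_eq natural_map_f')
  have off: "?N h v = 0" if "v \<notin> B.X" for h v
    using that by (simp add: comp_op_def fun_on_def)
  {
    assume "alg_iso A.MX B.MX ?N"
    then have img: "?N ` A.MX = B.MX" by (simp add: alg_iso_def bij_betw_def)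
    show "weighted_multipliers a = weighted_multipliers a'"
    proof (intro equalityI subsetI)
      fix m assume m: "m \<in> weighted_multipliers a"
      then have "?N (A.from_disc m) \<in> B.MX" using img A.from_disc_mem_MX(1) by blast
      then show "m \<in> weighted_multipliers a'"
        using td[of "A.from_disc m"] A.from_disc_mem_MX(2)[OF m] by (simp add: B.mem_MX)
    next
      fix m assume m: "m \<in> weighted_multipliers a'"
      then obtain h where "h \<in> A.MX" "B.from_disc m = ?N h"
        using img B.from_disc_mem_MX(1) by blast
      then show "m \<in> weighted_multipliers a"
        using td[of h] B.from_disc_mem_MX(2)[OF m] by (simp add: A.mem_MX)
    qed
  next
    assume eq: "weighted_multipliers a = weighted_multipliers a'"
    have "bij_betw ?N A.MX B.MX"
      unfolding bij_betw_def
    proof (intro conjI inj_onI equalityI subsetI)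
      fix g h assume gh: "g \<in> A.MX" "h \<in> A.MX" "?N g = ?N h"
      then have "A.to_disc g = A.to_disc h" using td by metis
      then show "g = h" using gh A.MX_off by (intro A.eq_if_to_disc_eq) auto
    next
      fix k assume "k \<in> ?N ` A.MX"
      then obtain h where "h \<in> A.MX" "k = ?N h" by blast
      then show "k \<in> B.MX" by (simp add: B.mem_MX A.mem_MX td off eq)
    next
      fix k assume k: "k \<in> B.MX"
      then have m: "B.to_disc k \<in> weighted_multipliers a" by (simp add: B.mem_MX eq)
      have "k = ?N (A.from_disc (B.to_disc k))"
        using B.MX_off[OF k] A.from_disc_mem_MX(2)[OF m] off
        by (intro B.eq_if_to_disc_eq) (auto simp: td)
      then show "k \<in> ?N ` A.MX" using A.from_disc_mem_MX(1)[OF m] by blast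
    qed
    then show "alg_iso A.MX B.MX ?N"
      by (auto simp: alg_iso_def comp_op_def fun_on_def)
  }
qed

text \<open>The pullback of the evaluation at \<open>f' w\<close>. It is unital because \<open>\<phi>\<close> is onto: \<open>\<phi> 1\<close> acts as an identity on
  the element \<open>u\<close> that is mapped to the constant \<open>1\<close>.\<close>

lemma character_of_iso:
  assumes iso: "alg_iso A.MX B.MX \<phi>" and w: "cmod w \<le> 1"
  shows "disc_character a (\<lambda>m. \<phi> (A.from_disc m) (f' w))"
proof
  have fd_add: "A.from_disc (\<lambda>z. g z + h z) = (\<lambda>v. A.from_disc g v + A.from_disc h v)"
    and fd_mult: "A.from_disc (\<lambda>z. g z * h z) = (\<lambda>v. A.from_disc g v * A.from_disc h v)"
    and fd_scale: "A.from_disc (\<lambda>z. c * h z) = (\<lambda>v. c * A.from_disc h v)" for g h c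
    by (auto simp: A.from_disc_def comp_op_def fun_on_def)
  show "\<phi> (A.from_disc (\<lambda>z. g z + h z)) (f' w) = \<phi> (A.from_disc g) (f' w) + \<phi> (A.from_disc h) (f' w)"
    "\<phi> (A.from_disc (\<lambda>z. g z * h z)) (f' w) = \<phi> (A.from_disc g) (f' w) * \<phi> (A.from_disc h) (f' w)"
    if "g \<in> weighted_multipliers a" "h \<in> weighted_multipliers a" for g h
    using iso A.from_disc_mem_MX(1)[OF that(1)] A.from_disc_mem_MX(1)[OF that(2)]
    unfolding fd_add fd_mult alg_iso_def by simp_all
  show "\<phi> (A.from_disc (\<lambda>z. c * h z)) (f' w) = c * \<phi> (A.from_disc h) (f' w)"
    if "h \<in> weighted_multipliers a" for c h
    using iso A.from_disc_mem_MX(1)[OF that] unfolding fd_scale alg_iso_def by simp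
  let ?one = "A.from_disc (fun_on (cball 0 1) (\<lambda>z. 1))"
  have one: "?one \<in> A.MX" by (rule A.from_disc_mem_MX(1)[OF A.one_multiplier])
  have "B.from_disc (fun_on (cball 0 1) (\<lambda>z. 1)) \<in> B.MX"
    by (rule B.from_disc_mem_MX(1)[OF B.one_multiplier])
  moreover have "\<phi> ` A.MX = B.MX" using iso by (simp add: alg_iso_def bij_betw_def)
  ultimately obtain u where u: "u \<in> A.MX" "\<phi> u = B.from_disc (fun_on (cball 0 1) (\<lambda>z. 1))"
    by force
  have "(\<lambda>v. ?one v * u v) = u"
  proof
    fix v show "?one v * u v = u v"
      by (cases "v \<in> A.X") (auto elim!: A.XE simp: A.from_disc_f A.MX_off[OF u(1)] fun_on_def)
  qed
  moreover have "\<phi> (\<lambda>v. ?one v * u v) = (\<lambda>y. \<phi> ?one y * \<phi> u y)"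
    using iso one u(1) by (simp add: alg_iso_def)
  ultimately have "\<phi> u (f' w) = \<phi> ?one (f' w) * \<phi> u (f' w)" by (metis (no_types))
  then show "\<phi> ?one (f' w) = 1"
    using w by (simp add: u(2) B.from_disc_f fun_on_def)
qed

text \<open>All characters of the first algebra are evaluations, so \<open>\<phi>\<close> is composition with \<open>\<theta> = \<phi>(z)\<close>. For the second
  algebra, whose characters are not known to be evaluations, only the spectrum of \<open>z\<close> is used: it
  bounds \<open>g = \<phi>\<^sup>-\<^sup>1(z)\<close> by \<open>1\<close>. Evaluating \<open>\<phi> g = z\<close> gives \<open>g \<circ> \<theta> = id\<close>.\<close>

theorem isomorphism_from_algebra:
  assumes conv: "disc_algebra_weight a C" and iso: "alg_iso A.MX B.MX \<phi>"
  obtains \<theta> g where "moebius_map \<theta>" "continuous_on (cball 0 1) g"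
    "\<theta> ` cball 0 1 \<subseteq> cball 0 1" "g ` cball 0 1 \<subseteq> cball 0 1" "\<theta> ` ball 0 1 \<subseteq> ball 0 1"
    "\<And>w. w \<in> cball 0 1 \<Longrightarrow> g (\<theta> w) = w" "\<And>v. v \<in> cball 0 1 \<Longrightarrow> \<theta> (g v) = v"
    "\<And>h w. h \<in> A.MX \<Longrightarrow> w \<in> cball 0 1 \<Longrightarrow> \<phi> h (f' w) = h (f (\<theta> w))"
proof -
  interpret swap: two_disc_embeddings H ip b' f' a' b f a ..
  define \<psi> where "\<psi> = inv_into A.MX \<phi>"
  have iso': "alg_iso B.MX A.MX \<psi>"
    unfolding \<psi>_def by (rule alg_iso_inv_into[OF iso A.MX_add A.MX_scale A.MX_mult])
  let ?id = "fun_on (cball 0 1) (\<lambda>z::complex. z)"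
  have bij: "bij_betw \<phi> A.MX B.MX" using iso by (simp add: alg_iso_def)
  have idA: "A.from_disc ?id \<in> A.MX" by (rule A.from_disc_mem_MX(1)[OF A.coordinate_multiplier])
  have idB: "B.from_disc ?id \<in> B.MX" by (rule B.from_disc_mem_MX(1)[OF B.coordinate_multiplier])
  define \<theta> where "\<theta> = B.to_disc (\<phi> (A.from_disc ?id))"
  define g where "g = A.to_disc (\<psi> (B.from_disc ?id))"
  have gm: "\<psi> (B.from_disc ?id) \<in> A.MX"
    using iso' idB by (auto simp: alg_iso_def bij_betw_def)
  have "\<theta> \<in> disc_algebra"
    unfolding \<theta>_def using B.to_disc_MX_disc_algebra iso idA by (auto simp: alg_iso_def bij_betw_def)
  then have \<theta>: "continuous_on (cball 0 1) \<theta>" "\<theta> holomorphic_on ball 0 1" by (auto simp: disc_algebra_def)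
  have "g \<in> disc_algebra"
    unfolding g_def using A.to_disc_MX_disc_algebra gm by blast
  then have g: "continuous_on (cball 0 1) g" "g holomorphic_on ball 0 1" by (auto simp: disc_algebra_def)
  have comp: "cmod (\<theta> w) \<le> 1" "\<And>h. h \<in> A.MX \<Longrightarrow> \<phi> h (f' w) = h (f (\<theta> w))"
    if w: "cmod w \<le> 1" for w
  proof -
    interpret disc_character a "\<lambda>m. \<phi> (A.from_disc m) (f' w)" by (rule character_of_iso[OF iso w])
    interpret disc_algebra_character a "\<lambda>m. \<phi> (A.from_disc m) (f' w)" C
      by (intro disc_algebra_character.intro disc_character_axioms conv)
    have \<theta>w: "\<theta> w = \<phi> (A.from_disc ?id) (f' w)" using w by (simp add: \<theta>_def B.to_disc_eq)
    show le: "cmod (\<theta> w) \<le> 1" unfolding \<theta>w by (rule character_coordinate_le_1)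
    fix h assume h: "h \<in> A.MX"
    then have m: "A.to_disc h \<in> weighted_multipliers a" by (simp add: A.mem_MX)
    have "A.from_disc (A.to_disc h) = h"
      using A.MX_off[OF h] A.from_disc_mem_MX(2)[OF m]
      by (intro A.eq_if_to_disc_eq) (auto simp: A.from_disc_off)
    then show "\<phi> h (f' w) = h (f (\<theta> w))"
      using character_is_evaluation[OF m] le by (simp add: \<theta>w[symmetric] A.to_disc_eq)
  qed
  have g_le: "cmod (g v) \<le> 1" if v: "cmod v \<le> 1" for v
  proof -
    interpret disc_character a' "\<lambda>m. \<psi> (B.from_disc m) (f v)" by (rule swap.character_of_iso[OF iso' v])
    show ?thesis using character_coordinate_le_1 v by (simp add: g_def A.to_disc_eq)
  qed
  have g_\<theta>: "g (\<theta> w) = w" if "w \<in> cball 0 1" for w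
  proof -
    have "\<phi> (\<psi> (B.from_disc ?id)) = B.from_disc ?id"
      unfolding \<psi>_def using bij idB by (simp add: bij_betw_def f_inv_into_f)
    then have "\<psi> (B.from_disc ?id) (f (\<theta> w)) = B.from_disc ?id (f' w)"
      using comp(2)[OF _ gm, of w] that by simp
    then show ?thesis
      using that comp(1)[of w] by (simp add: g_def A.to_disc_eq B.from_disc_f fun_on_def)
  qed
  have into: "\<theta> ` cball 0 1 \<subseteq> cball 0 1" "g ` cball 0 1 \<subseteq> cball 0 1"
    using comp(1) g_le by auto
  note * = disc_self_map_with_left_inverse[OF \<theta> into(1) g into(2) g_\<theta>]
  show ?thesis
    by (rule that[of \<theta> g]) (use * g into g_\<theta> comp in auto)
qed

text \<open>On a ball about \<open>f' w\<close> the first coordinate, divided by \<open>b'\<^sub>1\<close>, stays in the open disc. Therefore the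
  formula itself defines the local holomorphic extension.\<close>

lemma composite_holomorphic:
  assumes \<theta>: "\<theta> holomorphic_on ball 0 1" "\<theta> ` ball 0 1 \<subseteq> ball 0 1"
  shows "holomorphic_on_subset (f \<circ> \<theta> \<circ> B.\<zeta>) (f' ` ball 0 1)"
  unfolding holomorphic_on_subset_def
proof
  fix p assume "p \<in> f' ` ball 0 1"
  then obtain w where w: "cmod w < 1" "p = f' w" by auto
  have b1: "0 < cmod (b' 1)" using B.b_1 by simp
  \<comment> \<open>\<open>\<zeta>\<close> has Lipschitz constant \<open>1 / \<bar>b'\<^sub>1\<bar>\<close>, and \<open>w\<close> has distance \<open>1 - \<bar>w\<bar>\<close> from the circle.\<close>
  define e where "e = cmod (b' 1) * (1 - cmod w)"
  have e: "0 < e" using b1 w(1) by (simp add: e_def)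
  have in_ball: "cmod (B.\<zeta> x) < 1" if "x \<in> ball p e" for x
  proof -
    have "B.\<zeta> x - w = coord (x - p) 0 / b' 1"
      using w B.\<zeta>_f[of w] by (simp add: B.\<zeta>_def diff_divide_distrib)
    then have "cmod (B.\<zeta> x - w) \<le> norm (x - p) / cmod (b' 1)"
      by (simp add: norm_divide divide_right_mono norm_coord_le del: coord_minus)
    also have "\<dots> < 1 - cmod w"
      using that b1 by (simp add: e_def dist_norm norm_minus_commute field_simps)
    finally show ?thesis using norm_triangle_sub[of "B.\<zeta> x" w] by linarith
  qed
  have "holomorphic_on_open (f \<circ> \<theta> \<circ> B.\<zeta>) (ball p e)"
    unfolding holomorphic_on_open_def
  proof
    fix x assume x: "x \<in> ball p e"
    let ?z = "B.\<zeta> x"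
    have z: "?z \<in> ball 0 1" using in_ball[OF x] by simp
    then have "cmod (\<theta> ?z) < 1" using \<theta>(2) by (simp add: image_subset_iff)
    then obtain d where d: "(f has_derivative (\<lambda>h. ell2_scale h d)) (at (\<theta> ?z))"
      by (rule A.f_derivative)
    obtain t where "(\<theta> has_field_derivative t) (at ?z)"
      using holomorphic_onD[OF \<theta>(1) z] z
      by (auto simp: field_differentiable_def at_within_open[OF z open_ball])
    then have t: "(\<theta> has_derivative (\<lambda>h. t * h)) (at ?z)"
      by (simp add: has_field_derivative_def)
    have bl: "bounded_linear B.\<zeta>"
      by (rule bounded_linear_intro[where K = "1 / cmod (b' 1)"])
         (auto simp: B.\<zeta>_def add_divide_distrib scaleR_conv_of_real norm_divide intro: divide_right_mono norm_coord_le)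
    have "(B.\<zeta> has_derivative B.\<zeta>) (at x)" by (rule bounded_linear_imp_has_derivative[OF bl])
    from diff_chain_at[OF diff_chain_at[OF this t] d[folded o_apply[of \<theta> B.\<zeta> x]]]
    have "(f \<circ> (\<theta> \<circ> B.\<zeta>) has_derivative (\<lambda>h. ell2_scale h d) \<circ> ((\<lambda>h. t * h) \<circ> B.\<zeta>)) (at x)" .
    moreover have "((\<lambda>h. ell2_scale h d) \<circ> ((\<lambda>h. t * h) \<circ> B.\<zeta>)) (ell2_scale c v)
        = ell2_scale c (((\<lambda>h. ell2_scale h d) \<circ> ((\<lambda>h. t * h) \<circ> B.\<zeta>)) v)" for c v
      by (rule ell2_eqI) (simp add: B.\<zeta>_def)
    ultimately show "\<exists>D. (f \<circ> \<theta> \<circ> B.\<zeta> has_derivative D) (at x) \<and> (\<forall>c v. D (ell2_scale c v) = ell2_scale c (D v))"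
      by (metis comp_assoc)
  qed
  then show "\<exists>e>0. \<exists>G. holomorphic_on_open G (ball p e) \<and> (\<forall>x\<in>f' ` ball 0 1 \<inter> ball p e. (f \<circ> \<theta> \<circ> B.\<zeta>) x = G x)"
    using e by blast
qed

text \<open>With \<open>\<theta>\<close> at hand, \<open>F = f \<circ> \<theta> \<circ> f'\<^sup>-\<^sup>1\<close>. For the last claim, invariance says that composition with \<open>\<theta>\<close> maps
  the multipliers for \<open>a\<close> onto themselves, while \<open>\<phi>\<close> says that it maps them onto the multipliers for
  \<open>a'\<close>.\<close>

theorem algebra_isomorphisms_are_compositions:
  assumes conv: "disc_algebra_weight a C" and invariant: "automorphism_invariant A.MX f"
    and iso: "alg_iso A.MX B.MX \<phi>"
  shows "(\<exists>F. (\<forall>w\<in>B.X. F w \<in> A.X \<and> pullback A.MX \<phi> (point_eval B.MX w) = point_eval A.MX (F w)) \<and>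
             (\<exists>F'. homeomorphism B.X A.X F F') \<and>
             holomorphic_on_subset F (f' ` ball 0 1) \<and>
             (\<forall>h\<in>A.MX. \<phi> h = comp_op B.X F h))" (is ?F)
    and "(\<exists>\<theta>. moebius_map \<theta> \<and>
             comp_op (cball 0 1) \<theta> \<in> disc_algebra \<rightarrow> disc_algebra \<and>
             (\<forall>h\<in>A.MX. B.to_disc (\<phi> h) = comp_op (cball 0 1) \<theta> (A.to_disc h)))" (is ?\<theta>)
    and "weighted_multipliers a = weighted_multipliers a'"
proof -
  obtain \<theta> g where moebius: "moebius_map \<theta>" and g: "continuous_on (cball 0 1) g"
    and into: "\<theta> ` cball 0 1 \<subseteq> cball 0 1" "g ` cball 0 1 \<subseteq> cball 0 1" "\<theta> ` ball 0 1 \<subseteq> ball 0 1"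
    and g_\<theta>: "\<And>w. w \<in> cball 0 1 \<Longrightarrow> g (\<theta> w) = w" and \<theta>_g: "\<And>v. v \<in> cball 0 1 \<Longrightarrow> \<theta> (g v) = v"
    and comp: "\<And>h w. h \<in> A.MX \<Longrightarrow> w \<in> cball 0 1 \<Longrightarrow> \<phi> h (f' w) = h (f (\<theta> w))"
    using isomorphism_from_algebra[OF conv iso] by blast
  have \<theta>: "continuous_on (cball 0 1) \<theta>" "\<theta> holomorphic_on ball 0 1"
    using moebius by (auto simp: moebius_map_def)
  have \<theta>_le: "cmod (\<theta> w) \<le> 1" if "cmod w \<le> 1" for w using into(1) that by (simp add: image_subset_iff)
  have g_le: "cmod (g w) \<le> 1" if "cmod w \<le> 1" for w using into(2) that by (simp add: image_subset_iff)
  have bij: "bij_betw \<phi> A.MX B.MX" using iso by (simp add: alg_iso_def)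
  have \<phi>_mem: "\<phi> h \<in> B.MX" if "h \<in> A.MX" for h using bij that by (auto simp: bij_betw_def)
  define F where "F = f \<circ> \<theta> \<circ> B.\<zeta>"
  define F' where "F' = f' \<circ> g \<circ> A.\<zeta>"
  have F: "F (f' w) = f (\<theta> w)" if "cmod w \<le> 1" for w using that by (simp add: F_def)
  have F': "F' (f v) = f' (g v)" if "cmod v \<le> 1" for v using that by (simp add: F'_def)
  have homeo: "homeomorphism B.X A.X F F'"
  proof (rule homeomorphismI)
    have \<zeta>X: "B.\<zeta> ` B.X \<subseteq> cball 0 1" "A.\<zeta> ` A.X \<subseteq> cball 0 1"
      by (auto elim!: A.XE B.XE)
    have c: "continuous_on B.X (\<theta> \<circ> B.\<zeta>)" "(\<theta> \<circ> B.\<zeta>) ` B.X \<subseteq> cball 0 1"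
      using \<zeta>X(1) into(1) continuous_on_compose[OF B.continuous_\<zeta> continuous_on_subset[OF \<theta>(1) \<zeta>X(1)]]
      by auto
    show "continuous_on B.X F"
      using continuous_on_compose[OF c(1) continuous_on_subset[OF A.continuous_f c(2)]]
      by (simp add: F_def o_assoc)
    have c': "continuous_on A.X (g \<circ> A.\<zeta>)" "(g \<circ> A.\<zeta>) ` A.X \<subseteq> cball 0 1"
      using \<zeta>X(2) into(2) continuous_on_compose[OF A.continuous_\<zeta> continuous_on_subset[OF g \<zeta>X(2)]]
      by auto
    show "continuous_on A.X F'"
      using continuous_on_compose[OF c'(1) continuous_on_subset[OF B.continuous_f c'(2)]]
      by (simp add: F'_def o_assoc)
    show "F ` B.X \<subseteq> A.X" "F' ` A.X \<subseteq> B.X"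
      by (auto elim!: A.XE B.XE simp: F F' \<theta>_le g_le)
    show "F' (F v) = v" if "v \<in> B.X" for v
      using that by (auto elim!: B.XE simp: F F' \<theta>_le g_\<theta>)
    show "F (F' v) = v" if "v \<in> A.X" for v
      using that by (auto elim!: A.XE simp: F F' g_le \<theta>_g)
  qed
  have \<phi>F: "\<phi> h w = h (F w)" if "h \<in> A.MX" "w \<in> B.X" for h w
    using that comp by (auto elim!: B.XE simp: F)
  show ?F
  proof (rule exI[of _ F], intro conjI ballI)
    fix w assume w: "w \<in> B.X"
    then show "F w \<in> A.X" by (auto elim!: B.XE simp: F \<theta>_le)
    show "pullback A.MX \<phi> (point_eval B.MX w) = point_eval A.MX (F w)"
      using w \<phi>_mem \<phi>F by (auto simp: pullback_def point_eval_def fun_eq_iff restrict_def)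
  next
    show "\<exists>F'. homeomorphism B.X A.X F F'" using homeo by blast
    show "holomorphic_on_subset F (f' ` ball 0 1)"
      unfolding F_def by (rule composite_holomorphic[OF \<theta>(2) into(3)])
    show "\<phi> h = comp_op B.X F h" if "h \<in> A.MX" for h
      using \<phi>F[OF that] B.MX_off[OF \<phi>_mem[OF that]] by (auto simp: comp_op_def fun_on_def)
  qed
  have td: "B.to_disc (\<phi> h) w = A.to_disc h (\<theta> w)" if "h \<in> A.MX" "cmod w \<le> 1" for h w
    using that comp \<theta>_le by (simp add: A.to_disc_eq B.to_disc_eq)
  show ?\<theta>
  proof (rule exI[of _ \<theta>], intro conjI moebius funcsetI ballI)
    fix k :: "complex \<Rightarrow> complex" assume k: "k \<in> disc_algebra"
    have "continuous_on (cball 0 1) (k \<circ> \<theta>)"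
      using k by (intro continuous_on_compose[OF \<theta>(1)] continuous_on_subset[OF _ into(1)])
        (simp add: disc_algebra_def)
    then have 1: "continuous_on (cball 0 1) (comp_op (cball 0 1) \<theta> k)"
      by (rule continuous_on_eq) (simp add: comp_op_def fun_on_def)
    have "k \<circ> \<theta> holomorphic_on ball 0 1"
      using k by (intro holomorphic_on_compose_gen[OF \<theta>(2) _ into(3)]) (simp add: disc_algebra_def)
    then have 2: "comp_op (cball 0 1) \<theta> k holomorphic_on ball 0 1"
      by (rule holomorphic_transform) (simp add: comp_op_def fun_on_def)
    show "comp_op (cball 0 1) \<theta> k \<in> disc_algebra"
      using 1 2 by (simp add: disc_algebra_def comp_op_def fun_on_def)
  next
    fix h assume h: "h \<in> A.MX"
    show "B.to_disc (\<phi> h) = comp_op (cball 0 1) \<theta> (A.to_disc h)"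
      using td[OF h] by (auto simp: fun_eq_iff comp_op_def fun_on_def B.to_disc_eq)
  qed
  show "weighted_multipliers a = weighted_multipliers a'"
  proof -
    let ?A = "comp_op A.X (f \<circ> \<theta> \<circ> inv_into (cball 0 1) f)"
    have "alg_iso A.MX A.MX ?A"
      using invariant moebius by (simp add: automorphism_invariant_def A.X_def)
    then have img: "?A ` A.MX = A.MX" by (simp add: alg_iso_def bij_betw_def)
    have tdA: "A.to_disc (?A h) = B.to_disc (\<phi> h)" if "h \<in> A.MX" for h
      using td[OF that] \<theta>_le
      by (auto simp: fun_eq_iff A.to_disc_eq B.to_disc_eq comp_op_def fun_on_def)
    show ?thesis
    proof (intro equalityI subsetI)
      fix m assume m: "m \<in> weighted_multipliers a"
      then obtain h where h: "h \<in> A.MX" "A.from_disc m = ?A h"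
        using img A.from_disc_mem_MX(1)[OF m] by blast
      then have "m = B.to_disc (\<phi> h)"
        using tdA[OF h(1)] A.from_disc_mem_MX(2)[OF m] by simp
      then show "m \<in> weighted_multipliers a'" using \<phi>_mem[OF h(1)] by (simp add: B.mem_MX)
    next
      fix m assume m: "m \<in> weighted_multipliers a'"
      then obtain h where h: "h \<in> A.MX" "B.from_disc m = \<phi> h"
        using bij B.from_disc_mem_MX(1)[OF m] by (auto simp: bij_betw_def)
      then have "m = A.to_disc (?A h)"
        using tdA[OF h(1)] B.from_disc_mem_MX(2)[OF m] by simp
      moreover have "?A h \<in> A.MX" using img h(1) by blast
      ultimately show "m \<in> weighted_multipliers a" by (simp add: A.mem_MX)
    qed
  qed
qed

end

lemma disc_embeddingI:
  fixes b :: "nat \<Rightarrow> complex" and a :: "nat \<Rightarrow> real"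
  assumes "drury_arveson_space H ip"
    and b_norm: "summable (\<lambda>n. (cmod (b (Suc n)))\<^sup>2)" "sqrt (\<Sum>n. (cmod (b (Suc n)))\<^sup>2) < 1"
    and "f \<in> cball 0 1 \<rightarrow> ball 0 1"
      "\<And>z n. z \<in> cball 0 1 \<Longrightarrow> coord (f z) n = b (Suc n) * z ^ Suc n"
    and b1: "b 1 \<noteq> 0"
    and radius: "conv_radius (\<lambda>n. if n = 0 then 0 else (cmod (b n))\<^sup>2) = 1"
    and a: "\<And>z :: complex. z \<in> ball 0 1 \<Longrightarrow> (\<lambda>n. of_real (a n) * z ^ n) sums
      inverse (1 - (\<Sum>n. of_real ((cmod (b (Suc n)))\<^sup>2) * z ^ Suc n))"
  shows "disc_embedding H ip b f a"
proof (intro disc_embedding.intro renewal_sequence.intro assms)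
  show lt: "(\<Sum>n. (cmod (b (Suc n)))\<^sup>2) < 1"
    using b_norm(2) by simp
  show "a 0 = 1" "a (Suc n) = (\<Sum>i\<le>n. (cmod (b (Suc i)))\<^sup>2 * a (n - i))" for n
    using renewal_recursion_of_reciprocal[of "\<lambda>n. (cmod (b n))\<^sup>2" a, OF b_norm(1) _ lt a] by simp_all
  show "0 < (cmod (b 1))\<^sup>2" using b1 by simp
  show "\<exists>N\<ge>1. t ^ N \<le> (cmod (b N))\<^sup>2" if "0 < t" "t < 1" for t
    using not_dominated_if_conv_radius_1[OF radius _ that] by auto
qed auto

theorem theorem8p5:
  fixes H :: "(ell2 \<Rightarrow> complex) set"
    and ip :: "(ell2 \<Rightarrow> complex) \<Rightarrow> (ell2 \<Rightarrow> complex) \<Rightarrow> complex"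
    and b b' :: "nat \<Rightarrow> complex"
    and r r' :: real
    and f f' :: "complex \<Rightarrow> ell2"
    and X Y W :: "ell2 set"
    and a a' :: "nat \<Rightarrow> real"
    and MX MY :: "(ell2 \<Rightarrow> complex) set"
  assumes DA: "drury_arveson_space H ip"
    and b_norm: "summable (\<lambda>n. (cmod (b (Suc n)))\<^sup>2)"
      "sqrt (\<Sum>n. (cmod (b (Suc n)))\<^sup>2) = r" "r < 1"
    and b'_norm: "summable (\<lambda>n. (cmod (b' (Suc n)))\<^sup>2)"
      "sqrt (\<Sum>n. (cmod (b' (Suc n)))\<^sup>2) = r'" "r' < 1"
    and f: "f \<in> cball 0 1 \<rightarrow> ball 0 1"
      "\<And>z n. z \<in> cball 0 1 \<Longrightarrow> coord (f z) n = b (Suc n) * z ^ Suc n"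
    and f': "f' \<in> cball 0 1 \<rightarrow> ball 0 1"
      "\<And>z n. z \<in> cball 0 1 \<Longrightarrow> coord (f' z) n = b' (Suc n) * z ^ Suc n"
    and nonzero: "b 1 * b' 1 \<noteq> 0"
    and radius: "conv_radius (\<lambda>n. if n = 0 then 0 else (cmod (b n))\<^sup>2) = 1"
      "conv_radius (\<lambda>n. if n = 0 then 0 else (cmod (b' n))\<^sup>2) = 1"
    and X: "X = f ` cball 0 1"
    and Y: "Y = f' ` cball 0 1"
    and W: "W = f' ` ball 0 1"
    and a: "\<And>z :: complex. z \<in> ball 0 1 \<Longrightarrow> (\<lambda>n. of_real (a n) * z ^ n) sums
      inverse (1 - (\<Sum>n. of_real ((cmod (b (Suc n)))\<^sup>2) * z ^ Suc n))"
    and a': "\<And>z :: complex. z \<in> ball 0 1 \<Longrightarrow> (\<lambda>n. of_real (a' n) * z ^ n) sums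
      inverse (1 - (\<Sum>n. of_real ((cmod (b' (Suc n)))\<^sup>2) * z ^ Suc n))"
    and MX: "MX = multiplier_algebra H ip X"
    and MY: "MY = multiplier_algebra H ip Y"
  shows
    "(alg_iso MX MY (comp_op Y (f \<circ> inv_into (cball 0 1) f')) \<longleftrightarrow> comparable a a') \<and>
     (\<forall>\<phi>. bdd_above ((\<lambda>n. \<Sum>k=0..n. a k * a (n - k) / a n) ` {1..}) \<and>
        automorphism_invariant MX f \<and> alg_iso MX MY \<phi> \<longrightarrow>
        inj_on (point_eval MX) X \<and> point_eval MX ` X \<subseteq> character_space MX \<and>
        inj_on (point_eval MY) Y \<and> point_eval MY ` Y \<subseteq> character_space MY \<and>
        (\<exists>F. (\<forall>w\<in>Y. F w \<in> X \<and> pullback MX \<phi> (point_eval MY w) = point_eval MX (F w)) \<and>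
             (\<exists>F'. homeomorphism Y X F F') \<and>
             holomorphic_on_subset F W \<and>
             (\<forall>h\<in>MX. \<phi> h = comp_op Y F h)) \<and>
        comp_op (cball 0 1) f \<in> MX \<rightarrow> disc_algebra \<and>
        comp_op (cball 0 1) f' \<in> MY \<rightarrow> disc_algebra \<and>
        (\<exists>\<theta>. moebius_map \<theta> \<and>
             comp_op (cball 0 1) \<theta> \<in> disc_algebra \<rightarrow> disc_algebra \<and>
             (\<forall>h\<in>MX. comp_op (cball 0 1) f' (\<phi> h) =
                      comp_op (cball 0 1) \<theta> (comp_op (cball 0 1) f h))) \<and>
        alg_iso MX MY (comp_op Y (f \<circ> inv_into (cball 0 1) f')))"
proof -
  interpret two_disc_embeddings H ip b f a b' f' a'
  proof (rule two_disc_embeddings.intro)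
    show "disc_embedding H ip b f a"
      by (rule disc_embeddingI) (use DA b_norm f nonzero radius a in auto)
    show "disc_embedding H ip b' f' a'"
      by (rule disc_embeddingI) (use DA b'_norm f' nonzero radius a' in auto)
  qed
  have XA: "X = A.X" and YB: "Y = B.X" by (simp_all add: X Y A.X_def B.X_def)
  have MXA: "MX = A.MX" and MYB: "MY = B.MX" by (simp_all add: MX MY A.MX_def B.MX_def XA YB)
  have conv: "disc_algebra_weight a C"
    if C: "\<And>n. n \<ge> 1 \<Longrightarrow> (\<Sum>k=0..n. a k * a (n - k) / a n) \<le> C" "1 \<le> C" for C
  proof
    show "(\<Sum>k\<le>n. a k * a (n - k)) \<le> C * a n" for n
    proof (cases "n = 0")
      case False
      then show ?thesis
        using C(1)[of n] A.a_pos[of n]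
        by (simp add: sum_divide_distrib[symmetric] atLeast0AtMost field_simps)
    qed (use C(2) in \<open>simp add: A.a_0\<close>)
  qed
  show ?thesis
    unfolding XA YB MXA MYB W
  proof (intro conjI allI impI)
    show "alg_iso A.MX B.MX (comp_op B.X (f \<circ> inv_into (cball 0 1) f')) \<longleftrightarrow> comparable a a'"
      unfolding natural_map_iso_iff
      by (rule multipliers_eq_iff_comparable[OF A.disc_weight_axioms B.disc_weight_axioms])
  next
    fix \<phi>
    assume *: "bdd_above ((\<lambda>n. \<Sum>k=0..n. a k * a (n - k) / a n) ` {1..}) \<and>
        automorphism_invariant A.MX f \<and> alg_iso A.MX B.MX \<phi>"
    then obtain C where "\<And>n. n \<ge> 1 \<Longrightarrow> (\<Sum>k=0..n. a k * a (n - k) / a n) \<le> C"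
      by (auto simp: bdd_above_def)
    then have "disc_algebra_weight a (max 1 C)"
      by (intro conv) (auto simp: le_max_iff_disj)
    note main = algebra_isomorphisms_are_compositions[OF this, of \<phi>, simplified A.to_disc_def B.to_disc_def]
    show "inj_on (point_eval A.MX) A.X" "inj_on (point_eval B.MX) B.X"
      "point_eval A.MX ` A.X \<subseteq> character_space A.MX" "point_eval B.MX ` B.X \<subseteq> character_space B.MX"
      by (rule A.inj_point_eval B.inj_point_eval A.point_eval_character B.point_eval_character)+
    show "comp_op (cball 0 1) f \<in> A.MX \<rightarrow> disc_algebra" "comp_op (cball 0 1) f' \<in> B.MX \<rightarrow> disc_algebra"
      using A.to_disc_MX_disc_algebra B.to_disc_MX_disc_algebra by (simp_all add: A.to_disc_def B.to_disc_def)
    show "\<exists>F. (\<forall>w\<in>B.X. F w \<in> A.X \<and> pullback A.MX \<phi> (point_eval B.MX w) = point_eval A.MX (F w)) \<and>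
             (\<exists>F'. homeomorphism B.X A.X F F') \<and>
             holomorphic_on_subset F (f' ` ball 0 1) \<and>
             (\<forall>h\<in>A.MX. \<phi> h = comp_op B.X F h)"
      using * by (intro main(1)) auto
    show "\<exists>\<theta>. moebius_map \<theta> \<and>
             comp_op (cball 0 1) \<theta> \<in> disc_algebra \<rightarrow> disc_algebra \<and>
             (\<forall>h\<in>A.MX. comp_op (cball 0 1) f' (\<phi> h) =
                      comp_op (cball 0 1) \<theta> (comp_op (cball 0 1) f h))"
      using * by (intro main(2)) auto
    show "alg_iso A.MX B.MX (comp_op B.X (f \<circ> inv_into (cball 0 1) f'))"
      unfolding natural_map_iso_iff using * by (intro main(3)) auto
  qed
qed

end
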